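(* Let $p\ge1$ be an integer and let $U$ denote the fundamental representation of $S^+(p,0)$. Then for all integers $k,l\ge0$ $$\mathrm{Hom}(U^{\otimes k};U^{\otimes l})=\mathrm{span}\{\widetilde T_\pi:\ \pi\in NC_\bullet(k,l)\}.$$
   Context: Index set: $\mathcal{J}_p=\{i\alpha:i\in\{0,1\},\alpha\in\{1,\dots,p\}\}$ with involution (conjugation) $\overline{i\alpha}=\bar i\alpha$, $\bar0=1,\bar1=0$. $(e_z)_{z\in\mathcal{J}_p}$ is the canonical basis of $\mathbb{C}^{2p}$. $S^+(p,0)$ is the compact quantum group with $C(S^+(p,0))=A_s(p,0)$, the universal unital $C^*$-algebra generated by orthogonal projections $U_{z,y}$ ($z,y\in\mathcal{J}_p$) such that $U=(U_{z,y})$ is unitary and $U_{z,y}=U^*_{\bar z,\bar y}$ for all $z,y$. The coproduct is $\Delta(U_{z,y})=\sum_xU_{z,x}\otimes U_{x,y}$, and $U$ is the fundamental representation. $U^{\otimes k}$ is the matrix indexed by $\mathcal{J}_p^k$ with entries $U_{z_1,y_1}\cdots U_{z_k,y_k}$ (with $U^{\otimes0}=1$). $\mathrm{Hom}(U^{\otimes k};U^{\otimes l})$ is the set of linear maps $T:(\mathbb{C}^{2p})^{\otimes k}\to(\mathbb{C}^{2p})^{\otimes l}$ with $(T\otimes1)U^{\otimes k}=U^{\otimes l}(T\otimes1)$. Bulleted partitions: $P_\bullet(k,l)$ is the collection of all partitions of $k$ upper and $l$ lower points (two rows) in which each point is marked with a black or white circle, where two marked partitions are identified if they have the same blocks and the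 markings differ by exchanging the two colours at all points of some of the blocks. $NC_\bullet(k,l)\subset P_\bullet(k,l)$ consists of those whose underlying partition is non-crossing. For $\pi\in P_\bullet(k,l)$, $i\in\mathcal{J}_p^k$, $j\in\mathcal{J}_p^l$ (placed left to right on the upper, resp. lower points), $\delta_\pi(^i_j)=1$ if for any two points in the same block of $\pi$ the corresponding indices are equal when the two points have the same colour and conjugate (exchanged by the bar) when the colours are different; $\delta_\pi(^i_j)=0$ otherwise. Then $$\widetilde T_\pi(e_{i_1}\otimes\cdots\otimes e_{i_k})=\sum_{j_1,\dots,j_l\in\mathcal{J}_p}\delta_\pi(^i_j)\,e_{j_1}\otimes\cdots\otimes e_{j_l}.$$ *)

theory Defs
  imports
    Complex_Main
    "HOL-Library.Disjoint_Sets"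
    "HOL-Library.FuncSet"
    "HOL-Library.Function_Algebras"
    "HOL-Algebra.Ring"
begin

section \<open>Unital C*-algebras\<close>

record 'a cstar = "'a ring" +
  cscale :: "complex \<Rightarrow> 'a \<Rightarrow> 'a"
  star :: "'a \<Rightarrow> 'a"
  cnorm :: "'a \<Rightarrow> real"

definition cstar_limit :: "'a cstar \<Rightarrow> (nat \<Rightarrow> 'a) \<Rightarrow> 'a \<Rightarrow> bool" where
  "cstar_limit A X a \<longleftrightarrow> (\<lambda>n. cnorm A (X n \<ominus>\<^bsub>A\<^esub> a)) \<longlonglongrightarrow> 0"

definition cstar_Cauchy :: "'a cstar \<Rightarrow> (nat \<Rightarrow> 'a) \<Rightarrow> bool" where
  "cstar_Cauchy A X \<longleftrightarrow> (\<forall>e>0. \<exists>N. \<forall>m\<ge>N. \<forall>n\<ge>N. cnorm A (X m \<ominus>\<^bsub>A\<^esub> X n) < e)"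

locale unital_cstar_algebra = ring A for A :: "'a cstar" (structure) +
  assumes cscale_closed: "x \<in> carrier A \<Longrightarrow> cscale A c x \<in> carrier A"
    and cscale_add_right:
      "x \<in> carrier A \<Longrightarrow> y \<in> carrier A \<Longrightarrow> cscale A c (x \<oplus> y) = cscale A c x \<oplus> cscale A c y"
    and cscale_add_left: "x \<in> carrier A \<Longrightarrow> cscale A (c + d) x = cscale A c x \<oplus> cscale A d x"
    and cscale_cscale: "x \<in> carrier A \<Longrightarrow> cscale A c (cscale A d x) = cscale A (c * d) x"
    and cscale_one: "x \<in> carrier A \<Longrightarrow> cscale A 1 x = x"
    and cscale_mult_left:
      "x \<in> carrier A \<Longrightarrow> y \<in> carrier A \<Longrightarrow> cscale A c x \<otimes> y = cscale A c (x \<otimes> y)"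
    and cscale_mult_right:
      "x \<in> carrier A \<Longrightarrow> y \<in> carrier A \<Longrightarrow> x \<otimes> cscale A c y = cscale A c (x \<otimes> y)"
    and star_closed: "x \<in> carrier A \<Longrightarrow> star A x \<in> carrier A"
    and star_star: "x \<in> carrier A \<Longrightarrow> star A (star A x) = x"
    and star_add: "x \<in> carrier A \<Longrightarrow> y \<in> carrier A \<Longrightarrow> star A (x \<oplus> y) = star A x \<oplus> star A y"
    and star_cscale: "x \<in> carrier A \<Longrightarrow> star A (cscale A c x) = cscale A (cnj c) (star A x)"
    and star_mult: "x \<in> carrier A \<Longrightarrow> y \<in> carrier A \<Longrightarrow> star A (x \<otimes> y) = star A y \<otimes> star A x"
    and cnorm_nonneg: "x \<in> carrier A \<Longrightarrow> 0 \<le> cnorm A x"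
    and cnorm_eq_0_iff: "x \<in> carrier A \<Longrightarrow> cnorm A x = 0 \<longleftrightarrow> x = \<zero>"
    and cnorm_cscale: "x \<in> carrier A \<Longrightarrow> cnorm A (cscale A c x) = cmod c * cnorm A x"
    and cnorm_triangle:
      "x \<in> carrier A \<Longrightarrow> y \<in> carrier A \<Longrightarrow> cnorm A (x \<oplus> y) \<le> cnorm A x + cnorm A y"
    and cnorm_mult:
      "x \<in> carrier A \<Longrightarrow> y \<in> carrier A \<Longrightarrow> cnorm A (x \<otimes> y) \<le> cnorm A x * cnorm A y"
    and cstar_identity: "x \<in> carrier A \<Longrightarrow> cnorm A (star A x \<otimes> x) = (cnorm A x)\<^sup>2"
    and cnorm_complete:
      "(\<And>n. X n \<in> carrier A) \<Longrightarrow> cstar_Cauchy A X \<Longrightarrow> \<exists>a\<in>carrier A. cstar_limit A X a"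

text \<open>Unital *-homomorphisms; between C*-algebras these are automatically contractive.\<close>

definition star_hom :: "'a cstar \<Rightarrow> 'b cstar \<Rightarrow> ('a \<Rightarrow> 'b) set" where
  "star_hom A B = {\<phi> \<in> ring_hom A B.
     (\<forall>c. \<forall>x\<in>carrier A. \<phi> (cscale A c x) = cscale B c (\<phi> x)) \<and>
     (\<forall>x\<in>carrier A. \<phi> (star A x) = star B (\<phi> x))}"

definition closed_star_subalgebra :: "'a cstar \<Rightarrow> 'a set \<Rightarrow> bool" where
  "closed_star_subalgebra A S \<longleftrightarrow>
     S \<subseteq> carrier A \<and> \<one>\<^bsub>A\<^esub> \<in> S \<and>
     (\<forall>x\<in>S. \<forall>y\<in>S. x \<oplus>\<^bsub>A\<^esub> y \<in> S \<and> x \<otimes>\<^bsub>A\<^esub> y \<in> S) \<and>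
     (\<forall>c. \<forall>x\<in>S. cscale A c x \<in> S) \<and>
     (\<forall>x\<in>S. star A x \<in> S) \<and>
     (\<forall>X a. (\<forall>n. X n \<in> S) \<longrightarrow> a \<in> carrier A \<longrightarrow> cstar_limit A X a \<longrightarrow> a \<in> S)"


section \<open>The C*-algebra of the quantum group\<close>

text \<open>The index \<open>i\<alpha>\<close> is the pair \<open>(i, \<alpha>)\<close>, with \<open>i = 0\<close> encoded as
  \<^const>\<open>False\<close> and \<open>i = 1\<close> as \<^const>\<open>True\<close>.\<close>

type_synonym idx = "bool \<times> nat"

definition Jset :: "nat \<Rightarrow> idx set" where
  "Jset p = UNIV \<times> {1..p}"

definition conj_idx :: "idx \<Rightarrow> idx" where
  "conj_idx z = (\<not> fst z, snd z)"

definition As_relations :: "nat \<Rightarrow> 'a cstar \<Rightarrow> (idx \<Rightarrow> idx \<Rightarrow> 'a) \<Rightarrow> bool" where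
  "As_relations p A U \<longleftrightarrow>
     (\<forall>z\<in>Jset p. \<forall>y\<in>Jset p.
        U z y \<in> carrier A \<and>
        U z y \<otimes>\<^bsub>A\<^esub> U z y = U z y \<and> star A (U z y) = U z y \<and>
        (\<Oplus>\<^bsub>A\<^esub>x\<in>Jset p. U z x \<otimes>\<^bsub>A\<^esub> star A (U y x)) = (if z = y then \<one>\<^bsub>A\<^esub> else \<zero>\<^bsub>A\<^esub>) \<and>
        (\<Oplus>\<^bsub>A\<^esub>x\<in>Jset p. star A (U x z) \<otimes>\<^bsub>A\<^esub> U x y) = (if z = y then \<one>\<^bsub>A\<^esub> else \<zero>\<^bsub>A\<^esub>) \<and>
        U z y = star A (U (conj_idx z) (conj_idx y)))"

text \<open>
  The pair \<open>(A, U)\<close> is the universal unital C*-algebra generated by the entries of \<open>U\<close>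
  subject to the above relations. HOL cannot quantify over all types inside a formula, so the
  algebras \<open>B\<close> range over all C*-algebra structures carried by subsets of the type
  \<^typ>\<open>nat \<Rightarrow> nat \<Rightarrow> complex\<close>. This is no restriction: the image of \<open>A\<close> lies in the
  C*-subalgebra generated by finitely many elements \<open>V z y\<close>, which is separable, hence embeds
  into the operators on the sequence space of square-summable sequences, given by their
  matrices. The homomorphism is unique because the entries of \<open>U\<close> generate \<open>A\<close>.
\<close>

definition universal_As :: "nat \<Rightarrow> 'a cstar \<Rightarrow> (idx \<Rightarrow> idx \<Rightarrow> 'a) \<Rightarrow> bool" where
  "universal_As p A U \<longleftrightarrow>
     unital_cstar_algebra A \<and>
     As_relations p A U \<and>
     (\<forall>S. closed_star_subalgebra A S \<and> (\<forall>z\<in>Jset p. \<forall>y\<in>Jset p. U z y \<in> S) \<longrightarrow> S = carrier A) \<and>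
     (\<forall>(B :: (nat \<Rightarrow> nat \<Rightarrow> complex) cstar) V.
        unital_cstar_algebra B \<and> As_relations p B V \<longrightarrow>
        (\<exists>\<phi>\<in>star_hom A B. \<forall>z\<in>Jset p. \<forall>y\<in>Jset p. \<phi> (U z y) = V z y))"


section \<open>Tensor powers and intertwiners\<close>

definition words :: "nat \<Rightarrow> nat \<Rightarrow> idx list set" where
  "words p k = {w. set w \<subseteq> Jset p \<and> length w = k}"

text \<open>A vector of the \<open>k\<close>-th tensor power is its family of coordinates in the basis
  \<open>e\<^sub>i\<^sub>1 \<otimes> \<dots> \<otimes> e\<^sub>i\<^sub>k\<close>, extended by zero.\<close>

type_synonym tvec = "idx list \<Rightarrow> complex"

definition tensor_space :: "nat \<Rightarrow> nat \<Rightarrow> tvec set" where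
  "tensor_space p k = {v. \<forall>w. w \<notin> words p k \<longrightarrow> v w = 0}"

definition basis_vec :: "idx list \<Rightarrow> tvec" where
  "basis_vec i = (\<lambda>w. if w = i then 1 else 0)"

text \<open>Linear maps between tensor powers, extended by zero outside their domain so that
  equality of functions is equality of linear maps.\<close>

definition linear_maps :: "nat \<Rightarrow> nat \<Rightarrow> nat \<Rightarrow> (tvec \<Rightarrow> tvec) set" where
  "linear_maps p k l = {T.
     (\<forall>v\<in>tensor_space p k. T v \<in> tensor_space p l) \<and>
     (\<forall>v\<in>tensor_space p k. \<forall>w\<in>tensor_space p k. T (v + w) = T v + T w) \<and>
     (\<forall>c. \<forall>v\<in>tensor_space p k. T (\<lambda>x. c * v x) = (\<lambda>x. c * T v x)) \<and>
     (\<forall>v. v \<notin> tensor_space p k \<longrightarrow> T v = 0)}"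

interpretation tmap: vector_space
  "\<lambda>(c::complex) (T :: tvec \<Rightarrow> tvec) v w. c * T v w"
  by unfold_locales (auto simp: fun_eq_iff algebra_simps)

definition tensor_power :: "'a cstar \<Rightarrow> (idx \<Rightarrow> idx \<Rightarrow> 'a) \<Rightarrow> idx list \<Rightarrow> idx list \<Rightarrow> 'a" where
  "tensor_power A U z y = foldr (\<otimes>\<^bsub>A\<^esub>) (map2 U z y) \<one>\<^bsub>A\<^esub>"

text \<open>The matrix with entries in \<open>A\<close> of \<open>T \<otimes> 1\<close>.\<close>

definition amplify :: "'a cstar \<Rightarrow> (tvec \<Rightarrow> tvec) \<Rightarrow> idx list \<Rightarrow> idx list \<Rightarrow> 'a" where
  "amplify A T j i = cscale A (T (basis_vec i) j) \<one>\<^bsub>A\<^esub>"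

definition mat_prod ::
  "'a cstar \<Rightarrow> 'i set \<Rightarrow> ('r \<Rightarrow> 'i \<Rightarrow> 'a) \<Rightarrow> ('i \<Rightarrow> 'c \<Rightarrow> 'a) \<Rightarrow> 'r \<Rightarrow> 'c \<Rightarrow> 'a" where
  "mat_prod A I M N r c = (\<Oplus>\<^bsub>A\<^esub>x\<in>I. M r x \<otimes>\<^bsub>A\<^esub> N x c)"

definition Hom_space ::
  "nat \<Rightarrow> 'a cstar \<Rightarrow> (idx \<Rightarrow> idx \<Rightarrow> 'a) \<Rightarrow> nat \<Rightarrow> nat \<Rightarrow> (tvec \<Rightarrow> tvec) set" where
  "Hom_space p A U k l = {T \<in> linear_maps p k l.
     \<forall>j\<in>words p l. \<forall>i\<in>words p k.
       mat_prod A (words p k) (amplify A T) (tensor_power A U) j i =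
       mat_prod A (words p l) (tensor_power A U) (amplify A T) j i}"


section \<open>Bulleted partitions\<close>

datatype colour = Black | White

fun swap_colour :: "colour \<Rightarrow> colour" where
  "swap_colour Black = White"
| "swap_colour White = Black"

text \<open>The points, numbered from left to right starting with 0: \<^const>\<open>Inl\<close> for the upper row,
  \<^const>\<open>Inr\<close> for the lower row.\<close>

type_synonym point = "nat + nat"

definition points :: "nat \<Rightarrow> nat \<Rightarrow> point set" where
  "points k l = {..<k} <+> {..<l}"

type_synonym marked = "point set set \<times> (point \<Rightarrow> colour)"

definition marked_partitions :: "nat \<Rightarrow> nat \<Rightarrow> marked set" where
  "marked_partitions k l =
     {P. partition_on (points k l) P} \<times> (points k l \<rightarrow>\<^sub>E UNIV)"

definition recolouring :: "nat \<Rightarrow> nat \<Rightarrow> (marked \<times> marked) set" where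
  "recolouring k l = {((P, c), (Q, d)).
     (P, c) \<in> marked_partitions k l \<and> (Q, d) \<in> marked_partitions k l \<and> P = Q \<and>
     (\<exists>S\<subseteq>P. \<forall>x\<in>points k l. d x = (if x \<in> \<Union>S then swap_colour (c x) else c x))}"

definition P_bullet :: "nat \<Rightarrow> nat \<Rightarrow> marked set set" where
  "P_bullet k l = marked_partitions k l // recolouring k l"

text \<open>The position of a point when the boundary of the diagram is traversed clockwise: upper row
  from left to right, then lower row from right to left.\<close>

fun position :: "nat \<Rightarrow> nat \<Rightarrow> point \<Rightarrow> nat" where
  "position k l (Inl a) = a"
| "position k l (Inr b) = k + (l - 1 - b)"

definition noncrossing :: "nat \<Rightarrow> nat \<Rightarrow> point set set \<Rightarrow> bool" where
  "noncrossing k l P \<longleftrightarrow>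
     (\<forall>B\<in>P. \<forall>C\<in>P. \<forall>a\<in>B. \<forall>b\<in>C. \<forall>c\<in>B. \<forall>d\<in>C.
        position k l a < position k l b \<and> position k l b < position k l c \<and>
        position k l c < position k l d \<longrightarrow> B = C)"

definition NC_bullet :: "nat \<Rightarrow> nat \<Rightarrow> marked set set" where
  "NC_bullet k l = {\<pi> \<in> P_bullet k l. \<forall>(P, c)\<in>\<pi>. noncrossing k l P}"

definition label :: "idx list \<Rightarrow> idx list \<Rightarrow> point \<Rightarrow> idx" where
  "label i j = case_sum ((!) i) ((!) j)"

definition delta_marked :: "marked \<Rightarrow> idx list \<Rightarrow> idx list \<Rightarrow> bool" where
  "delta_marked m i j \<longleftrightarrow>
     (\<forall>B\<in>fst m. \<forall>x\<in>B. \<forall>y\<in>B.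
        label i j x = (if snd m x = snd m y then label i j y else conj_idx (label i j y)))"

text \<open>The value does not depend on the representative, see \<open>delta_bullet_eq\<close> below.\<close>

definition delta_bullet :: "marked set \<Rightarrow> idx list \<Rightarrow> idx list \<Rightarrow> complex" where
  "delta_bullet \<pi> i j = (if \<exists>m\<in>\<pi>. delta_marked m i j then 1 else 0)"

definition T_tilde :: "nat \<Rightarrow> nat \<Rightarrow> nat \<Rightarrow> marked set \<Rightarrow> tvec \<Rightarrow> tvec" where
  "T_tilde p k l \<pi> v = (if v \<in> tensor_space p k
     then (\<Sum>i\<in>words p k. \<Sum>j\<in>words p l. (\<lambda>w. v i * delta_bullet \<pi> i j * basis_vec j w))
     else 0)"

lemma finite_words: "finite (words p k)"
  unfolding words_def Jset_def by (rule finite_lists_length_eq) simp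

lemma T_tilde_basis_vec:
  assumes "i \<in> words p k"
  shows "T_tilde p k l \<pi> (basis_vec i)
    = (\<Sum>j\<in>words p l. (\<lambda>w. delta_bullet \<pi> i j * basis_vec j w))"
proof -
  have "basis_vec i \<in> tensor_space p k"
    using assms by (auto simp: tensor_space_def basis_vec_def)
  then have "T_tilde p k l \<pi> (basis_vec i) =
      (\<Sum>i'\<in>words p k. \<Sum>j\<in>words p l. (\<lambda>w. basis_vec i i' * delta_bullet \<pi> i' j * basis_vec j w))"
    by (simp add: T_tilde_def)
  also have "\<dots> = (\<Sum>i'\<in>{i}. \<Sum>j\<in>words p l. (\<lambda>w. basis_vec i i' * delta_bullet \<pi> i' j * basis_vec j w))"
  proof (rule sum.mono_neutral_right[OF finite_words])
    show "{i} \<subseteq> words p k"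
      using assms by simp
    show "\<forall>i'\<in>words p k - {i}.
        (\<Sum>j\<in>words p l. (\<lambda>w. basis_vec i i' * delta_bullet \<pi> i' j * basis_vec j w)) = 0"
      by (intro ballI sum.neutral) (simp add: basis_vec_def zero_fun_def)
  qed
  finally show ?thesis
    by (simp add: basis_vec_def)
qed

lemma equiv_recolouring: "equiv (marked_partitions k l) (recolouring k l)"
proof (rule equivI)
  have inv: "swap_colour (swap_colour c) = c" for c by (cases c) auto
  show "recolouring k l \<subseteq> marked_partitions k l \<times> marked_partitions k l"
    by (auto simp: recolouring_def)
  show "refl_on (marked_partitions k l) (recolouring k l)"
  proof (rule refl_onI)
    fix x assume "x \<in> marked_partitions k l"
    moreover have "\<exists>S\<subseteq>fst x. \<forall>q\<in>points k l.
        snd x q = (if q \<in> \<Union>S then swap_colour (snd x q) else snd x q)"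
      by (rule exI[where x = "{}"]) simp
    ultimately show "(x, x) \<in> recolouring k l"
      by (simp add: recolouring_def split_beta)
  qed
  show "sym (recolouring k l)"
  proof (rule symI)
    fix x y assume xy: "(x, y) \<in> recolouring k l"
    then obtain S where S: "S \<subseteq> fst x"
      "\<forall>q\<in>points k l. snd y q = (if q \<in> \<Union>S then swap_colour (snd x q) else snd x q)"
      unfolding recolouring_def by (auto simp only: mem_Collect_eq split_beta fst_conv snd_conv)
    have "\<forall>q\<in>points k l. snd x q = (if q \<in> \<Union>S then swap_colour (snd y q) else snd y q)"
    proof
      fix q assume "q \<in> points k l"
      with S(2) have "snd y q = (if q \<in> \<Union>S then swap_colour (snd x q) else snd x q)"
        by (rule bspec)
      then show "snd x q = (if q \<in> \<Union>S then swap_colour (snd y q) else snd y q)"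
        by (simp add: inv split: if_split_asm)
    qed
    with S(1) have "\<exists>S\<subseteq>fst x. \<forall>q\<in>points k l.
        snd x q = (if q \<in> \<Union>S then swap_colour (snd y q) else snd y q)"
      by (intro exI[where x = S] conjI)
    with xy show "(y, x) \<in> recolouring k l"
      by (simp add: recolouring_def split_beta)
  qed
  show "trans (recolouring k l)"
  proof (rule transI)
    fix x y z assume xy: "(x, y) \<in> recolouring k l" and yz: "(y, z) \<in> recolouring k l"
    obtain P c d e where x: "x = (P, c)" and y: "y = (P, d)" and z: "z = (P, e)"
      using xy yz by (auto simp: recolouring_def)
    obtain S where S: "S \<subseteq> P"
      "\<And>q. q \<in> points k l \<Longrightarrow> d q = (if q \<in> \<Union>S then swap_colour (c q) else c q)"
      using xy unfolding x y recolouring_def by auto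
    obtain R where R: "R \<subseteq> P"
      "\<And>q. q \<in> points k l \<Longrightarrow> e q = (if q \<in> \<Union>R then swap_colour (d q) else d q)"
      using yz unfolding y z recolouring_def by auto
    have part: "partition_on (points k l) P"
      using xy by (auto simp: x recolouring_def marked_partitions_def)
    let ?Q = "(S - R) \<union> (R - S)"
    have "e q = (if q \<in> \<Union>?Q then swap_colour (c q) else c q)" if q: "q \<in> points k l" for q
    proof -
      obtain B where B: "B \<in> P" "q \<in> B"
        using part q by (auto simp: partition_on_def)
      have "C = B" if "C \<in> P" "q \<in> C" for C
        using part B that by (auto simp: partition_on_def disjoint_def)
      then have mem: "q \<in> \<Union>X \<longleftrightarrow> B \<in> X" if "X \<subseteq> P" for X
        using that B by blast
      have Q: "?Q \<subseteq> P" using S(1) R(1) by blast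
      show ?thesis
        unfolding S(2)[OF q] R(2)[OF q] mem[OF S(1)] mem[OF R(1)] mem[OF Q]
        by (simp add: inv)
    qed
    moreover have "?Q \<subseteq> P" using S(1) R(1) by blast
    ultimately have "\<exists>S\<subseteq>P. \<forall>q\<in>points k l. e q = (if q \<in> \<Union>S then swap_colour (c q) else c q)"
      by (intro exI[of _ ?Q] conjI ballI)
    then show "(x, z) \<in> recolouring k l"
      using xy yz by (simp add: x y z recolouring_def)
  qed
qed

lemma delta_marked_recolouring:
  assumes "(m, n) \<in> recolouring k l"
  shows "delta_marked m i j = delta_marked n i j"
proof -
  obtain P c d where m: "m = (P, c)" and n: "n = (P, d)"
    using assms by (auto simp: recolouring_def)
  obtain S where S: "S \<subseteq> P"
    "\<And>q. q \<in> points k l \<Longrightarrow> d q = (if q \<in> \<Union>S then swap_colour (c q) else c q)"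
    using assms unfolding m n recolouring_def by auto
  have part: "partition_on (points k l) P"
    using assms by (auto simp: m recolouring_def marked_partitions_def)
  have swap: "swap_colour a = swap_colour b \<longleftrightarrow> a = b" for a b
    by (cases a; cases b) auto
  have "d x = d y \<longleftrightarrow> c x = c y" if "B \<in> P" "x \<in> B" "y \<in> B" for B x y
  proof -
    have mem: "q \<in> \<Union>S \<longleftrightarrow> B \<in> S" if q: "q \<in> B" for q
    proof -
      have "C = B" if "C \<in> P" "q \<in> C" for C
        using part \<open>B \<in> P\<close> q that by (auto simp: partition_on_def disjoint_def)
      then show ?thesis using S(1) q by blast
    qed
    have "x \<in> points k l" "y \<in> points k l"
      using part that by (auto simp: partition_on_def)
    then show ?thesis
      by (simp only: S(2) mem[OF that(2)] mem[OF that(3)] swap split: if_split) simp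
  qed
  then show ?thesis
    by (simp add: delta_marked_def m n)
qed

lemma delta_bullet_eq:
  assumes "\<pi> \<in> P_bullet k l" and "m \<in> \<pi>"
  shows "delta_bullet \<pi> i j = (if delta_marked m i j then 1 else 0)"
proof -
  have "(m, n) \<in> recolouring k l" if "n \<in> \<pi>" for n
    using assms that quotient_eq_iff[OF equiv_recolouring, of \<pi> k l \<pi> m n]
    by (auto simp: P_bullet_def)
  then have "delta_marked n i j = delta_marked m i j" if "n \<in> \<pi>" for n
    using that delta_marked_recolouring by blast
  then have "(\<exists>n\<in>\<pi>. delta_marked n i j) = delta_marked m i j"
    using assms(2) by blast
  then show ?thesis
    by (simp add: delta_bullet_def)
qed

end

theory Submission
  imports Defs "HOL-Library.Poly_Mapping" "HOL-Library.Countable"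
begin

text \<open>Let \<open>F p n\<close> be the span of the vectors of the noncrossing coloured partitions of \<open>n\<close> points on a
line. The entries of \<open>U\<close> are self-adjoint, so the representation is its own dual, with duality vector
the sum of all \<open>e\<^sub>z \<otimes> e\<^sub>z\<close>, and bending the legs of a linear map turns the intertwiners from
\<open>U\<^sup>k\<close> to \<open>U\<^sup>l\<close> into the vectors fixed by \<open>U\<^sup>l\<^sup>+\<^sup>k\<close> (\<open>intertwines_iff_fixed\<close>). The claim becomes
that the vectors fixed by \<open>U\<^sup>n\<close> are those of \<open>F p n\<close>.

All vectors of \<open>F p n\<close> are fixed (\<open>F_subset_fix_space\<close>). A noncrossing partition contains a singleton or two neighbours in
one block, so its vector arises from the number 1 by inserting the sum of all \<open>e\<^sub>z\<close> at some place and
by doubling a letter, possibly with a bar (\<open>nc_induct\<close>). These operations respect \<open>U\<close>: its rows sum to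
1, the entries of one column are mutually orthogonal, and \<open>U\<close> is invariant under the bar. Orthogonality is
where the norm of \<open>A\<close> enters: projections with sum 1 in a C*-algebra are pairwise orthogonal
(\<open>projections_orthogonal\<close>).

For the converse, universality of \<open>A\<close> makes it enough to find one C*-algebra with a matrix
satisfying the relations whose fixed vectors all lie in \<open>F p n\<close>. It comes from a concrete form of
Tannaka-Krein duality. On the free *-algebra in letters \<open>u\<^sub>z\<^sub>y\<close> a functional, the future Haar state,
sends a word of length \<open>n\<close> with row indices \<open>z\<close> and column indices \<open>y\<close> to the coefficient at
\<open>(z, y)\<close> of the orthogonal projection \<open>P\<^sub>n\<close> onto \<open>F p n\<close>. The spaces \<open>F p n\<close> are stable under the elementary
operations (insert, double, bar, merge two neighbours, sum over one letter), which occur in adjoint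
pairs. Hence the projections commute with them (\<open>kern_intertwine\<close>), and this says exactly that the
functional vanishes on the ideal generated by the relations (\<open>magic_haar_ideal\<close>). The functional is
positive (\<open>haar_pos\<close>): modulo that ideal all words can be given the same length \<open>n\<close>, and then positivity is the
complete positivity of the projection of a matrix algebra onto the *-subalgebra \<open>F p (n + n)\<close>
(\<open>kern_completely_positive\<close>). The GNS construction now yields the C*-algebra. If a vector
\<open>f\<close> is fixed there, applying the functional to the fixed point equation gives \<open>P\<^sub>n f = f\<close>, so
\<open>f\<close> lies in \<open>F p n\<close> (\<open>fix_space_haar\<close>).\<close>

section \<open>Projections onto finite-dimensional function spaces\<close>
definition ip :: "'s set \<Rightarrow> ('s \<Rightarrow> complex) \<Rightarrow> ('s \<Rightarrow> complex) \<Rightarrow> complex" where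
  "ip S f g = (\<Sum>s\<in>S. cnj (f s) * g s)"

definition fsubspace :: "'s set \<Rightarrow> ('s \<Rightarrow> complex) set \<Rightarrow> bool" where
  "fsubspace S M \<longleftrightarrow> (\<forall>f\<in>M. \<forall>s. s \<notin> S \<longrightarrow> f s = 0) \<and> (\<lambda>_. 0) \<in> M \<and>
     (\<forall>f\<in>M. \<forall>g\<in>M. (\<lambda>s. f s + g s) \<in> M) \<and> (\<forall>c. \<forall>f\<in>M. (\<lambda>s. c * f s) \<in> M)"

lemma fsubspaceD:
  assumes "fsubspace S M"
  shows "f \<in> M \<Longrightarrow> s \<notin> S \<Longrightarrow> f s = 0"
    and "(\<lambda>_. 0) \<in> M"
    and "f \<in> M \<Longrightarrow> g \<in> M \<Longrightarrow> (\<lambda>s. f s + g s) \<in> M"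
    and "f \<in> M \<Longrightarrow> (\<lambda>s. c * f s) \<in> M"
  using assms unfolding fsubspace_def by blast+

lemma fsubspace_sum:
  assumes "fsubspace S M" and "\<And>i. i \<in> I \<Longrightarrow> F i \<in> M"
  shows "(\<lambda>s. \<Sum>i\<in>I. c i * F i s) \<in> M"
  using assms(2)
proof (induction I rule: infinite_finite_induct)
  case (insert x I)
  have "(\<lambda>s. c x * F x s + (\<Sum>i\<in>I. c i * F i s)) \<in> M"
    using insert by (intro fsubspaceD(3)[OF assms(1)] fsubspaceD(4)[OF assms(1)]) auto
  then show ?case using insert by simp
qed (use fsubspaceD(2)[OF assms(1)] in auto)

lemma ip_add_right: "ip S f (\<lambda>s. g s + g' s) = ip S f g + ip S f g'"
  by (simp add: ip_def sum.distrib algebra_simps)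
lemma ip_scale_right: "ip S f (\<lambda>s. c * g s) = c * ip S f g"
  by (simp add: ip_def sum_distrib_left mult_ac)
lemma ip_sum_right: "ip S f (\<lambda>s. \<Sum>i\<in>I. c i * g i s) = (\<Sum>i\<in>I. c i * ip S f (g i))"
  unfolding ip_def sum_distrib_left by (subst sum.swap) (simp add: mult_ac)
lemma cnj_ip: "cnj (ip S f g) = ip S g f"
  by (simp add: ip_def cnj_sum mult.commute)

lemma ip_self:
  assumes "finite S"
  shows "ip S f f = of_real (\<Sum>s\<in>S. (cmod (f s))\<^sup>2)"
  unfolding ip_def of_real_sum
  by (rule sum.cong) (simp_all only: complex_norm_square mult.commute)

lemma ip_self_eq_0:
  assumes "finite S" "ip S f f = 0" "s \<in> S"
  shows "f s = 0"
proof -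
  have "(\<Sum>s\<in>S. (cmod (f s))\<^sup>2) = 0"
    using assms(2) unfolding ip_self[OF assms(1)] of_real_eq_0_iff .
  then have "(cmod (f s))\<^sup>2 = 0" using assms by (simp add: sum_nonneg_eq_0_iff)
  then show ?thesis by simp
qed

definition onb :: "'s set \<Rightarrow> ('s \<Rightarrow> complex) set \<Rightarrow> ('s \<Rightarrow> complex) set \<Rightarrow> bool" where
  "onb S M E \<longleftrightarrow> finite E \<and> E \<subseteq> M \<and>
     (\<forall>e\<in>E. \<forall>f\<in>E. ip S e f = (if e = f then 1 else 0)) \<and>
     (\<forall>m\<in>M. m = (\<lambda>s. \<Sum>e\<in>E. ip S e m * e s))"

text \<open>Induction on the domain: the functions of \<open>M\<close> that vanish at a given point form a subspace of
functions on a smaller domain, and any function of \<open>M\<close> that does not vanish there contributes one more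
basis vector. The subspace may thus be given by equations, like a commutant.\<close>

lemma onb_exists:
  assumes "finite S" and "fsubspace S M"
  shows "\<exists>E. onb S M E"
  using assms
proof (induction S arbitrary: M rule: finite_induct)
  case empty
  then have "M = {\<lambda>_. 0}" by (auto simp: fsubspace_def)
  then show ?case by (intro exI[of _ "{}"]) (auto simp: onb_def)
next
  case (insert x S M)
  define M0 where "M0 = {m\<in>M. m x = 0}"
  note M = fsubspaceD[OF insert.prems]
  have M0: "fsubspace S M0"
    unfolding fsubspace_def M0_def
  proof (intro conjI ballI allI impI)
    fix f s assume "f \<in> {m\<in>M. m x = 0}" "s \<notin> S"
    then show "f s = 0" using M(1)[of f s] by (cases "s = x") auto
  qed (use M(2-4) in auto)
  obtain E where E: "onb S M0 E" using insert.IH[OF M0] by blast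
  have ipS: "ip (insert x S) f g = ip S f g" if "f \<in> M0 \<or> g \<in> M0" for f g
    using that insert.hyps by (auto simp: ip_def M0_def)
  have E_M0: "E \<subseteq> M0" and finE: "finite E" using E by (auto simp: onb_def)
  show ?case
  proof (cases "M0 = M")
    case True
    then show ?thesis using E ipS E_M0 unfolding onb_def
      by (intro exI[of _ E]) (auto simp: subset_iff)
  next
    case False
    then obtain m1 where m1: "m1 \<in> M" "m1 x \<noteq> 0" unfolding M0_def by auto
    define m2 where "m2 = (\<lambda>s. m1 s + (- 1) * (\<Sum>e\<in>E. ip S e m1 * e s))"
    have proj: "(\<lambda>s. \<Sum>e\<in>E. ip S e m1 * e s) \<in> M0"
      by (rule fsubspace_sum[OF M0, of E "\<lambda>e. e"]) (use E_M0 in blast)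
    have m2M: "m2 \<in> M" unfolding m2_def
      by (intro M(3,4)) (use m1 proj in \<open>auto simp: M0_def\<close>)
    have m2x: "m2 x \<noteq> 0" using proj m1 by (simp add: m2_def M0_def)
    have orth: "ip (insert x S) e m2 = 0" if "e \<in> E" for e
    proof -
      have "ip S e m2 = ip S e m1 + (-1) * ip S e (\<lambda>s. \<Sum>f\<in>E. ip S f m1 * f s)"
        unfolding m2_def by (simp only: ip_add_right ip_scale_right)
      also have "ip S e (\<lambda>s. \<Sum>f\<in>E. ip S f m1 * f s) = (\<Sum>f\<in>E. ip S f m1 * (if e = f then 1 else 0))"
        using E that by (simp add: ip_sum_right onb_def)
      also have "\<dots> = ip S e m1" using finE that by (simp add: if_distrib cong: if_cong)
      finally show ?thesis using ipS that E_M0 by auto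
    qed
    define r where "r = (\<Sum>s\<in>insert x S. (cmod (m2 s))\<^sup>2)"
    have finS: "finite (insert x S)" using insert.hyps by simp
    have r: "r > 0"
    proof -
      have "(cmod (m2 x))\<^sup>2 > 0" using m2x by simp
      then show ?thesis unfolding r_def using insert.hyps by (simp add: add_pos_nonneg sum_nonneg)
    qed
    define m3 where "m3 = (\<lambda>s. of_real (1 / sqrt r) * m2 s)"
    have m3M: "m3 \<in> M" unfolding m3_def using m2M M(4) by blast
    have m3x: "m3 x \<noteq> 0" using m2x r by (simp add: m3_def)
    have m3_unit: "ip (insert x S) m3 m3 = 1"
    proof -
      have "(\<Sum>s\<in>insert x S. (cmod (m3 s))\<^sup>2) = (1 / sqrt r)\<^sup>2 * r"
        unfolding r_def m3_def sum_distrib_left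
        by (simp add: norm_mult power_mult_distrib power_divide norm_divide)
      also have "\<dots> = 1" using r by (simp add: power_divide)
      finally show ?thesis using ip_self[OF finS, of m3] by simp
    qed
    have orth3: "ip (insert x S) e m3 = 0" if "e \<in> E" for e
      unfolding m3_def using orth[OF that] by (simp only: ip_scale_right) simp
    have orth3': "ip (insert x S) m3 e = 0" if "e \<in> E" for e
      using orth3[OF that] cnj_ip[of "insert x S" e m3] by simp
    have m3E: "m3 \<notin> E" using m3x E_M0 by (auto simp: M0_def)
    have "m = (\<lambda>s. \<Sum>e\<in>insert m3 E. ip (insert x S) e m * e s)" if m: "m \<in> M" for m
    proof -
      define t where "t = m x / m3 x"
      define m0 where "m0 = (\<lambda>s. m s + (- t) * m3 s)"
      have "m0 \<in> M" unfolding m0_def using M(3,4) m m3M by blast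
      then have m0: "m0 \<in> M0" using m3x by (simp add: M0_def m0_def t_def)
      have meq: "m = (\<lambda>s. m0 s + t * m3 s)" by (simp add: m0_def)
      have a: "m0 = (\<lambda>s. \<Sum>e\<in>E. ip S e m0 * e s)" using E m0 by (simp add: onb_def)
      have b: "ip (insert x S) e m = ip S e m0" if "e \<in> E" for e
        unfolding meq ip_add_right ip_scale_right using orth3[OF that] ipS[of e m0] m0 by simp
      have c: "ip (insert x S) m3 m0 = 0"
      proof -
        have "ip (insert x S) m3 m0 = ip (insert x S) m3 (\<lambda>s. \<Sum>e\<in>E. ip S e m0 * e s)"
          using a by simp
        also have "\<dots> = 0" unfolding ip_sum_right using orth3' by simp
        finally show ?thesis .
      qed
      have d: "ip (insert x S) m3 m = t"
        unfolding meq ip_add_right ip_scale_right using c m3_unit by simp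
      show ?thesis
      proof
        fix s
        have "m s = t * m3 s + m0 s" using meq by (metis add.commute)
        also have "m0 s = (\<Sum>e\<in>E. ip S e m0 * e s)" using fun_cong[OF a] .
        also have "t * m3 s + \<dots> = (\<Sum>e\<in>insert m3 E. ip (insert x S) e m * e s)"
          using m3E finE b d by simp
        finally show "m s = (\<Sum>e\<in>insert m3 E. ip (insert x S) e m * e s)" .
      qed
    qed
    moreover have "ip (insert x S) e f = (if e = f then 1 else 0)"
      if "e \<in> insert m3 E" "f \<in> insert m3 E" for e f
      using that E E_M0 ipS m3_unit orth3 orth3' m3E by (auto simp: onb_def)
    ultimately have "onb (insert x S) M (insert m3 E)"
      unfolding onb_def using finE m3M E_M0 by (auto simp: M0_def)
    then show ?thesis by blast
  qed
qed

text \<open>For an orthonormal basis \<open>E\<close> of \<open>M\<close> this is the matrix of the orthogonal projection onto \<open>M\<close>.\<close>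

definition kern :: "('s \<Rightarrow> complex) set \<Rightarrow> 's \<Rightarrow> 's \<Rightarrow> complex" where
  "kern E s t = (\<Sum>e\<in>E. e s * cnj (e t))"

lemma cnj_kern: "cnj (kern E s t) = kern E t s"
  by (simp add: kern_def cnj_sum mult.commute)

lemma kern_apply: "(\<Sum>t\<in>S. kern E s t * f t) = (\<Sum>e\<in>E. ip S e f * e s)"
  unfolding kern_def ip_def sum_distrib_right by (subst sum.swap) (simp add: mult_ac)

lemma kern_reproduces:
  assumes "onb S M E" "m \<in> M"
  shows "(\<Sum>t\<in>S. kern E s t * m t) = m s"
  using assms unfolding kern_apply onb_def by metis

lemma kern_range:
  assumes "onb S M E" "fsubspace S M"
  shows "(\<lambda>s. \<Sum>t\<in>S. kern E s t * f t) \<in> M"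
  unfolding kern_apply
  by (rule fsubspace_sum[OF assms(2), of E "\<lambda>e. e"]) (use assms(1) in \<open>auto simp: onb_def\<close>)

lemma kern_in:
  assumes "onb S M E" "fsubspace S M"
  shows "(\<lambda>s. kern E s t) \<in> M"
proof -
  have "(\<lambda>s. \<Sum>e\<in>E. cnj (e t) * e s) \<in> M"
    by (rule fsubspace_sum[OF assms(2), of E "\<lambda>e. e"]) (use assms(1) in \<open>auto simp: onb_def\<close>)
  then show ?thesis by (simp add: kern_def mult.commute)
qed

text \<open>A matrix \<open>t\<close> that maps \<open>M\<close> into \<open>M'\<close>, and whose adjoint maps \<open>M'\<close> into \<open>M\<close>, also respects the
orthogonal complements; therefore it intertwines the two projections.\<close>

lemma kern_intertwine:
  assumes E: "onb S M E" "fsubspace S M" and E': "onb S' M' E'" "fsubspace S' M'"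
    and T: "\<And>f. f \<in> M \<Longrightarrow> (\<lambda>s'. \<Sum>s\<in>S. t s' s * f s) \<in> M'"
    and T': "\<And>g. g \<in> M' \<Longrightarrow> (\<lambda>s. \<Sum>s'\<in>S'. cnj (t s' s) * g s') \<in> M"
  shows "(\<Sum>s\<in>S. t s' s * kern E s r) = (\<Sum>r'\<in>S'. kern E' s' r' * t r' r)"
proof -
  define k where "k = (\<lambda>s. kern E s r)"
  define Tk where "Tk = (\<lambda>s'. \<Sum>s\<in>S. t s' s * k s)"
  have "Tk \<in> M'" unfolding Tk_def using T kern_in[OF E] by (simp add: k_def)
  then have "Tk s' = (\<Sum>e\<in>E'. ip S' e Tk * e s')" using E'(1) unfolding onb_def by metis
  also have "\<dots> = (\<Sum>e\<in>E'. (\<Sum>r'\<in>S'. cnj (e r') * t r' r) * e s')"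
  proof (rule sum.cong[OF refl])
    fix e assume e: "e \<in> E'"
    define g where "g = (\<lambda>s. \<Sum>s'\<in>S'. cnj (t s' s) * e s')"
    have g: "g \<in> M" unfolding g_def using T' e E'(1) by (auto simp: onb_def)
    have "ip S' e Tk = (\<Sum>s\<in>S. (\<Sum>s'\<in>S'. cnj (e s') * t s' s) * k s)"
      unfolding ip_def Tk_def sum_distrib_left sum_distrib_right
      by (subst sum.swap) (simp add: mult_ac)
    also have "\<dots> = (\<Sum>s\<in>S. cnj (kern E r s * g s))"
      by (simp add: g_def cnj_sum k_def cnj_kern mult_ac)
    also have "\<dots> = cnj (g r)"
      using arg_cong[OF kern_reproduces[OF E(1) g, of r], of cnj] by simp
    finally show "ip S' e Tk * e s' = (\<Sum>r'\<in>S'. cnj (e r') * t r' r) * e s'"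
      by (simp add: g_def cnj_sum mult_ac)
  qed
  also have "\<dots> = (\<Sum>r'\<in>S'. kern E' s' r' * t r' r)"
    unfolding kern_def sum_distrib_right by (subst sum.swap) (simp add: mult_ac)
  finally show ?thesis by (simp add: Tk_def k_def)
qed

section \<open>Complete positivity of the projection onto a matrix algebra\<close>
definition mm :: "'i set \<Rightarrow> ('i \<times> 'i \<Rightarrow> complex) \<Rightarrow> ('i \<times> 'i \<Rightarrow> complex) \<Rightarrow> ('i \<times> 'i \<Rightarrow> complex)" where
  "mm I a b = (\<lambda>(i, j). \<Sum>x\<in>I. a (i, x) * b (x, j))"

definition adj :: "('i \<times> 'i \<Rightarrow> complex) \<Rightarrow> ('i \<times> 'i \<Rightarrow> complex)" where
  "adj a = (\<lambda>(i, j). cnj (a (j, i)))"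

lemma adj_apply [simp]: "adj a (i, j) = cnj (a (j, i))"
  by (simp add: adj_def)

lemma mm_apply: "mm I a b (i, j) = (\<Sum>x\<in>I. a (i, x) * b (x, j))"
  by (simp add: mm_def)

lemma adj_adj [simp]: "adj (adj a) = a"
  by (simp add: adj_def)

lemma adj_mm: "adj (mm I a b) = mm I (adj b) (adj a)"
  by (simp add: adj_def mm_def cnj_sum mult.commute)

lemma mm_assoc: "mm I (mm I a b) c = mm I a (mm I b c)"
proof -
  have "(\<Sum>x\<in>I. (\<Sum>y\<in>I. a (i, y) * b (y, x)) * c (x, j)) =
      (\<Sum>y\<in>I. a (i, y) * (\<Sum>x\<in>I. b (y, x) * c (x, j)))" for i j
    unfolding sum_distrib_left sum_distrib_right by (subst sum.swap) (simp add: mult_ac)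
  then show ?thesis by (simp add: mm_def)
qed

lemma ip_square: "ip (I \<times> I) f g = (\<Sum>i\<in>I. \<Sum>j\<in>I. cnj (f (i, j)) * g (i, j))"
  by (simp add: ip_def sum.cartesian_product)

lemma ip_mm_left: "ip (I \<times> I) (mm I a b) c = ip (I \<times> I) b (mm I (adj a) c)"
proof -
  have "ip (I \<times> I) (mm I a b) c =
      (\<Sum>i\<in>I. \<Sum>j\<in>I. \<Sum>x\<in>I. cnj (a (i, x)) * cnj (b (x, j)) * c (i, j))"
    by (simp add: ip_square mm_apply cnj_sum sum_distrib_right)
  also have "\<dots> = (\<Sum>i\<in>I. \<Sum>x\<in>I. \<Sum>j\<in>I. cnj (a (i, x)) * cnj (b (x, j)) * c (i, j))"
    by (rule sum.cong[OF refl]) (rule sum.swap)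
  also have "\<dots> = (\<Sum>x\<in>I. \<Sum>i\<in>I. \<Sum>j\<in>I. cnj (a (i, x)) * cnj (b (x, j)) * c (i, j))"
    by (rule sum.swap)
  also have "\<dots> = (\<Sum>x\<in>I. \<Sum>j\<in>I. \<Sum>i\<in>I. cnj (a (i, x)) * cnj (b (x, j)) * c (i, j))"
    by (rule sum.cong[OF refl]) (rule sum.swap)
  also have "\<dots> = ip (I \<times> I) b (mm I (adj a) c)"
    by (simp add: ip_square mm_apply sum_distrib_left mult_ac)
  finally show ?thesis .
qed

lemma ip_mm_right: "ip (I \<times> I) (mm I a b) c = ip (I \<times> I) a (mm I c (adj b))"
proof -
  have "ip (I \<times> I) (mm I a b) c =
      (\<Sum>i\<in>I. \<Sum>j\<in>I. \<Sum>x\<in>I. cnj (a (i, x)) * cnj (b (x, j)) * c (i, j))"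
    by (simp add: ip_square mm_apply cnj_sum sum_distrib_right)
  also have "\<dots> = (\<Sum>i\<in>I. \<Sum>x\<in>I. \<Sum>j\<in>I. cnj (a (i, x)) * cnj (b (x, j)) * c (i, j))"
    by (rule sum.cong[OF refl]) (rule sum.swap)
  also have "\<dots> = ip (I \<times> I) a (mm I c (adj b))"
    by (simp add: ip_square mm_apply sum_distrib_left mult_ac)
  finally show ?thesis .
qed

lemma ip_adj_swap: "ip (I \<times> I) f (adj e) = ip (I \<times> I) e (adj f)"
  unfolding ip_square adj_apply by (subst sum.swap) (simp add: mult.commute)

text \<open>The trace-preserving projection of all matrices onto a *-subalgebra \<open>M\<close> has kernel
\<open>kern E\<close>. Its complete positivity is obtained from the map \<open>\<Phi> c = (\<Sum>e\<in>E. e c e\<^sup>*)\<close> without any spectral theory.\<close>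

locale matrix_star_algebra =
  fixes I :: "'i set" and M E :: "('i \<times> 'i \<Rightarrow> complex) set"
  assumes finI: "finite I" and sub: "fsubspace (I \<times> I) M"
    and mm_closed: "\<And>a b. a \<in> M \<Longrightarrow> b \<in> M \<Longrightarrow> mm I a b \<in> M"
    and adj_closed: "\<And>a. a \<in> M \<Longrightarrow> adj a \<in> M"
    and onb: "onb (I \<times> I) M E"
begin

abbreviation "ipp \<equiv> ip (I \<times> I)"

lemma E_M: "e \<in> E \<Longrightarrow> e \<in> M" and finE: "finite E"
  using onb by (auto simp: onb_def)

lemma expand: "m \<in> M \<Longrightarrow> m s = (\<Sum>e\<in>E. ipp e m * e s)"
  using onb unfolding onb_def by (elim conjE) (drule (1) bspec, erule fun_cong)

lemma expand_adj:
  assumes "m \<in> M"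
  shows "adj m t = (\<Sum>e\<in>E. ipp m e * adj e t)"
proof -
  obtain i j where t: "t = (i, j)" by (cases t)
  have "cnj (m (j, i)) = (\<Sum>e\<in>E. cnj (ipp e m * e (j, i)))"
    by (subst expand[OF assms]) (rule cnj_sum)
  then show ?thesis by (simp add: t cnj_ip)
qed

text \<open>The tensor \<open>\<Sum>e\<in>E. e \<otimes> e\<^sup>*\<close> behaves like a Casimir element: expanding \<open>b e\<close> and \<open>e\<^sup>* b\<close> in the basis gives the
same coefficients.\<close>

lemma casimir_commutes:
  assumes b: "b \<in> M"
  shows "(\<Sum>e\<in>E. mm I b e s * adj e t) = (\<Sum>e\<in>E. e s * mm I (adj e) b t)"
proof -
  have "(\<Sum>e\<in>E. e s * mm I (adj e) b t) = (\<Sum>f\<in>E. f s * (\<Sum>e\<in>E. ipp f (mm I b e) * adj e t))"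
  proof (rule sum.cong[OF refl])
    fix f assume f: "f \<in> E"
    have "mm I (adj f) b = adj (mm I (adj b) f)" by (simp add: adj_mm)
    then have "mm I (adj f) b t = (\<Sum>e\<in>E. ipp (mm I (adj b) f) e * adj e t)"
      using expand_adj[OF mm_closed[OF adj_closed[OF b] E_M[OF f]]] by simp
    then show "f s * mm I (adj f) b t = f s * (\<Sum>e\<in>E. ipp f (mm I b e) * adj e t)"
      by (simp add: ip_mm_left)
  qed
  also have "\<dots> = (\<Sum>e\<in>E. (\<Sum>f\<in>E. ipp f (mm I b e) * f s) * adj e t)"
    unfolding sum_distrib_left sum_distrib_right by (subst sum.swap) (simp add: mult_ac)
  also have "\<dots> = (\<Sum>e\<in>E. mm I b e s * adj e t)"
    by (rule sum.cong[OF refl]) (simp only: expand[OF mm_closed[OF b E_M], symmetric])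
  finally show ?thesis ..
qed

text \<open>The adjoints of \<open>E\<close> form an orthonormal basis of \<open>M\<close> as well, and the tensor is the same for all bases.\<close>

lemma casimir_swap: "(\<Sum>e\<in>E. e s * adj e t) = (\<Sum>e\<in>E. adj e s * e t)"
proof -
  have "(\<Sum>e\<in>E. adj e s * e t) = (\<Sum>e\<in>E. (\<Sum>f\<in>E. ipp f (adj e) * f s) * e t)"
    by (rule sum.cong[OF refl]) (simp only: expand[OF adj_closed[OF E_M], symmetric])
  also have "\<dots> = (\<Sum>f\<in>E. f s * (\<Sum>e\<in>E. ipp e (adj f) * e t))"
    unfolding sum_distrib_left sum_distrib_right
    by (subst sum.swap) (simp add: mult_ac ip_adj_swap)
  also have "\<dots> = (\<Sum>f\<in>E. f s * adj f t)"
    by (rule sum.cong[OF refl]) (simp only: expand[OF adj_closed[OF E_M], symmetric])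
  finally show ?thesis ..
qed

definition sandwich where
  "sandwich P Q c = (\<lambda>s. \<Sum>e\<in>E. mm I (mm I (P e) c) (Q e) s)"

lemma sandwich_apply:
  "sandwich P Q c (i, j) = (\<Sum>x\<in>I. \<Sum>y\<in>I. c (x, y) * (\<Sum>e\<in>E. P e (i, x) * Q e (y, j)))"
proof -
  have "mm I (mm I (P e) c) (Q e) (i, j) = (\<Sum>x\<in>I. \<Sum>y\<in>I. c (x, y) * (P e (i, x) * Q e (y, j)))" for e
    unfolding mm_apply sum_distrib_right by (subst sum.swap) (simp add: mult_ac)
  then have "sandwich P Q c (i, j) = (\<Sum>e\<in>E. \<Sum>x\<in>I. \<Sum>y\<in>I. c (x, y) * (P e (i, x) * Q e (y, j)))"
    by (simp add: sandwich_def)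
  also have "\<dots> = (\<Sum>x\<in>I. \<Sum>e\<in>E. \<Sum>y\<in>I. c (x, y) * (P e (i, x) * Q e (y, j)))"
    by (rule sum.swap)
  also have "\<dots> = (\<Sum>x\<in>I. \<Sum>y\<in>I. \<Sum>e\<in>E. c (x, y) * (P e (i, x) * Q e (y, j)))"
    by (rule sum.cong[OF refl]) (rule sum.swap)
  finally show ?thesis
    by (simp only: sum_distrib_left)
qed

lemma sandwich_cong:
  assumes "\<And>s t. (\<Sum>e\<in>E. P e s * Q e t) = (\<Sum>e\<in>E. P' e s * Q' e t)"
  shows "sandwich P Q = sandwich P' Q'"
  by (intro ext) (auto simp: sandwich_apply assms)

abbreviation "\<Phi> \<equiv> sandwich (\<lambda>e. e) adj"

definition "commutant = {x. (\<forall>s. s \<notin> I \<times> I \<longrightarrow> x s = 0) \<and> (\<forall>b\<in>M. mm I b x = mm I x b)}"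

lemma mm_add_right: "mm I b (\<lambda>s. x s + y s) = (\<lambda>s. mm I b x s + mm I b y s)"
  and mm_add_left: "mm I (\<lambda>s. x s + y s) b = (\<lambda>s. mm I x b s + mm I y b s)"
  and mm_scale_right: "mm I b (\<lambda>s. c * x s) = (\<lambda>s. c * mm I b x s)"
  and mm_scale_left: "mm I (\<lambda>s. c * x s) b = (\<lambda>s. c * mm I x b s)"
  by (auto simp: mm_def fun_eq_iff sum.distrib algebra_simps sum_distrib_left)

lemma mm_sum_right: "mm I b (\<lambda>s. \<Sum>e\<in>K. x e s) = (\<lambda>s. \<Sum>e\<in>K. mm I b (x e) s)"
  and mm_sum_left: "mm I (\<lambda>s. \<Sum>e\<in>K. x e s) b = (\<lambda>s. \<Sum>e\<in>K. mm I (x e) b s)"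
  by (auto simp: mm_def fun_eq_iff sum_distrib_left sum_distrib_right sum.swap[of _ I K])

lemma fsubspace_commutant: "fsubspace (I \<times> I) commutant"
  unfolding fsubspace_def commutant_def
  by (auto simp: mm_add_left mm_add_right mm_scale_left mm_scale_right) (auto simp: mm_def)

lemma \<Phi>_commutant: "\<Phi> c \<in> commutant"
proof -
  have "\<Phi> c s = 0" if s: "s \<notin> I \<times> I" for s
  proof -
    obtain i j where ij: "s = (i, j)" by (cases s)
    have "e (i, x) * adj e (y, j) = 0" if "e \<in> E" for e x y
      using that s ij fsubspaceD(1)[OF sub E_M[OF that]] by auto
    then have "(\<Sum>e\<in>E. e (i, x) * adj e (y, j)) = 0" for x y by (intro sum.neutral ballI)
    then show ?thesis by (simp only: ij sandwich_apply) simp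
  qed
  moreover have "mm I b (\<Phi> c) = mm I (\<Phi> c) b" if b: "b \<in> M" for b
  proof -
    have "mm I b (\<Phi> c) = sandwich (mm I b) adj c"
      unfolding sandwich_def mm_sum_right by (simp add: mm_assoc)
    also have "\<dots> = sandwich (\<lambda>e. e) (\<lambda>e. mm I (adj e) b) c"
      using sandwich_cong[OF casimir_commutes[OF b]] by simp
    also have "\<dots> = mm I (\<Phi> c) b"
      unfolding sandwich_def mm_sum_left by (simp add: mm_assoc)
    finally show ?thesis .
  qed
  ultimately show ?thesis by (simp add: commutant_def)
qed

lemma ip_sandwich: "ipp y (sandwich P Q c) = (\<Sum>e\<in>E. ipp y (mm I (mm I (P e) c) (Q e)))"
  using ip_sum_right[of "I \<times> I" y "\<lambda>_. 1" "\<lambda>e. mm I (mm I (P e) c) (Q e)" E]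
  by (simp add: sandwich_def)

lemma \<Phi>_selfadjoint: "ipp y (\<Phi> c) = ipp (\<Phi> y) c"
proof -
  have "ipp y (\<Phi> c) = (\<Sum>e\<in>E. ipp (mm I (mm I (adj e) y) e) c)"
    unfolding ip_sandwich
    by (rule sum.cong[OF refl])
      (metis adj_adj ip_mm_left ip_mm_right mm_assoc)
  also have "\<dots> = cnj (ipp c (sandwich adj (\<lambda>e. e) y))"
    by (simp add: ip_sandwich cnj_sum cnj_ip)
  also have "sandwich adj (\<lambda>e. e) y = \<Phi> y"
    using sandwich_cong[OF casimir_swap] by simp
  finally show ?thesis by (simp add: cnj_ip)
qed

text \<open>The sum equals \<open>\<langle>c, \<Phi> c\<rangle>\<close>. Write \<open>c = c1 + c2\<close> with \<open>c1\<close> in the commutant of \<open>M\<close> and \<open>c2\<close> orthogonal to it.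
As \<open>\<Phi>\<close> is self-adjoint with values in the commutant, it kills \<open>c2\<close>, and only \<open>\<langle>c1, \<Phi> c1\<rangle>\<close> remains; since \<open>c1\<close>
commutes with every \<open>e\<close>, this is the sum of the squared norms of the matrices \<open>c1 e\<close>.\<close>

theorem kern_completely_positive:
  "\<exists>r\<ge>0. (\<Sum>i\<in>I. \<Sum>j\<in>I. \<Sum>i'\<in>I. \<Sum>j'\<in>I. cnj (c (i, j)) * c (i', j') * kern E (i, i') (j, j'))
     = complex_of_real r"
proof -
  have lhs: "(\<Sum>i\<in>I. \<Sum>j\<in>I. \<Sum>i'\<in>I. \<Sum>j'\<in>I. cnj (c (i, j)) * c (i', j') * kern E (i, i') (j, j'))
     = ipp c (\<Phi> c)"
    by (simp add: ip_square sandwich_apply sum_distrib_left kern_def mult_ac)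
  obtain E' where E': "onb (I \<times> I) commutant E'"
    using onb_exists[OF _ fsubspace_commutant] finI by auto
  define c1 where "c1 = (\<lambda>s. \<Sum>e\<in>E'. ipp e c * e s)"
  define c2 where "c2 = (\<lambda>s. c s + (- 1) * c1 s)"
  have c1N: "c1 \<in> commutant" unfolding c1_def
    by (rule fsubspace_sum[OF fsubspace_commutant, of E' "\<lambda>e. e"]) (use E' in \<open>auto simp: onb_def\<close>)
  have ipc2: "ipp n c2 = 0" if n: "n \<in> commutant" for n
  proof -
    have "ipp e c2 = 0" if e: "e \<in> E'" for e
    proof -
      have "ipp e c1 = (\<Sum>f\<in>E'. ipp f c * (if e = f then 1 else 0))"
        unfolding c1_def ip_sum_right using E' e by (simp add: onb_def)
      also have "\<dots> = ipp e c" using E' e by (simp add: onb_def if_distrib cong: if_cong)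
      finally show ?thesis unfolding c2_def ip_add_right ip_scale_right by simp
    qed
    then have "ipp c2 e = 0" if "e \<in> E'" for e
      using cnj_ip[of "I \<times> I" e c2] that by simp
    then have "ipp c2 (\<lambda>s. \<Sum>e\<in>E'. ipp e n * e s) = 0"
      unfolding ip_sum_right by simp
    moreover have "n = (\<lambda>s. \<Sum>e\<in>E'. ipp e n * e s)"
      using E' n unfolding onb_def by (elim conjE) (drule (1) bspec)
    ultimately have "ipp c2 n = 0" by (rule back_subst[where P = "\<lambda>n. ipp c2 n = 0", OF _ sym])
    then show ?thesis using cnj_ip[of "I \<times> I" c2 n] by simp
  qed
  have \<Phi>c2: "\<Phi> c2 s = 0" for s
  proof (cases "s \<in> I \<times> I")
    case True
    have "ipp (\<Phi> c2) (\<Phi> c2) = ipp (\<Phi> (\<Phi> c2)) c2" by (rule \<Phi>_selfadjoint)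
    also have "\<dots> = 0" by (rule ipc2[OF \<Phi>_commutant])
    finally have "ipp (\<Phi> c2) (\<Phi> c2) = 0" .
    then show ?thesis by (rule ip_self_eq_0[OF _ _ True, rotated]) (use finI in simp)
  next
    case False
    then show ?thesis using \<Phi>_commutant[of c2] unfolding commutant_def by blast
  qed
  have "\<Phi> c s = \<Phi> c1 s" for s
  proof -
    have "\<Phi> c s = \<Phi> (\<lambda>s. c1 s + c2 s) s" by (simp add: c2_def)
    also have "\<dots> = \<Phi> c1 s + \<Phi> c2 s"
      by (simp add: sandwich_def mm_add_right mm_add_left sum.distrib)
    finally show ?thesis using \<Phi>c2 by simp
  qed
  then have \<Phi>: "\<Phi> c = \<Phi> c1" by blast
  have "ipp c (\<Phi> c1) = ipp c1 (\<Phi> c1)"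
  proof -
    have "ipp (\<Phi> c1) c = ipp (\<Phi> c1) c1 + ipp (\<Phi> c1) c2"
      using ip_add_right[of _ "\<Phi> c1" c1 c2] by (simp add: c2_def)
    then have "cnj (ipp (\<Phi> c1) c) = cnj (ipp (\<Phi> c1) c1)" using ipc2[OF \<Phi>_commutant] by simp
    then show ?thesis by (simp only: cnj_ip)
  qed
  also have "\<dots> = (\<Sum>e\<in>E. ipp (mm I c1 e) (mm I c1 e))"
    unfolding ip_sandwich
  proof (rule sum.cong[OF refl])
    fix e assume "e \<in> E"
    then have "mm I e c1 = mm I c1 e" using c1N E_M by (auto simp: commutant_def)
    then show "ipp c1 (mm I (mm I e c1) (adj e)) = ipp (mm I c1 e) (mm I c1 e)"
      by (simp flip: ip_mm_right)
  qed
  also have "\<dots> = complex_of_real (\<Sum>e\<in>E. \<Sum>s\<in>I\<times>I. (cmod (mm I c1 e s))\<^sup>2)"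
    using finI by (simp only: ip_self finite_cartesian_product of_real_sum)
  finally have "ipp c (\<Phi> c1) = complex_of_real (\<Sum>e\<in>E. \<Sum>s\<in>I\<times>I. (cmod (mm I c1 e s))\<^sup>2)" .
  then show ?thesis unfolding lhs \<Phi>
    by (intro exI[of _ "\<Sum>e\<in>E. \<Sum>s\<in>I\<times>I. (cmod (mm I c1 e s))\<^sup>2"]) (simp add: sum_nonneg)
qed

end

section \<open>Noncrossing patterns\<close>
text \<open>The action of a colour on a letter: black is the identity, white the bar.\<close>

definition tw :: "bool \<Rightarrow> idx \<Rightarrow> idx" where
  "tw c z = (if c then conj_idx z else z)"

lemma conj_conj [simp]: "conj_idx (conj_idx z) = z"
  by (simp add: conj_idx_def)
lemma conj_neq [simp]: "conj_idx z \<noteq> z" "z \<noteq> conj_idx z"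
  by (cases z; simp add: conj_idx_def)+
lemma conj_in_J [simp]: "conj_idx z \<in> Jset p \<longleftrightarrow> z \<in> Jset p"
  by (cases z) (simp add: conj_idx_def Jset_def)
lemma conj_eq_iff [simp]: "conj_idx z = conj_idx y \<longleftrightarrow> z = y"
  by (metis conj_conj)
lemma tw_tw: "tw c (tw c' z) = tw (c \<noteq> c') z"
  by (simp add: tw_def)
lemma tw_self [simp]: "tw c (tw c z) = z"
  by (simp add: tw_def)
lemma tw_in_J [simp]: "tw c z \<in> Jset p \<longleftrightarrow> z \<in> Jset p"
  by (simp add: tw_def)
lemma tw_eq_iff: "tw c z = tw c' z \<longleftrightarrow> c = c'"
  by (auto simp: tw_def)
lemma tw_inj [simp]: "tw c z = tw c y \<longleftrightarrow> z = y"
  by (metis tw_self)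

lemma finite_J [simp]: "finite (Jset p)"
  by (simp add: Jset_def)
lemma words_append_len: "length u = a \<Longrightarrow> u @ v \<in> words p (a + b) \<longleftrightarrow> u \<in> words p a \<and> v \<in> words p b"
  by (auto simp: words_def)
lemma words_length: "w \<in> words p n \<Longrightarrow> length w = n"
  by (simp add: words_def)
lemma words_0 [simp]: "words p 0 = {[]}"
  by (auto simp: words_def)
lemma words_rev [simp]: "rev w \<in> words p n \<longleftrightarrow> w \<in> words p n"
  by (simp add: words_def)
lemma words_splitE:
  assumes "w \<in> words p n" "a < n"
  obtains u z v where "w = u @ z # v" "length u = a" "u \<in> words p a" "z \<in> Jset p"
    "v \<in> words p (n - Suc a)"
proof
  show "w = take a w @ (w ! a) # drop (Suc a) w" using assms by (simp add: id_take_nth_drop words_def)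
qed (use assms in \<open>auto simp: words_def dest: in_set_takeD in_set_dropD\<close>)

lemma sum_words_append:
  "(\<Sum>w\<in>words p (a + b). \<phi> w) = (\<Sum>u\<in>words p a. \<Sum>v\<in>words p b. \<phi> (u @ v))"
proof -
  have "(\<Sum>w\<in>words p (a + b). \<phi> w) = (\<Sum>(u, v)\<in>words p a \<times> words p b. \<phi> (u @ v))"
    by (rule sum.reindex_bij_witness[where i = "\<lambda>(u, v). u @ v" and j = "\<lambda>w. (take a w, drop a w)"])
      (auto simp: words_def dest: in_set_takeD in_set_dropD)
  then show ?thesis by (simp add: sum.cartesian_product)
qed

lemma sum_words_1: "(\<Sum>w\<in>words p (Suc 0). \<phi> w) = (\<Sum>z\<in>Jset p. \<phi> [z])"
  by (rule sum.reindex_bij_witness[where i = "\<lambda>z. [z]" and j = "hd"])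
    (auto simp: words_def length_Suc_conv)

lemma sum_words_Suc: "(\<Sum>w\<in>words p (Suc n). \<phi> w) = (\<Sum>z\<in>Jset p. \<Sum>v\<in>words p n. \<phi> (z # v))"
  using sum_words_append[of \<phi> p 1 n] by (simp add: sum_words_1)

lemma sum_words_snoc: "(\<Sum>w\<in>words p (Suc n). \<phi> w) = (\<Sum>u\<in>words p n. \<Sum>z\<in>Jset p. \<phi> (u @ [z]))"
  using sum_words_append[of \<phi> p n 1] by (simp add: sum_words_1)

text \<open>A coloured partition of \<open>n\<close> points on a line is stored as the list of pairs of a block label and a
colour. Lists make the operations on neighbouring points easy to express; the labels only matter up to
renaming. A word matches the pattern if it arises by choosing one letter per block and twisting it by the
colours.\<close>

type_synonym pattern = "(nat \<times> bool) list"

definition pat :: "pattern \<Rightarrow> idx list \<Rightarrow> bool" where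
  "pat q w \<longleftrightarrow> (\<exists>g. w = map (\<lambda>(l, c). tw c (g l)) q)"

definition pvec :: "nat \<Rightarrow> pattern \<Rightarrow> idx list \<Rightarrow> complex" where
  "pvec p q w = (if w \<in> words p (length q) \<and> pat q w then 1 else 0)"

definition nc :: "pattern \<Rightarrow> bool" where
  "nc q \<longleftrightarrow> (\<forall>a b c d. a < b \<and> b < c \<and> c < d \<and> d < length q \<and>
     fst (q ! a) = fst (q ! c) \<and> fst (q ! b) = fst (q ! d) \<longrightarrow> fst (q ! a) = fst (q ! b))"

lemma ncD: "nc q \<Longrightarrow> a < b \<Longrightarrow> b < c \<Longrightarrow> c < d \<Longrightarrow> d < length q \<Longrightarrow>
    fst (q ! a) = fst (q ! c) \<Longrightarrow> fst (q ! b) = fst (q ! d) \<Longrightarrow> fst (q ! a) = fst (q ! b)"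
  unfolding nc_def by blast

text \<open>A crossing of \<open>q'\<close> alternates between two labels, so its four points stay distinct under the monotone
map \<open>s\<close> and give a crossing of \<open>q\<close>. This covers deletion, doubling and recolouring of points.\<close>

lemma nc_reindex:
  assumes "nc q"
    and s: "\<And>i. i < length q' \<Longrightarrow> s i < length q \<and> fst (q' ! i) = fst (q ! s i)"
    and mono: "\<And>i j. i \<le> j \<Longrightarrow> j < length q' \<Longrightarrow> s i \<le> s j"
  shows "nc q'"
  unfolding nc_def
proof (intro allI impI, elim conjE, rule ccontr)
  fix a b c d
  assume *: "a < b" "b < c" "c < d" "d < length q'" "fst (q' ! a) = fst (q' ! c)"
    "fst (q' ! b) = fst (q' ! d)" "fst (q' ! a) \<noteq> fst (q' ! b)"
  have lt: "a < length q'" "b < length q'" "c < length q'" using * by auto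
  have "s a < s b" "s b < s c" "s c < s d"
    using mono[of a b] mono[of b c] mono[of c d] s * lt
    by (metis less_imp_le le_neq_implies_less)+
  then have "fst (q ! s a) = fst (q ! s b)"
    using ncD[OF assms(1), of "s a" "s b" "s c" "s d"] s * lt by simp
  then show False using s * lt by simp
qed

lemma nc_delete: "nc (q1 @ x # q2) \<Longrightarrow> nc (q1 @ q2)"
  by (rule nc_reindex[where s = "\<lambda>i. if i < length q1 then i else Suc i"])
    (auto simp: nth_append)

lemma nth_append_mid: "(q1 @ x # q2) ! i =
    (if i < length q1 then q1 ! i else if i = length q1 then x else q2 ! (i - Suc (length q1)))"
  by (cases "i - length q1") (auto simp: nth_append diff_Suc)

lemma nc_dup: "nc (q1 @ (l, c) # q2) \<Longrightarrow> nc (q1 @ (l, c) # (l, c') # q2)"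
  by (rule nc_reindex[where s = "\<lambda>i. if i \<le> length q1 then i else i - 1"])
    (auto simp: nth_append_mid nth_append_mid[of q1 "(l, c)" "(l, c') # q2"] nth_Cons' numeral_2_eq_2)

lemma nc_recolour: "nc (q1 @ (l, c) # q2) \<Longrightarrow> nc (q1 @ (l, c') # q2)"
  by (rule nc_reindex[where s = "\<lambda>i. i"]) (auto simp: nth_append_mid)

lemma nc_fresh:
  assumes "nc (q1 @ q2)" "l \<notin> fst ` set (q1 @ q2)"
  shows "nc (q1 @ (l, c) # q2)"
  unfolding nc_def
proof (intro allI impI, elim conjE)
  let ?q = "q1 @ (l, c) # q2"
  define s where "s i = (if i < length q1 then i else i - 1)" for i
  fix i j m n
  assume *: "i < j" "j < m" "m < n" "n < length ?q" "fst (?q ! i) = fst (?q ! m)"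
    "fst (?q ! j) = fst (?q ! n)"
  have fresh: "fst (?q ! a) \<noteq> l" if "a < length ?q" "a \<noteq> length q1" for a
  proof -
    have "?q ! a \<in> set (q1 @ q2)"
      using that by (auto simp: nth_append_mid)
    then show ?thesis using assms(2) by (metis imageI)
  qed
  have mid: "fst (?q ! length q1) = l" by simp
  have "i \<noteq> length q1" "j \<noteq> length q1" "m \<noteq> length q1" "n \<noteq> length q1"
    using fresh mid * by (metis less_trans less_irrefl)+
  moreover have "?q ! a = (q1 @ q2) ! s a" if "a \<noteq> length q1" for a
    using that by (auto simp: nth_append_mid nth_append s_def)
  moreover have "s i < s j" "s j < s m" "s m < s n" "s n < length (q1 @ q2)"
    using * calculation(1-4) by (auto simp: s_def)
  ultimately show "fst (?q ! i) = fst (?q ! j)"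
    using ncD[OF assms(1), of "s i" "s j" "s m" "s n"] * by simp
qed

lemma nc_rev: "nc q \<Longrightarrow> nc (rev q)"
  unfolding nc_def
proof (intro allI impI, elim conjE)
  fix a b c d
  assume q: "\<forall>a b c d. a < b \<and> b < c \<and> c < d \<and> d < length q \<and>
     fst (q ! a) = fst (q ! c) \<and> fst (q ! b) = fst (q ! d) \<longrightarrow> fst (q ! a) = fst (q ! b)"
  assume *: "a < b" "b < c" "c < d" "d < length (rev q)" "fst (rev q ! a) = fst (rev q ! c)"
    "fst (rev q ! b) = fst (rev q ! d)"
  let ?n = "length q"
  have "fst (q ! (?n - Suc d)) = fst (q ! (?n - Suc c))"
  proof (rule q[rule_format, of "?n - Suc d" "?n - Suc c" "?n - Suc b" "?n - Suc a"], intro conjI)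
    show "?n - Suc d < ?n - Suc c" "?n - Suc c < ?n - Suc b" "?n - Suc b < ?n - Suc a" "?n - Suc a < ?n"
      using *(1-4) unfolding length_rev by arith+
  qed (use * in \<open>simp_all add: rev_nth\<close>)
  then show "fst (rev q ! a) = fst (rev q ! b)" using * by (simp add: rev_nth)
qed

lemma nc_append_disjoint:
  assumes "nc q" "nc q'" "fst ` set q \<inter> fst ` set q' = {}"
  shows "nc (q @ q')"
  unfolding nc_def
proof (intro allI impI, elim conjE)
  fix a b c d
  assume *: "a < b" "b < c" "c < d" "d < length (q @ q')" "fst ((q @ q') ! a) = fst ((q @ q') ! c)"
    "fst ((q @ q') ! b) = fst ((q @ q') ! d)"
  have sep: "fst ((q @ q') ! i) \<noteq> fst ((q @ q') ! j)"
    if "i < length q" "length q \<le> j" "j < length (q @ q')" for i j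
    using that assms(3) by (auto simp: nth_append) (metis disjoint_iff imageI nth_mem add.commute less_diff_conv2)
  have side: "a < length q \<longleftrightarrow> c < length q" "b < length q \<longleftrightarrow> d < length q"
    using sep[of a c] sep[of b d] * by (meson leI less_trans)+
  show "fst ((q @ q') ! a) = fst ((q @ q') ! b)"
  proof (cases "a < length q")
    case True
    then have "c < length q" "b < length q" "d < length q" using side * by auto
    then show ?thesis using ncD[OF assms(1), of a b c d] * True by (simp add: nth_append)
  next
    case False
    then show ?thesis
      using ncD[OF assms(2), of "a - length q" "b - length q" "c - length q" "d - length q"] *
      by (simp add: nth_append)
  qed
qed

lemma nc_reindex_inj:
  assumes "nc q" "length q' = length q" "inj r"
    "\<And>i. i < length q \<Longrightarrow> fst (q' ! i) = r (fst (q ! i))"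
  shows "nc q'"
  unfolding nc_def
proof (intro allI impI, elim conjE)
  fix a b c d
  assume *: "a < b" "b < c" "c < d" "d < length q'" "fst (q' ! a) = fst (q' ! c)"
    "fst (q' ! b) = fst (q' ! d)"
  then have "fst (q ! a) = fst (q ! c)" "fst (q ! b) = fst (q ! d)"
    using assms(2-4) by (simp_all add: inj_eq)
  then have "fst (q ! a) = fst (q ! b)" using ncD[OF assms(1), of a b c d] * assms(2) by simp
  then show "fst (q' ! a) = fst (q' ! b)" using assms(2,4) * by simp
qed

lemma nc_relabel: "nc q \<Longrightarrow> (\<And>x. fst (\<rho> x) = r (fst x)) \<Longrightarrow> inj r \<Longrightarrow> nc (map \<rho> q)"
  by (rule nc_reindex_inj[of q _ r]) simp_all

text \<open>Joining the blocks of two neighbours \<open>a\<close> and \<open>Suc a\<close> creates no crossing. If one pair of a crossing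
were made of points from the two joined blocks, one of its points could be replaced by the
neighbour from the block of the other point, giving a crossing of \<open>q\<close>; which of the two works depends on the side of
\<open>a\<close> on which the other pair lies.\<close>

lemma nc_merge:
  assumes q: "nc q" and a: "Suc a < length q"
    and \<rho>: "\<And>x. fst (\<rho> x) = (if fst x = fst (q ! Suc a) then fst (q ! a) else fst x)"
  shows "nc (map \<rho> q)"
  unfolding nc_def
proof (intro allI impI, elim conjE, rule ccontr)
  fix x1 x2 x3 x4
  assume *: "x1 < x2" "x2 < x3" "x3 < x4" "x4 < length (map \<rho> q)"
    "fst (map \<rho> q ! x1) = fst (map \<rho> q ! x3)" "fst (map \<rho> q ! x2) = fst (map \<rho> q ! x4)"
    "fst (map \<rho> q ! x1) \<noteq> fst (map \<rho> q ! x2)"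
  define L where "L i = fst (q ! i)" for i
  define r where "r l = (if l = L (Suc a) then L a else l)" for l
  have lt: "x1 < length q" "x2 < length q" "x3 < length q" "x4 < length q" using * by auto
  have map_r: "fst (map \<rho> q ! i) = r (L i)" if "i < length q" for i
    using that by (simp add: r_def L_def \<rho>)
  have r: "r (L x1) = r (L x3)" "r (L x2) = r (L x4)" "r (L x1) \<noteq> r (L x2)"
    using *(5-7) unfolding map_r[OF lt(1)] map_r[OF lt(2)] map_r[OF lt(3)] map_r[OF lt(4)] by blast+
  have nc: "\<lbrakk>i < j; j < m; m < n; n < length q; L i = L m; L j = L n\<rbrakk> \<Longrightarrow> L i = L j" for i j m n
    using ncD[OF q, of i j m n] by (simp add: L_def)
  have merged: "(l = L a \<or> l = L (Suc a))" if "r l = r l'" "l \<noteq> l'" for l l'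
    using that by (auto simp: r_def split: if_splits)
  have rL: "r (L a) = r (L (Suc a))" by (simp add: r_def)
  have nearby: "\<exists>y. (y = a \<or> y = Suc a) \<and> L y = l" if "r l = r l'" "l \<noteq> l'" for l l'
    using merged[OF that] by blast
  consider "L x1 = L x3" "L x2 = L x4" | "L x1 \<noteq> L x3" | "L x2 \<noteq> L x4" by blast
  then show False
  proof cases
    case 1
    then show ?thesis using nc[of x1 x2 x3 x4] r * lt by auto
  next
    case 2
    obtain y1 where y1: "y1 = a \<or> y1 = Suc a" "L y1 = L x1" using nearby[OF r(1) 2] by blast
    obtain y3 where y3: "y3 = a \<or> y3 = Suc a" "L y3 = L x3" using nearby[OF r(1)[symmetric] 2[symmetric]] by blast
    have ry: "r (L y1) = r (L a)" "r (L y3) = r (L a)" using y1 y3 rL by auto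
    have neq: "L x2 \<noteq> L a" "L x2 \<noteq> L (Suc a)" "L x4 \<noteq> L a" "L x4 \<noteq> L (Suc a)"
      using r ry(1) y1(2) rL by auto
    have eq: "L x2 = L x4" using merged[OF r(2)] neq by blast
    have ne: "a \<noteq> x2" "Suc a \<noteq> x2" "a \<noteq> x4" "Suc a \<noteq> x4" using neq by auto
    consider "Suc a < x2" | "x2 < a" "Suc a < x4" | "x4 < a" using ne by linarith
    then show ?thesis
    proof cases
      case 1
      then have "y3 < x2" using y3 by auto
      then show ?thesis using nc[of y3 x2 x3 x4] y3 eq r ry y1 * lt by auto
    next
      case 2
      then have "x2 < y1" "y1 < x4" using y1 by auto
      then show ?thesis using nc[of x1 x2 y1 x4] y1 eq r * lt by auto
    next
      case 3
      then have "x4 < y3" "y3 < length q" using y3 a by auto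
      then show ?thesis using nc[of x2 x3 x4 y3] y3 eq r * lt by auto
    qed
  next
    case 3
    obtain y2 where y2: "y2 = a \<or> y2 = Suc a" "L y2 = L x2" using nearby[OF r(2) 3] by blast
    obtain y4 where y4: "y4 = a \<or> y4 = Suc a" "L y4 = L x4" using nearby[OF r(2)[symmetric] 3[symmetric]] by blast
    have ry: "r (L y2) = r (L a)" "r (L y4) = r (L a)" using y2 y4 rL by auto
    have neq: "L x1 \<noteq> L a" "L x1 \<noteq> L (Suc a)" "L x3 \<noteq> L a" "L x3 \<noteq> L (Suc a)"
      using r ry(1) y2(2) rL by auto
    have eq: "L x1 = L x3" using merged[OF r(1)] neq by blast
    have ne: "a \<noteq> x1" "Suc a \<noteq> x1" "a \<noteq> x3" "Suc a \<noteq> x3" using neq by auto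
    consider "Suc a < x1" | "x1 < a" "Suc a < x3" | "x3 < a" using ne by linarith
    then show ?thesis
    proof cases
      case 1
      then have "y2 < x1" using y2 by auto
      then show ?thesis using nc[of y2 x1 x2 x3] y2 eq r * lt by auto
    next
      case 2
      then have "x1 < y4" "y4 < x3" using y4 by auto
      then show ?thesis using nc[of x1 y4 x3 x4] y4 eq r * lt by auto
    next
      case 3
      then have "x3 < y2" "y2 < length q" using y2 a by auto
      then show ?thesis using nc[of x1 x2 x3 y2] y2 eq r * lt by auto
    qed
  qed
qed

text \<open>Take two points \<open>x\<close> and \<open>x + k\<close> of one block at minimal distance. If \<open>k > 1\<close>, the block of \<open>Suc x\<close> is a
singleton: another point of it would lie between the two, contradicting minimality, or outside,
producing a crossing.\<close>

lemma nc_interval: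
  assumes q: "nc q" and ne: "q \<noteq> []"
  shows "(\<exists>a. Suc a < length q \<and> fst (q ! a) = fst (q ! Suc a)) \<or>
    (\<exists>a<length q. \<forall>b<length q. b \<noteq> a \<longrightarrow> fst (q ! b) \<noteq> fst (q ! a))"
proof (rule ccontr)
  assume contra: "\<not> ?thesis"
  have adj: "fst (q ! a) \<noteq> fst (q ! Suc a)" if "Suc a < length q" for a using contra that by blast
  define P where "P k \<longleftrightarrow> (\<exists>x. x + k < length q \<and> k > 0 \<and> fst (q ! x) = fst (q ! (x + k)))" for k
  obtain b where b: "b < length q" "b \<noteq> 0" "fst (q ! b) = fst (q ! 0)"
    using contra ne by (metis length_greater_0_conv)
  then have "\<exists>k. P k" unfolding P_def by (intro exI[of _ b] exI[of _ 0]) auto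
  then have "P (LEAST k. P k)" by (rule LeastI_ex)
  then obtain k x where k: "k = (LEAST k. P k)" "x + k < length q" "k > 0" "fst (q ! x) = fst (q ! (x + k))"
    unfolding P_def by blast
  have least: "k \<le> m" if "P m" for m using that k(1) by (simp add: Least_le)
  have k2: "k \<noteq> 1" using adj[of x] k(2,4) by auto
  obtain z where z: "z < length q" "z \<noteq> Suc x" "fst (q ! z) = fst (q ! Suc x)"
  proof -
    have "Suc x < length q" using k(2,3) by simp
    then show ?thesis using contra that by blast
  qed
  have x1: "Suc x < x + k" using k(3) k2 by simp
  have no: "\<not> P m" if "m < k" for m using least that by force
  consider "z < x" | "z = x" | "Suc x < z" "z < x + k" | "z = x + k" | "x + k < z" using z(2) by linarith
  then show False
  proof cases
    case 1
    then have "fst (q ! z) = fst (q ! x)" using ncD[OF q, of z x "Suc x" "x + k"] k z x1 by simp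
    then show ?thesis using adj[of x] z(3) k(2) x1 by simp
  next
    case 2
    then show ?thesis using adj[of x] z(3) k(2) x1 by simp
  next
    case 3
    then have "P (z - Suc x)" unfolding P_def using z by (intro exI[of _ "Suc x"]) auto
    then show ?thesis using no 3 by auto
  next
    case 4
    have eq: "Suc x + (k - 1) = x + k" using k(3) by simp
    have "P (k - 1)" unfolding P_def
      by (intro exI[of _ "Suc x"], unfold eq) (use z(3) k(2) x1 4 in auto)
    then show ?thesis using no k(3) by auto
  next
    case 5
    then have "fst (q ! x) = fst (q ! Suc x)" using ncD[OF q, of x "Suc x" "x + k" z] k z x1 by simp
    then show ?thesis using adj[of x] z(3) k(2) x1 by simp
  qed
qed

lemma nc_induct [consumes 1, case_names Nil fresh dup]:
  assumes "nc q" and Nil: "P []"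
    and fresh: "\<And>q1 q2 l c. nc (q1 @ q2) \<Longrightarrow> P (q1 @ q2) \<Longrightarrow> l \<notin> fst ` set (q1 @ q2) \<Longrightarrow> P (q1 @ (l, c) # q2)"
    and dup: "\<And>q1 q2 l c c'. nc (q1 @ (l, c) # q2) \<Longrightarrow> P (q1 @ (l, c) # q2) \<Longrightarrow> P (q1 @ (l, c) # (l, c') # q2)"
  shows "P q"
  using assms(1)
proof (induction "length q" arbitrary: q rule: less_induct)
  case less
  show ?case
  proof (cases "q = []")
    case True
    then show ?thesis using Nil by simp
  next
    case False
    have split: "q = take a q @ (q ! a) # drop (Suc a) q" if "a < length q" for a
      using that by (rule id_take_nth_drop)
    from nc_interval[OF less.prems False] show ?thesis
    proof (elim disjE exE conjE)
      fix a assume a: "Suc a < length q" "fst (q ! a) = fst (q ! Suc a)"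
      obtain l c c' where lc: "q ! a = (l, c)" "q ! Suc a = (l, c')" using a(2) by (cases "q ! a"; cases "q ! Suc a") auto
      have "drop (Suc a) q = (l, c') # drop (Suc (Suc a)) q" using a(1) lc(2) Cons_nth_drop_Suc by metis
      then have q: "q = take a q @ (l, c) # (l, c') # drop (Suc (Suc a)) q"
        using split[of a] a lc by simp
      define q1 q2 where "q1 = take a q" and "q2 = drop (Suc (Suc a)) q"
      have q': "q = q1 @ (l, c) # (l, c') # q2" using q by (simp add: q1_def q2_def)
      have "nc (q1 @ (l, c) # q2)" using nc_delete[of "q1 @ [(l, c)]"] less.prems q' by simp
      then show ?thesis using dup less.hyps q' by simp
    next
      fix a assume a: "a < length q" "\<forall>b<length q. b \<noteq> a \<longrightarrow> fst (q ! b) \<noteq> fst (q ! a)"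
      define q1 q2 where "q1 = take a q" and "q2 = drop (Suc a) q"
      obtain l c where lc: "q ! a = (l, c)" by (cases "q ! a")
      have q': "q = q1 @ (l, c) # q2" using split[OF a(1)] lc by (simp add: q1_def q2_def)
      have len: "length q1 = a" using a by (simp add: q1_def)
      have "l \<notin> fst ` set (q1 @ q2)"
      proof
        assume "l \<in> fst ` set (q1 @ q2)"
        then obtain i where i: "i < length (q1 @ q2)" "l = fst ((q1 @ q2) ! i)"
          by (auto simp: in_set_conv_nth simp del: set_append)
        define b where "b = (if i < a then i else Suc i)"
        have "b < length q" "b \<noteq> a" "q ! b = (q1 @ q2) ! i"
          using i len by (auto simp: b_def q' nth_append_mid nth_append)
        then show False using a(2) i lc by auto
      qed
      moreover have "nc (q1 @ q2)" using nc_delete less.prems q' by metis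
      ultimately show ?thesis using fresh less.hyps q' by simp
    qed
  qed
qed

section \<open>Spans of noncrossing patterns\<close>
interpretation fvec: vector_space "\<lambda>(c::complex) (f :: idx list \<Rightarrow> complex) w. c * f w"
  by unfold_locales (auto simp: fun_eq_iff algebra_simps)

definition F :: "nat \<Rightarrow> nat \<Rightarrow> (idx list \<Rightarrow> complex) set" where
  "F p n = fvec.span {pvec p q |q. nc q \<and> length q = n}"

lemma F_base: "nc q \<Longrightarrow> length q = n \<Longrightarrow> pvec p q \<in> F p n"
  unfolding F_def by (rule fvec.span_base) blast

lemma F_zero: "(\<lambda>_. 0) \<in> F p n"
  using fvec.span_zero unfolding F_def zero_fun_def by blast
lemma F_add: "f \<in> F p n \<Longrightarrow> g \<in> F p n \<Longrightarrow> (\<lambda>w. f w + g w) \<in> F p n"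
  using fvec.span_add unfolding F_def plus_fun_def by blast
lemma F_scale: "f \<in> F p n \<Longrightarrow> (\<lambda>w. c * f w) \<in> F p n"
  using fvec.span_scale unfolding F_def by blast

lemma F_induct [consumes 1, case_names zero base add scale]:
  assumes "f \<in> F p n" and "P (\<lambda>_. 0)"
    and "\<And>q. nc q \<Longrightarrow> length q = n \<Longrightarrow> P (pvec p q)"
    and "\<And>f g. f \<in> F p n \<Longrightarrow> g \<in> F p n \<Longrightarrow> P f \<Longrightarrow> P g \<Longrightarrow> P (\<lambda>w. f w + g w)"
    and "\<And>c f. f \<in> F p n \<Longrightarrow> P f \<Longrightarrow> P (\<lambda>w. c * f w)"
  shows "P f"
proof -
  have "f \<in> F p n \<and> P f"
    using assms(1) unfolding F_def
  proof (induction rule: fvec.span_induct_alt)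
    case base
    then show ?case using assms(2) fvec.span_zero by (simp add: zero_fun_def)
  next
    case (step c x y)
    then obtain q where q: "x = pvec p q" "nc q" "length q = n" by blast
    have x: "x \<in> F p n" "P x" using F_base assms(3) q by auto
    then have cx: "(\<lambda>w. c * x w) \<in> F p n" "P (\<lambda>w. c * x w)" using F_scale assms(5) by auto
    have y: "y \<in> F p n" "P y" using step by (auto simp: F_def)
    show ?case
      using assms(4)[OF cx(1) y(1) cx(2) y(2)] F_add[OF cx(1) y(1)] by (simp add: plus_fun_def F_def)
  qed
  then show ?thesis ..
qed

text \<open>A map that is linear, or semilinear via \<open>\<sigma>\<close>, needs to be examined only on the vectors of the patterns.
The variant with \<open>\<sigma> = cnj\<close> handles complex conjugation.\<close>

lemma F_closed_under:
  assumes "f \<in> F p n"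
    and base: "\<And>q. nc q \<Longrightarrow> length q = n \<Longrightarrow> Op (pvec p q) \<in> F p m"
    and add: "\<And>f g. Op (\<lambda>w. f w + g w) = (\<lambda>w. Op f w + Op g w)"
    and scale: "\<And>c f. Op (\<lambda>w. c * f w) = (\<lambda>w. \<sigma> c * Op f w)" and "\<sigma> 0 = 0"
  shows "Op f \<in> F p m"
  using assms(1)
proof (induction rule: F_induct)
  case zero
  then show ?case using scale[of 0 "\<lambda>_. 0"] F_zero \<open>\<sigma> 0 = 0\<close> by simp
qed (simp_all add: base add scale F_add F_scale)

lemma F_support: "f \<in> F p n \<Longrightarrow> w \<notin> words p n \<Longrightarrow> f w = 0"
  by (induction rule: F_induct) (auto simp: pvec_def)

lemma fsubspace_F: "fsubspace (words p n) (F p n)"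
  unfolding fsubspace_def using F_support F_zero F_add F_scale by blast

lemma pat_append: "length u = length q1 \<Longrightarrow> pat (q1 @ q2) (u @ v) \<longleftrightarrow>
    (\<exists>g. u = map (\<lambda>(l, c). tw c (g l)) q1 \<and> v = map (\<lambda>(l, c). tw c (g l)) q2)"
  by (auto simp: pat_def append_eq_append_conv)

lemma pat_mid: "length u = length q1 \<Longrightarrow> pat (q1 @ (l, c) # q2) (u @ z # v) \<longleftrightarrow>
    (\<exists>g. u = map (\<lambda>(l, c). tw c (g l)) q1 \<and> z = tw c (g l) \<and> v = map (\<lambda>(l, c). tw c (g l)) q2)"
  by (auto simp: pat_def append_eq_append_conv)

lemma pat_mid2: "length u = length q1 \<Longrightarrow> pat (q1 @ (l, c) # (l', c') # q2) (u @ z # z' # v) \<longleftrightarrow>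
    (\<exists>g. u = map (\<lambda>(l, c). tw c (g l)) q1 \<and> z = tw c (g l) \<and> z' = tw c' (g l') \<and>
      v = map (\<lambda>(l, c). tw c (g l)) q2)"
  by (auto simp: pat_def append_eq_append_conv)

lemma pat_fresh:
  assumes "length u = length q1" "l \<notin> fst ` set (q1 @ q2)"
  shows "pat (q1 @ (l, c) # q2) (u @ z # v) \<longleftrightarrow> pat (q1 @ q2) (u @ v)"
proof
  assume "pat (q1 @ q2) (u @ v)"
  then obtain g where g: "u = map (\<lambda>(l, c). tw c (g l)) q1" "v = map (\<lambda>(l, c). tw c (g l)) q2"
    using assms(1) by (auto simp: pat_append)
  have keep: "map (\<lambda>(l, c). tw c (g l)) q = map (\<lambda>(l', c'). tw c' ((g(l := tw c z)) l')) q"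
    if "l \<notin> fst ` set q" for q
    using that by (induction q) auto
  have "l \<notin> fst ` set q1" "l \<notin> fst ` set q2" using assms(2) by auto
  then have "u = map (\<lambda>(l', c'). tw c' ((g(l := tw c z)) l')) q1"
      "v = map (\<lambda>(l', c'). tw c' ((g(l := tw c z)) l')) q2"
    using g keep by metis+
  moreover have "z = tw c ((g(l := tw c z)) l)" by simp
  ultimately show "pat (q1 @ (l, c) # q2) (u @ z # v)"
    unfolding pat_mid[OF assms(1)] by blast
qed (auto simp: pat_mid[OF assms(1)] pat_append[OF assms(1)])

lemma pattern_split:
  fixes q :: pattern
  assumes "a < length q"
  obtains q1 l c q2 where "q = q1 @ (l, c) # q2" "length q1 = a"
  using assms id_take_nth_drop[OF assms] by (metis length_take min.absorb4 surj_pair)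

definition dupw where "dupw a w = take (Suc a) w @ drop a w"
definition delw where "delw a w = take a w @ drop (Suc a) w"
definition insw where "insw a z w = take a w @ z # drop a w"
definition barw :: "nat \<Rightarrow> idx list \<Rightarrow> idx list" where
  "barw a w = take a w @ conj_idx (w ! a) # drop (Suc a) w"

lemma edit_simps [simp]:
  "length u = a \<Longrightarrow> dupw a (u @ z # v) = u @ z # z # v"
  "length u = a \<Longrightarrow> delw a (u @ z # v) = u @ v"
  "length u = a \<Longrightarrow> insw a z (u @ v) = u @ z # v"
  "length u = a \<Longrightarrow> barw a (u @ z # v) = u @ conj_idx z # v"
  by (auto simp: dupw_def delw_def insw_def barw_def)

lemma words_mid: "length u = a \<Longrightarrow> u @ z # v \<in> words p n \<longleftrightarrow>
    a < n \<and> u \<in> words p a \<and> z \<in> Jset p \<and> v \<in> words p (n - Suc a)"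
  by (auto simp: words_def)

lemma fun_eq_on_words:
  assumes "\<And>w. w \<notin> words p n \<Longrightarrow> f w = 0" "\<And>w. w \<notin> words p n \<Longrightarrow> g w = 0"
    and "a < n"
    and "\<And>u z v. length u = a \<Longrightarrow> u @ z # v \<in> words p n \<Longrightarrow> f (u @ z # v) = g (u @ z # v)"
  shows "f = g"
proof
  fix w
  show "f w = g w"
    using assms(1,2)[of w] assms(4) by (metis words_splitE[OF _ assms(3)])
qed

text \<open>Each of the elementary operations sends the vector of a noncrossing pattern to a multiple of
the vector of a noncrossing pattern.\<close>

lemma F_bar:
  assumes "f \<in> F p n" "a < n"
  shows "(\<lambda>w. if w \<in> words p n then f (barw a w) else 0) \<in> F p n"
proof (rule F_closed_under[OF assms(1)])
  fix q assume q: "nc q" "length q = n"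
  obtain q1 l c q2 where q': "q = q1 @ (l, c) # q2" "length q1 = a"
    using pattern_split assms(2) q(2) by metis
  have "(\<lambda>w. if w \<in> words p n then pvec p q (barw a w) else 0) = pvec p (q1 @ (l, \<not> c) # q2)"
  proof (rule fun_eq_on_words[OF _ _ assms(2)])
    fix u v :: "idx list" and z assume *: "length u = a" "u @ z # v \<in> words p n"
    have "pat q (u @ conj_idx z # v) \<longleftrightarrow> pat (q1 @ (l, \<not> c) # q2) (u @ z # v)"
    proof -
      have "conj_idx z = tw c y \<longleftrightarrow> z = tw (\<not> c) y" for y
        by (auto simp: tw_def)
      then show ?thesis using * q' by (simp add: pat_mid)
    qed
    then show "(if u @ z # v \<in> words p n then pvec p q (barw a (u @ z # v)) else 0) =
        pvec p (q1 @ (l, \<not> c) # q2) (u @ z # v)"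
      using * q q' by (simp add: pvec_def words_mid)
  qed (use q q' in \<open>simp_all add: pvec_def\<close>)
  then show "(\<lambda>w. if w \<in> words p n then pvec p q (barw a w) else 0) \<in> F p n"
    using q q' by (simp add: F_base nc_recolour)
qed (auto simp: fun_eq_iff)

lemma F_new:
  assumes "f \<in> F p n" "a \<le> n"
  shows "(\<lambda>w. if w \<in> words p (Suc n) then f (delw a w) else 0) \<in> F p (Suc n)"
proof (rule F_closed_under[OF assms(1)])
  fix q assume q: "nc q" "length q = n"
  define q1 q2 where "q1 = take a q" and "q2 = drop a q"
  have q': "q = q1 @ q2" "length q1 = a" using assms q by (simp_all add: q1_def q2_def)
  obtain l where l: "l \<notin> fst ` set (q1 @ q2)"
    using ex_new_if_finite[OF infinite_UNIV_nat] by (metis finite_imageI List.finite_set)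
  have "(\<lambda>w. if w \<in> words p (Suc n) then pvec p q (delw a w) else 0) = pvec p (q1 @ (l, False) # q2)"
  proof (rule fun_eq_on_words)
    show "a < Suc n" using assms by simp
    fix u v :: "idx list" and z assume *: "length u = a" "u @ z # v \<in> words p (Suc n)"
    then have "u @ v \<in> words p n" by (auto simp: words_def)
    then show "(if u @ z # v \<in> words p (Suc n) then pvec p q (delw a (u @ z # v)) else 0) =
        pvec p (q1 @ (l, False) # q2) (u @ z # v)"
      using * q q' pat_fresh[of u q1 l q2 False z v] l by (simp add: pvec_def)
  qed (use q q' in \<open>simp_all add: pvec_def\<close>)
  then show "(\<lambda>w. if w \<in> words p (Suc n) then pvec p q (delw a w) else 0) \<in> F p (Suc n)"
    using q q' nc_fresh[of q1 q2 l] l by (simp add: F_base)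
qed (auto simp: fun_eq_iff)

lemma F_dup:
  assumes "f \<in> F p n" "a < n"
  shows "(\<lambda>w. if w \<in> words p (Suc n) \<and> w ! a = w ! Suc a then f (delw a w) else 0) \<in> F p (Suc n)"
proof (rule F_closed_under[OF assms(1)])
  fix q assume q: "nc q" "length q = n"
  obtain q1 l c q2 where q': "q = q1 @ (l, c) # q2" "length q1 = a"
    using pattern_split assms(2) q(2) by metis
  have "(\<lambda>w. if w \<in> words p (Suc n) \<and> w ! a = w ! Suc a then pvec p q (delw a w) else 0)
      = pvec p (q1 @ (l, c) # (l, c) # q2)"
  proof (rule fun_eq_on_words)
    show "a < Suc n" using assms by simp
    fix u v' :: "idx list" and z assume *: "length u = a" "u @ z # v' \<in> words p (Suc n)"
    obtain z' v where v: "v' = z' # v" using * assms(2) by (cases v') (auto simp: words_def)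
    have 1: "z = z' \<Longrightarrow> u @ z' # v \<in> words p n" using * v by (auto simp: words_def)
    have 2: "pat (q1 @ (l, c) # (l, c) # q2) (u @ z # z' # v) \<longleftrightarrow> z = z' \<and> pat q (u @ z' # v)"
      using * q' by (auto simp: pat_mid2 pat_mid)
    show "(if u @ z # v' \<in> words p (Suc n) \<and> (u @ z # v') ! a = (u @ z # v') ! Suc a
        then pvec p q (delw a (u @ z # v')) else 0) =
        pvec p (q1 @ (l, c) # (l, c) # q2) (u @ z # v')"
      using * q q' 1 2 v by (auto simp: pvec_def nth_append)
  qed (use q q' in \<open>simp_all add: pvec_def\<close>)
  then show "(\<lambda>w. if w \<in> words p (Suc n) \<and> w ! a = w ! Suc a then pvec p q (delw a w) else 0) \<in> F p (Suc n)"
    using q q' nc_dup[of q1 l c q2 c] by (simp add: F_base)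
qed (auto simp: fun_eq_iff)

text \<open>Evaluating on words with equal neighbours joins the two blocks. If the neighbours already share a block
but have different colours, no word matches, since no letter equals its bar. Otherwise the
labels of one block are renamed, and its colours are corrected by the difference of the
colours of the two neighbours.\<close>

lemma F_merge:
  assumes "f \<in> F p (Suc n)" "a < n"
  shows "(\<lambda>w. if w \<in> words p n then f (dupw a w) else 0) \<in> F p n"
proof (rule F_closed_under[OF assms(1)])
  fix q assume q: "nc q" "length q = Suc n"
  obtain q1 l c q2' where "q = q1 @ (l, c) # q2'" "length q1 = a"
    by (rule pattern_split[of a q]) (use assms(2) q(2) in auto)
  moreover then obtain l' c' q2 where "q2' = (l', c') # q2" using q assms(2) by (cases q2') auto
  ultimately have q': "q = q1 @ (l, c) # (l', c') # q2" "length q1 = a" by auto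
  define \<rho> where "\<rho> = (\<lambda>(l'', d). if l'' = l' then (l, d \<noteq> (c \<noteq> c')) else (l'', d))"
  have words2: "u @ z # v \<in> words p n \<Longrightarrow> u @ z # z # v \<in> words p (Suc n)" for u z v
    by (auto simp: words_def)
  show "(\<lambda>w. if w \<in> words p n then pvec p q (dupw a w) else 0) \<in> F p n"
  proof (cases "l = l' \<and> c \<noteq> c'")
    case True
    have "(\<lambda>w. if w \<in> words p n then pvec p q (dupw a w) else 0) = (\<lambda>_. 0)"
    proof (rule fun_eq_on_words[OF _ _ assms(2)])
      fix u v :: "idx list" and z assume *: "length u = a" "u @ z # v \<in> words p n"
      have "\<not> pat q (u @ z # z # v)"
        using True q' * by (auto simp: pat_mid2 tw_eq_iff)
      then show "(if u @ z # v \<in> words p n then pvec p q (dupw a (u @ z # v)) else 0) = 0"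
        using * by (simp add: pvec_def)
    qed auto
    then show ?thesis by (simp add: F_zero)
  next
    case False
    have "(\<lambda>w. if w \<in> words p n then pvec p q (dupw a w) else 0) = pvec p (map \<rho> (q1 @ (l, c) # q2))"
    proof (rule fun_eq_on_words[OF _ _ assms(2)])
      fix u v :: "idx list" and z assume *: "length u = a" "u @ z # v \<in> words p n"
      have lenu: "length u = length q1" using * q' by simp
      have \<rho>lc: "\<rho> (l, c) = (l, c)" using False by (auto simp: \<rho>_def)
      have "pat q (u @ z # z # v) \<longleftrightarrow> pat (map \<rho> (q1 @ (l, c) # q2)) (u @ z # v)" (is "?A \<longleftrightarrow> ?B")
      proof
        assume ?A
        then have "pat (q1 @ (l, c) # (l', c') # q2) (u @ z # z # v)" using q' by simp
        then obtain g where g: "u = map (\<lambda>(l, c). tw c (g l)) q1" "z = tw c (g l)" "z = tw c' (g l')"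
            "v = map (\<lambda>(l, c). tw c (g l)) q2"
          unfolding pat_mid2[OF lenu] by blast
        have "g l' = tw c' (tw c (g l))" using g(2,3) by (metis tw_self)
        then have "(\<lambda>(l, c). tw c (g l)) x = (\<lambda>(l, c). tw c (g l)) (\<rho> x)" for x
          by (auto simp: \<rho>_def tw_def split: prod.splits)
        then have "map (\<lambda>(l, c). tw c (g l)) (map \<rho> (q1 @ (l, c) # q2)) = u @ z # v"
          using g by simp
        then show ?B unfolding pat_def by metis
      next
        assume ?B
        then obtain g where g: "u = map (\<lambda>x. (\<lambda>(l, c). tw c (g l)) (\<rho> x)) q1" "z = tw c (g l)"
            "v = map (\<lambda>x. (\<lambda>(l, c). tw c (g l)) (\<rho> x)) q2"
          using * q' \<rho>lc by (auto simp: pat_mid comp_def)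
        define g' where "g' = g(l' := tw c' (tw c (g l)))"
        have eq: "(\<lambda>(l, c). tw c (g l)) (\<rho> x) = (\<lambda>(l, c). tw c (g' l)) x" for x
          by (auto simp: \<rho>_def g'_def tw_def split: prod.splits)
        have "g' l = g l" using False by (auto simp: g'_def tw_tw tw_def)
        then show ?A
          unfolding q' using * q' g eq
          by (simp add: pat_mid2, intro exI[of _ g']) (auto simp: g'_def)
      qed
      then show "(if u @ z # v \<in> words p n then pvec p q (dupw a (u @ z # v)) else 0) =
          pvec p (map \<rho> (q1 @ (l, c) # q2)) (u @ z # v)"
        using * q q' words2 by (auto simp: pvec_def)
    qed (use q q' in \<open>simp_all add: pvec_def\<close>)
    moreover have "nc (map \<rho> (q1 @ (l, c) # q2))"
    proof -
      have "nc (map \<rho> q)"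
        by (rule nc_merge[OF q(1), of a]) (use q' in \<open>auto simp: \<rho>_def nth_append_mid split: prod.splits\<close>)
      then show ?thesis using nc_delete[of "map \<rho> (q1 @ [(l, c)])" "\<rho> (l', c')" "map \<rho> q2"] q' by simp
    qed
    ultimately show ?thesis using q q' by (simp add: F_base)
  qed
qed (auto simp: fun_eq_iff)

text \<open>Summing over a letter removes its point. A singleton contributes the factor \<open>card (Jset p)\<close>; otherwise the other
points of the block determine the letter, and exactly one summand survives.\<close>

lemma F_cap:
  assumes "f \<in> F p (Suc n)" "a \<le> n"
  shows "(\<lambda>w. if w \<in> words p n then \<Sum>z\<in>Jset p. f (insw a z w) else 0) \<in> F p n"
proof (rule F_closed_under[OF assms(1)])
  fix q assume q: "nc q" "length q = Suc n"
  obtain q1 l c q2 where q': "q = q1 @ (l, c) # q2" "length q1 = a"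
    by (rule pattern_split[of a q]) (use assms(2) q(2) in auto)
  define k :: complex where "k = (if l \<in> fst ` set (q1 @ q2) then 1 else of_nat (card (Jset p)))"
  have "(if w \<in> words p n then \<Sum>z\<in>Jset p. pvec p q (insw a z w) else 0) = k * pvec p (q1 @ q2) w" for w
  proof (cases "w \<in> words p n")
    case True
    define u v where "u = take a w" and "v = drop a w"
    have w: "w = u @ v" "length u = a" using True assms by (auto simp: u_def v_def words_def)
    have ins: "u @ z # v \<in> words p (Suc n)" if "z \<in> Jset p" for z
      using True w that by (auto simp: words_def)
    have "(\<Sum>z\<in>Jset p. pvec p q (insw a z w)) = (\<Sum>z\<in>Jset p. if pat q (u @ z # v) then 1 else 0)"
      using ins q w by (intro sum.cong) (auto simp: pvec_def)
    also have "\<dots> = k * (if pat (q1 @ q2) w then 1 else 0)"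
    proof (cases "l \<in> fst ` set (q1 @ q2)")
      case False
      then show ?thesis using pat_fresh[of u q1 l q2 c _ v] w q' by (simp add: k_def)
    next
      case True
      then obtain c' where c': "(l, c') \<in> set (q1 @ q2)" by (auto simp del: set_append)
      show ?thesis
      proof (cases "pat (q1 @ q2) w")
        case False
        then have "\<not> pat q (u @ z # v)" for z using q' w by (auto simp: pat_mid pat_append)
        then show ?thesis using False by simp
      next
        case pt: True
        then obtain g where g: "w = map (\<lambda>(l, c). tw c (g l)) (q1 @ q2)" by (auto simp: pat_def)
        have gl: "g l \<in> Jset p"
        proof -
          have "tw c' (g l) \<in> set w" unfolding g using c' by (force simp: image_iff)
          then show ?thesis using \<open>w \<in> words p n\<close> by (auto simp: words_def)
        qed
        have "pat q (u @ z # v) \<longleftrightarrow> z = tw c (g l)" for z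
        proof
          assume "pat q (u @ z # v)"
          then obtain g' where g': "w = map (\<lambda>(l, c). tw c (g' l)) (q1 @ q2)" "z = tw c (g' l)"
            using q' w by (auto simp: pat_mid)
          have "tw c' (g' l) = tw c' (g l)" using g g'(1) c' by (metis (no_types, lifting) case_prod_conv map_eq_conv)
          then show "z = tw c (g l)" using g' by simp
        next
          have "u = map (\<lambda>(l, c). tw c (g l)) q1" "v = map (\<lambda>(l, c). tw c (g l)) q2"
            using g w q' by (auto simp: append_eq_append_conv)
          then show "z = tw c (g l) \<Longrightarrow> pat q (u @ z # v)"
            using q' w by (auto simp: pat_mid)
        qed
        then show ?thesis using pt True gl by (simp add: k_def)
      qed
    qed
    finally show ?thesis using True q q' by (simp add: pvec_def)
  qed (use q q' in \<open>simp add: pvec_def\<close>)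
  moreover have "(\<lambda>w. k * pvec p (q1 @ q2) w) \<in> F p n"
    using q q' nc_delete by (intro F_scale F_base) auto
  ultimately show "(\<lambda>w. if w \<in> words p n then \<Sum>z\<in>Jset p. pvec p q (insw a z w) else 0) \<in> F p n"
    by simp
qed (auto simp: fun_eq_iff sum.distrib sum_distrib_left)

lemma F_rev:
  assumes "f \<in> F p n" shows "(\<lambda>w. f (rev w)) \<in> F p n"
proof (rule F_closed_under[OF assms])
  fix q assume q: "nc q" "length q = n"
  have "(\<lambda>w. pvec p q (rev w)) = pvec p (rev q)"
    by (auto simp: fun_eq_iff pvec_def pat_def rev_map[symmetric] rev_swap)
  then show "(\<lambda>w. pvec p q (rev w)) \<in> F p n" using q nc_rev by (simp add: F_base)
qed auto

lemma F_cnj: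
  assumes "f \<in> F p n" shows "(\<lambda>w. cnj (f w)) \<in> F p n"
proof (rule F_closed_under[OF assms, where \<sigma> = cnj])
  fix q assume "nc q" "length q = n"
  moreover have "(\<lambda>w. cnj (pvec p q w)) = pvec p q" by (auto simp: pvec_def)
  ultimately show "(\<lambda>w. cnj (pvec p q w)) \<in> F p n" using F_base by simp
qed auto

lemma F_tensor:
  assumes "f \<in> F p n" "g \<in> F p m"
  shows "(\<lambda>w. f (take n w) * g (drop n w)) \<in> F p (n + m)"
proof (rule F_closed_under[OF assms(1)])
  fix q assume q: "nc q" "length q = n"
  show "(\<lambda>w. pvec p q (take n w) * g (drop n w)) \<in> F p (n + m)"
  proof (rule F_closed_under[OF assms(2)])
    fix q' assume q': "nc q'" "length q' = m"
    define r r' where "r = map (\<lambda>(l, c). (2 * l, c)) q" and "r' = map (\<lambda>(l, c). (2 * l + 1, c)) q'"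
    have "nc r" unfolding r_def
      by (rule nc_relabel[OF q(1), of _ "\<lambda>l. 2 * l"]) (auto simp: inj_def)
    moreover have "nc r'" unfolding r'_def
      by (rule nc_relabel[OF q'(1), of _ "\<lambda>l. 2 * l + 1"]) (auto simp: inj_def)
    moreover have "fst ` set r \<inter> fst ` set r' = {}"
      by (auto simp: r_def r'_def) presburger
    ultimately have nc: "nc (r @ r')" by (rule nc_append_disjoint)
    have "(\<lambda>w. pvec p q (take n w) * pvec p q' (drop n w)) = pvec p (r @ r')"
    proof
      fix w
      have len: "length r = n" "length r' = m" using q q' by (auto simp: r_def r'_def)
      have wd: "w \<in> words p (n + m) \<longleftrightarrow> take n w \<in> words p n \<and> drop n w \<in> words p m"
      proof -
        have "set w = set (take n w) \<union> set (drop n w)" by (metis append_take_drop_id set_append)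
        then show ?thesis by (auto simp: words_def)
      qed
      show "pvec p q (take n w) * pvec p q' (drop n w) = pvec p (r @ r') w"
      proof (cases "w \<in> words p (n + m)")
        case True
        then have tl: "length (take n w) = length r" using len by (simp add: words_def)
        have "pat (r @ r') (take n w @ drop n w) \<longleftrightarrow> pat q (take n w) \<and> pat q' (drop n w)"
          unfolding pat_append[OF tl]
        proof
          assume "pat q (take n w) \<and> pat q' (drop n w)"
          then obtain g g' where g: "take n w = map (\<lambda>(l, c). tw c (g l)) q"
              "drop n w = map (\<lambda>(l, c). tw c (g' l)) q'"
            by (auto simp: pat_def)
          show "\<exists>g. take n w = map (\<lambda>(l, c). tw c (g l)) r \<and> drop n w = map (\<lambda>(l, c). tw c (g l)) r'"
            unfolding g r_def r'_def
            by (intro exI[of _ "\<lambda>l. if even l then g (l div 2) else g' (l div 2)"]) auto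
        next
          assume "\<exists>g. take n w = map (\<lambda>(l, c). tw c (g l)) r \<and> drop n w = map (\<lambda>(l, c). tw c (g l)) r'"
          then obtain g where g: "take n w = map (\<lambda>(l, c). tw c (g l)) r"
              "drop n w = map (\<lambda>(l, c). tw c (g l)) r'" by blast
          have "take n w = map (\<lambda>(l, c). tw c (g (2 * l))) q"
            unfolding g(1) r_def by auto
          moreover have "drop n w = map (\<lambda>(l, c). tw c (g (2 * l + 1))) q'"
            unfolding g(2) r'_def by auto
          ultimately show "pat q (take n w) \<and> pat q' (drop n w)"
            unfolding pat_def by (intro conjI exI)
        qed
        then show ?thesis using True wd len q q' by (simp add: pvec_def)
      qed (use wd len q q' in \<open>auto simp: pvec_def\<close>)
    qed
    then show "(\<lambda>w. pvec p q (take n w) * pvec p q' (drop n w)) \<in> F p (n + m)"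
      using nc q q' by (simp add: F_base r_def r'_def)
  qed (auto simp: fun_eq_iff algebra_simps)
qed (auto simp: fun_eq_iff algebra_simps)

text \<open>Contracting the reversed word \<open>rev x\<close> against \<open>x\<close> in the middle is a sequence of mergings and caps, from the
inside outwards.\<close>

lemma F_contract:
  assumes "f \<in> F p (r + m + m + s)"
  shows "(\<lambda>w. if w \<in> words p (r + s) then
      \<Sum>x\<in>words p m. f (take r w @ x @ rev x @ drop r w) else 0) \<in> F p (r + s)"
  using assms
proof (induction m arbitrary: f)
  case 0
  have "(\<lambda>w. if w \<in> words p (r + s) then \<Sum>x\<in>words p 0. f (take r w @ x @ rev x @ drop r w) else 0) = f"
    using F_support[OF 0] by (auto simp: fun_eq_iff)
  then show ?case using 0 by simp
next
  case (Suc m)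
  define a where "a = r + m"
  define n where "n = r + m + m + s"
  define f1 where "f1 = (\<lambda>w. if w \<in> words p (Suc n) then f (dupw a w) else 0)"
  define f2 where "f2 = (\<lambda>w. if w \<in> words p n then \<Sum>z\<in>Jset p. f1 (insw a z w) else 0)"
  have "f \<in> F p (Suc (Suc n))" using Suc.prems by (simp add: n_def add_ac)
  then have "f1 \<in> F p (Suc n)" unfolding f1_def by (rule F_merge) (simp add: a_def n_def)
  then have "f2 \<in> F p n" unfolding f2_def by (rule F_cap) (simp add: a_def n_def)
  note IH = Suc.IH[OF this[unfolded n_def]]
  have f2: "f2 (u @ x @ rev x @ v) = (\<Sum>z\<in>Jset p. f (u @ (x @ [z]) @ rev (x @ [z]) @ v))"
    if "u \<in> words p r" "v \<in> words p s" "x \<in> words p m" for u v x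
  proof -
    have len: "length (u @ x) = a" using that by (simp add: a_def words_def)
    have mem: "u @ x @ rev x @ v \<in> words p n" "z \<in> Jset p \<Longrightarrow> u @ x @ z # rev x @ v \<in> words p (Suc n)" for z
      using that by (auto simp: n_def words_def)
    have "insw a z (u @ x @ rev x @ v) = u @ x @ z # rev x @ v" for z
      using edit_simps(3)[OF len, of z "rev x @ v"] by simp
    moreover have "dupw a (u @ x @ z # rev x @ v) = u @ x @ z # z # rev x @ v" for z
      using edit_simps(1)[OF len, of z "rev x @ v"] by simp
    ultimately show ?thesis using mem by (simp add: f2_def f1_def)
  qed
  have "(\<lambda>w. if w \<in> words p (r + s) then \<Sum>x\<in>words p m. f2 (take r w @ x @ rev x @ drop r w) else 0) =
      (\<lambda>w. if w \<in> words p (r + s) then \<Sum>x\<in>words p (Suc m). f (take r w @ x @ rev x @ drop r w) else 0)"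
  proof
    fix w
    have "take r w \<in> words p r" "drop r w \<in> words p s" if "w \<in> words p (r + s)"
      using that by (auto simp: words_def dest: in_set_takeD in_set_dropD)
    then show "(if w \<in> words p (r + s) then \<Sum>x\<in>words p m. f2 (take r w @ x @ rev x @ drop r w) else 0) =
        (if w \<in> words p (r + s) then \<Sum>x\<in>words p (Suc m). f (take r w @ x @ rev x @ drop r w) else 0)"
      using f2 by (auto simp: sum_words_snoc intro!: sum.cong)
  qed
  then show ?case using IH by simp
qed

text \<open>Read as matrices with reversed row words, the spaces are closed under matrix multiplication.\<close>

lemma F_compose:
  assumes "f \<in> F p (r + m)" "g \<in> F p (m + s)"
  shows "(\<lambda>w. if w \<in> words p (r + s) then
      \<Sum>x\<in>words p m. f (take r w @ x) * g (rev x @ drop r w) else 0) \<in> F p (r + s)"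
proof -
  have "(\<lambda>w. f (take (r + m) w) * g (drop (r + m) w)) \<in> F p (r + m + m + s)"
    using F_tensor[OF assms] by (simp add: add_ac)
  note F_contract[OF this]
  moreover have "take (r + m) (take r w @ x @ rev x @ drop r w) = take r w @ x"
    "drop (r + m) (take r w @ x @ rev x @ drop r w) = rev x @ drop r w"
    if "w \<in> words p (r + s)" "x \<in> words p m" for w x
    using that by (auto simp: words_def)
  ultimately show ?thesis by (simp cong: if_cong sum.cong)
qed

section \<open>The C*-algebra of a positive functional\<close>
text \<open>A complex *-algebra is given by a ring with involution \<open>st\<close> and a homomorphism \<open>sc\<close> from the scalars into its
centre; \<open>h\<close> is a positive linear functional on it.\<close>

locale positive_functional =
  fixes st :: "'b::ring_1 \<Rightarrow> 'b" and sc :: "complex \<Rightarrow> 'b" and h :: "'b \<Rightarrow> complex"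
  assumes sc_add: "sc (c + c') = sc c + sc c'" and sc_mult: "sc (c * c') = sc c * sc c'"
    and sc_one: "sc 1 = 1" and sc_comm: "sc c * x = x * sc c"
    and st_add: "st (x + y) = st x + st y" and st_mult: "st (x * y) = st y * st x"
    and st_st: "st (st x) = x" and st_sc: "st (sc c) = sc (cnj c)"
    and h_add: "h (x + y) = h x + h y" and h_sc: "h (sc c * x) = c * h x"
    and h_pos: "\<exists>r\<ge>0. h (st x * x) = complex_of_real r"
begin

lemma sc_0: "sc 0 = 0" using sc_add[of 0 0] by simp
lemma sc_minus: "sc (- c) = - sc c" using sc_add[of c "- c"] by (simp add: sc_0 eq_neg_iff_add_eq_0 add.commute)
lemma st_0: "st 0 = 0" using st_add[of 0 0] by simp
lemma st_minus: "st (- x) = - st x"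
  using st_add[of x "- x"] by (simp add: st_0 eq_neg_iff_add_eq_0 add.commute)
lemma st_diff: "st (x - y) = st x - st y"
  using st_add[of x "- y"] by (simp add: st_minus)
lemma h_0: "h 0 = 0" using h_add[of 0 0] by simp
lemma h_minus: "h (- x) = - h x"
  using h_add[of x "- x"] by (simp add: h_0 eq_neg_iff_add_eq_0 add.commute)
lemma h_diff: "h (x - y) = h x - h y"
  using h_add[of x "- y"] by (simp add: h_minus)
lemma h_sum: "h (sum f S) = (\<Sum>i\<in>S. h (f i))"
  by (induction S rule: infinite_finite_induct) (auto simp: h_0 h_add)

definition form where "form x y = h (st x * y)"
definition nrm where "nrm x = sqrt (Re (form x x))"

lemma form_add: "form x (y + z) = form x y + form x z" "form (x + y) z = form x z + form y z"
  by (simp_all add: form_def distrib_left distrib_right st_add h_add)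
lemma form_sc: "form x (sc c * y) = c * form x y" "form (sc c * x) y = cnj c * form x y"
proof -
  have "st x * (sc c * y) = sc c * (st x * y)" by (metis mult.assoc sc_comm)
  then show "form x (sc c * y) = c * form x y" by (simp add: form_def h_sc)
  have "st (sc c * x) * y = sc (cnj c) * (st x * y)" by (metis mult.assoc sc_comm st_mult st_sc)
  then show "form (sc c * x) y = cnj c * form x y" by (simp add: form_def h_sc)
qed

lemma form_self: "form x x = complex_of_real ((nrm x)\<^sup>2)" and nrm_nonneg: "0 \<le> nrm x"
proof -
  obtain r where r: "r \<ge> 0" "h (st x * x) = complex_of_real r" using h_pos by blast
  then show "form x x = complex_of_real ((nrm x)\<^sup>2)" "0 \<le> nrm x"
    by (simp_all add: form_def nrm_def)
qed

lemma form_Im: "Im (form x x) = 0" by (simp add: form_self)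

lemma cnj_form: "cnj (form x y) = form y x"
proof -
  have "Im (form x y + form y x) = 0"
    using form_Im[of "x + y"] form_Im[of x] form_Im[of y] by (simp add: form_add)
  moreover have "Im (\<i> * form x y - \<i> * form y x) = 0"
    using form_Im[of "x + sc \<i> * y"] form_Im[of x] form_Im[of y]
    by (simp add: form_add form_sc)
  ultimately show ?thesis by (simp add: complex_eq_iff)
qed

lemma form_adjoint: "form (a * x) y = form x (st a * y)"
  by (simp add: form_def st_mult mult.assoc)

lemma nrm_power2: "(nrm x)\<^sup>2 = Re (form x x)"
  by (simp add: form_self)

lemma nrm_sc: "nrm (sc c * x) = cmod c * nrm x"
proof -
  have "form (sc c * x) (sc c * x) = of_real ((cmod c)\<^sup>2) * form x x"
    by (simp only: form_sc complex_norm_square mult_ac)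
  then have "(nrm (sc c * x))\<^sup>2 = (cmod c * nrm x)\<^sup>2"
    unfolding nrm_power2 by (simp add: power_mult_distrib nrm_power2)
  then show ?thesis by (simp add: nrm_nonneg power2_eq_iff_nonneg)
qed

text \<open>The form is only semidefinite, so the discriminant argument is run with the real parameter \<open>t\<close> and the vector
\<open>x - t cnj (form x y) y\<close>, which also covers the case of \<open>y\<close> having norm 0.\<close>

lemma Cauchy_Schwarz: "cmod (form x y) \<le> nrm x * nrm y"
proof -
  define b where "b = form x y"
  have key: "0 \<le> (nrm x)\<^sup>2 - 2 * t * (cmod b)\<^sup>2 + t\<^sup>2 * (cmod b)\<^sup>2 * (nrm y)\<^sup>2" for t
  proof -
    define c where "c = - of_real t * cnj b"
    have yx: "form y x = cnj b" by (simp add: b_def cnj_form)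
    have "form (x + sc c * y) (x + sc c * y)
        = form x x + c * b + cnj c * cnj b + cnj c * c * form y y"
      by (simp add: form_add form_sc b_def[symmetric] yx algebra_simps)
    moreover have "c * b = of_real (- (t * (cmod b)\<^sup>2))"
      unfolding c_def using complex_norm_square[of b] by (simp add: mult_ac)
    moreover have "cnj c * cnj b = of_real (- (t * (cmod b)\<^sup>2))"
      unfolding c_def using complex_norm_square[of b] by (simp add: mult_ac)
    moreover have "cnj c * c = of_real (t\<^sup>2 * (cmod b)\<^sup>2)"
      unfolding c_def using complex_norm_square[of b] by (simp add: power2_eq_square mult_ac)
    ultimately have "Re (form (x + sc c * y) (x + sc c * y))
        = (nrm x)\<^sup>2 - 2 * t * (cmod b)\<^sup>2 + t\<^sup>2 * (cmod b)\<^sup>2 * (nrm y)\<^sup>2"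
      by (simp add: form_self flip: of_real_power of_real_mult)
    moreover have "0 \<le> Re (form (x + sc c * y) (x + sc c * y))"
      by (simp add: form_self)
    ultimately show ?thesis by simp
  qed
  show ?thesis
  proof (cases "nrm y = 0")
    case True
    have "cmod b = 0"
    proof (rule ccontr)
      assume b: "cmod b \<noteq> 0"
      have "2 * (((nrm x)\<^sup>2 + 1) / (2 * (cmod b)\<^sup>2)) * (cmod b)\<^sup>2 = (nrm x)\<^sup>2 + 1"
        using b by simp
      then show False using key[of "((nrm x)\<^sup>2 + 1) / (2 * (cmod b)\<^sup>2)"] True by simp
    qed
    then show ?thesis by (simp add: True b_def)
  next
    case False
    then have y: "nrm y > 0" using nrm_nonneg[of y] by simp
    have "0 \<le> (nrm x)\<^sup>2 - (cmod b)\<^sup>2 / (nrm y)\<^sup>2"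
      using key[of "1 / (nrm y)\<^sup>2"] y by (simp add: power2_eq_square field_simps)
    then have "(cmod b)\<^sup>2 \<le> (nrm x * nrm y)\<^sup>2"
      using y by (simp add: field_simps power_mult_distrib)
    then show ?thesis using b_def nrm_nonneg by (simp add: power2_le_iff_abs_le)
  qed
qed

lemma nrm_triangle: "nrm (x + y) \<le> nrm x + nrm y"
proof -
  have "(nrm (x + y))\<^sup>2 = (nrm x)\<^sup>2 + (nrm y)\<^sup>2 + 2 * Re (form x y)"
    unfolding nrm_power2 form_add using cnj_form[of x y] by (simp add: complex_eq_iff)
  also have "Re (form x y) \<le> nrm x * nrm y"
    using Cauchy_Schwarz complex_Re_le_cmod order_trans by blast
  finally have "(nrm (x + y))\<^sup>2 \<le> (nrm x + nrm y)\<^sup>2" by (simp add: power2_sum)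
  then show ?thesis using nrm_nonneg by (meson add_nonneg_nonneg power2_le_imp_le)
qed

end

text \<open>If left multiplications are bounded, they form an algebra with the C*-identity for the operator norm. Its
completion is realised by Cauchy sequences, and each Cauchy sequence is encoded by the limits of its
matrix coefficients against a countable spanning family \<open>d\<close>; this makes the carrier a set of functions
\<open>nat \<Rightarrow> nat \<Rightarrow> complex\<close>.\<close>

locale state_on_star_algebra = positive_functional st sc h
  for st :: "'b::ring_1 \<Rightarrow> 'b" and sc :: "complex \<Rightarrow> 'b" and h :: "'b \<Rightarrow> complex" +
  fixes d :: "nat \<Rightarrow> 'b"
  assumes bounded: "\<exists>K\<ge>0. \<forall>x. nrm (a * x) \<le> K * nrm x"
    and d_spans: "\<exists>S c. finite S \<and> x = (\<Sum>n\<in>S. sc (c n) * d n)"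
begin

definition opN where "opN a = Inf {K. 0 \<le> K \<and> (\<forall>x. nrm (a * x) \<le> K * nrm x)}"

lemma opN_nonneg: "0 \<le> opN a"
  unfolding opN_def using bounded[of a] by (intro cInf_greatest) auto

lemma opN_least: "0 \<le> K \<Longrightarrow> (\<And>x. nrm (a * x) \<le> K * nrm x) \<Longrightarrow> opN a \<le> K"
  unfolding opN_def by (intro cInf_lower bdd_belowI[of _ 0]) auto

lemma nrm_opN: "nrm (a * x) \<le> opN a * nrm x"
proof (cases "nrm x = 0")
  case True
  then show ?thesis using bounded[of a] by (metis mult_zero_right)
next
  case False
  then have x: "nrm x > 0" using nrm_nonneg[of x] by simp
  have "nrm (a * x) / nrm x \<le> opN a"
    unfolding opN_def using bounded[of a] x
    by (intro cInf_greatest) (auto simp: divide_le_eq)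
  then show ?thesis using x by (simp add: divide_le_eq)
qed

lemma opN_add: "opN (a + b) \<le> opN a + opN b"
proof (rule opN_least)
  fix x
  have "nrm ((a + b) * x) \<le> nrm (a * x) + nrm (b * x)"
    using nrm_triangle by (simp add: distrib_right)
  also have "\<dots> \<le> (opN a + opN b) * nrm x"
    using nrm_opN[of a x] nrm_opN[of b x] by (simp add: distrib_right)
  finally show "nrm ((a + b) * x) \<le> (opN a + opN b) * nrm x" .
qed (simp add: opN_nonneg)

lemma opN_mult: "opN (a * b) \<le> opN a * opN b"
proof (rule opN_least)
  fix x
  have "nrm (a * b * x) \<le> opN a * nrm (b * x)"
    using nrm_opN[of a "b * x"] by (simp add: mult.assoc)
  also have "\<dots> \<le> opN a * (opN b * nrm x)"
    by (intro mult_left_mono nrm_opN opN_nonneg)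
  finally show "nrm (a * b * x) \<le> opN a * opN b * nrm x" by (simp add: mult.assoc)
qed (simp add: opN_nonneg)

lemma opN_sc_le: "opN (sc c * a) \<le> cmod c * opN a"
proof (rule opN_least)
  fix x
  have "nrm (sc c * a * x) = cmod c * nrm (a * x)" by (simp add: nrm_sc mult.assoc)
  then show "nrm (sc c * a * x) \<le> cmod c * opN a * nrm x"
    using nrm_opN[of a x] by (simp add: mult.assoc mult_left_mono)
qed (simp add: opN_nonneg)

lemma opN_sc: "opN (sc c * a) = cmod c * opN a"
proof (cases "c = 0")
  case True
  then show ?thesis using opN_sc_le[of 0 a] opN_nonneg[of "sc 0 * a"] by simp
next
  case False
  have "a = sc (1 / c) * (sc c * a)" using False by (simp flip: mult.assoc sc_mult add: sc_one)
  then have "opN a \<le> cmod (1 / c) * opN (sc c * a)" using opN_sc_le by metis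
  then have "cmod c * opN a \<le> opN (sc c * a)"
    using False by (simp add: norm_divide field_simps)
  then show ?thesis using opN_sc_le[of c a] by simp
qed

lemma opN_0: "opN 0 = 0" using opN_sc[of 0 0] by (simp add: sc_0)
lemma opN_minus: "opN (- a) = opN a" using opN_sc[of "-1" a] by (simp add: sc_minus sc_one)
lemma opN_diff_commute: "opN (a - b) = opN (b - a)" using opN_minus[of "a - b"] by simp
lemma opN_triangle: "opN (a - c) \<le> opN (a - b) + opN (b - c)"
  using opN_add[of "a - b" "b - c"] by simp
lemma opN_diff_le: "\<bar>opN a - opN b\<bar> \<le> opN (a - b)"
  using opN_add[of "a - b" b] opN_add[of "b - a" a] opN_diff_commute[of a b] by simp

lemma opN_st_le: "opN (st a) \<le> opN a"
proof (rule opN_least)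
  fix x
  have "(nrm (st a * x))\<^sup>2 = cmod (form x (a * (st a * x)))"
    using form_self[of "st a * x"] by (simp add: form_adjoint st_st norm_power)
  also have "\<dots> \<le> nrm x * nrm (a * (st a * x))" by (rule Cauchy_Schwarz)
  also have "\<dots> \<le> nrm x * (opN a * nrm (st a * x))"
    by (intro mult_left_mono nrm_opN nrm_nonneg)
  finally have "nrm (st a * x) * nrm (st a * x) \<le> (opN a * nrm x) * nrm (st a * x)"
    by (simp add: power2_eq_square mult_ac)
  then show "nrm (st a * x) \<le> opN a * nrm x"
    using nrm_nonneg opN_nonneg
    by (metis linorder_not_less mult_nonneg_nonneg mult_right_le_imp_le order_le_less)
qed (simp add: opN_nonneg)

lemma opN_st: "opN (st a) = opN a"
  using opN_st_le[of a] opN_st_le[of "st a"] by (simp add: st_st)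

lemma opN_cstar: "opN (st a * a) = (opN a)\<^sup>2"
proof (rule antisym)
  show "opN (st a * a) \<le> (opN a)\<^sup>2"
    using opN_mult[of "st a" a] by (simp add: opN_st power2_eq_square)
  have "opN a \<le> sqrt (opN (st a * a))"
  proof (rule opN_least)
    fix x
    have "(nrm (a * x))\<^sup>2 = cmod (form x (st a * a * x))"
      using form_self[of "a * x"] by (simp add: form_adjoint norm_power mult.assoc)
    also have "\<dots> \<le> nrm x * nrm (st a * a * x)" by (rule Cauchy_Schwarz)
    also have "\<dots> \<le> nrm x * (opN (st a * a) * nrm x)"
      by (intro mult_left_mono nrm_opN nrm_nonneg)
    finally have "(nrm (a * x))\<^sup>2 \<le> (sqrt (opN (st a * a)) * nrm x)\<^sup>2"
      by (simp add: power_mult_distrib opN_nonneg) (simp add: power2_eq_square mult_ac)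
    then show "nrm (a * x) \<le> sqrt (opN (st a * a)) * nrm x"
      by (rule power2_le_imp_le) (simp add: nrm_nonneg opN_nonneg)
  qed (simp add: opN_nonneg)
  then show "(opN a)\<^sup>2 \<le> opN (st a * a)"
    using power_mono[OF _ opN_nonneg[of a], of "sqrt (opN (st a * a))" 2] opN_nonneg[of "st a * a"]
    by simp
qed

lemma h_opN: "cmod (h (st x * a * y)) \<le> nrm x * opN a * nrm y"
proof -
  have "cmod (form x (a * y)) \<le> nrm x * nrm (a * y)" by (rule Cauchy_Schwarz)
  also have "\<dots> \<le> nrm x * (opN a * nrm y)"
    by (intro mult_left_mono nrm_opN nrm_nonneg)
  finally show ?thesis by (simp add: form_def mult.assoc)
qed

lemma opN_eq_0_iff: "opN a = 0 \<longleftrightarrow> (\<forall>x y. h (x * a * y) = 0)"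
proof
  assume "opN a = 0"
  then have "cmod (h (st (st x) * a * y)) \<le> 0" for x y using h_opN[of "st x" a y] by simp
  then show "\<forall>x y. h (x * a * y) = 0" by (simp add: st_st)
next
  assume "\<forall>x y. h (x * a * y) = 0"
  then have "h (st x * st a * a * x) = 0" for x by blast
  then have "form (a * x) (a * x) = 0" for x by (simp add: form_def st_mult mult.assoc)
  then have "nrm (a * x) = 0" for x by (simp add: nrm_def)
  then show "opN a = 0" using opN_least[of 0 a] opN_nonneg[of a] by simp
qed

definition Cs :: "(nat \<Rightarrow> 'b) set" where "Cs = {s. \<forall>e>0. \<exists>K. \<forall>m\<ge>K. \<forall>n\<ge>K. opN (s m - s n) < e}"

lemma CsD: "s \<in> Cs \<Longrightarrow> e > 0 \<Longrightarrow> \<exists>K. \<forall>m\<ge>K. \<forall>n\<ge>K. opN (s m - s n) < e"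
  by (simp add: Cs_def)

lemma Cs_const: "(\<lambda>_. a) \<in> Cs"
  by (simp add: Cs_def opN_0)

lemma Cs_add:
  assumes "s \<in> Cs" "t \<in> Cs"
  shows "(\<lambda>k. s k + t k) \<in> Cs"
  unfolding Cs_def
proof (intro CollectI allI impI)
  fix e :: real assume e: "e > 0"
  obtain K1 where K1: "\<And>m n. m \<ge> K1 \<Longrightarrow> n \<ge> K1 \<Longrightarrow> opN (s m - s n) < e / 2"
    using CsD[OF assms(1), of "e / 2"] e by auto
  obtain K2 where K2: "\<And>m n. m \<ge> K2 \<Longrightarrow> n \<ge> K2 \<Longrightarrow> opN (t m - t n) < e / 2"
    using CsD[OF assms(2), of "e / 2"] e by auto
  have "opN (s m + t m - (s n + t n)) < e" if "m \<ge> max K1 K2" "n \<ge> max K1 K2" for m n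
  proof -
    have "opN (s m + t m - (s n + t n)) \<le> opN (s m - s n) + opN (t m - t n)"
      using opN_add[of "s m - s n" "t m - t n"] by (simp add: algebra_simps)
    also have "\<dots> < e / 2 + e / 2" using that by (intro add_strict_mono K1 K2) auto
    finally show ?thesis by simp
  qed
  then show "\<exists>K. \<forall>m\<ge>K. \<forall>n\<ge>K. opN (s m + t m - (s n + t n)) < e" by blast
qed

lemma Cs_norm_convergent:
  assumes "s \<in> Cs"
  shows "convergent (\<lambda>k. opN (s k))"
proof (rule Cauchy_convergent, rule CauchyI)
  fix e :: real assume "e > 0"
  then obtain K where "\<forall>m\<ge>K. \<forall>n\<ge>K. opN (s m - s n) < e" using CsD[OF assms] by blast
  then show "\<exists>M. \<forall>m\<ge>M. \<forall>n\<ge>M. norm (opN (s m) - opN (s n)) < e"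
    using opN_diff_le by (metis order_le_less_trans real_norm_def)
qed

lemma Cs_bounded:
  assumes "s \<in> Cs"
  shows "\<exists>C>0. \<forall>k. opN (s k) \<le> C"
proof -
  have "Bseq (\<lambda>k. opN (s k))" using Cs_norm_convergent[OF assms] by (rule convergent_imp_Bseq)
  then obtain C where "C > 0" "\<And>k. norm (opN (s k)) \<le> C" by (auto elim: BseqE)
  then show ?thesis using opN_nonneg by (intro exI[of _ C]) auto
qed

lemma Cs_mult:
  assumes "s \<in> Cs" "t \<in> Cs"
  shows "(\<lambda>k. s k * t k) \<in> Cs"
  unfolding Cs_def
proof (intro CollectI allI impI)
  fix e :: real assume e: "e > 0"
  obtain C where C: "C > 0" "\<And>k. opN (s k) \<le> C" using Cs_bounded[OF assms(1)] by blast
  obtain D where D: "D > 0" "\<And>k. opN (t k) \<le> D" using Cs_bounded[OF assms(2)] by blast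
  obtain K1 where K1: "\<And>m n. m \<ge> K1 \<Longrightarrow> n \<ge> K1 \<Longrightarrow> opN (s m - s n) < e / (2 * D)"
    using CsD[OF assms(1), of "e / (2 * D)"] e D by auto
  obtain K2 where K2: "\<And>m n. m \<ge> K2 \<Longrightarrow> n \<ge> K2 \<Longrightarrow> opN (t m - t n) < e / (2 * C)"
    using CsD[OF assms(2), of "e / (2 * C)"] e C by auto
  have "opN (s m * t m - s n * t n) < e" if mn: "m \<ge> max K1 K2" "n \<ge> max K1 K2" for m n
  proof -
    have "opN (s m * t m - s n * t n) = opN (s m * (t m - t n) + (s m - s n) * t n)"
      by (simp add: algebra_simps)
    also have "\<dots> \<le> opN (s m) * opN (t m - t n) + opN (s m - s n) * opN (t n)"
      using opN_add[of "s m * (t m - t n)" "(s m - s n) * t n"] opN_mult[of "s m" "t m - t n"]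
        opN_mult[of "s m - s n" "t n"] by linarith
    also have "\<dots> \<le> C * opN (t m - t n) + opN (s m - s n) * D"
      by (intro add_mono mult_mono C D) (use C D opN_nonneg in \<open>auto intro: less_imp_le\<close>)
    also have "\<dots> < C * (e / (2 * C)) + e / (2 * D) * D"
      by (intro add_strict_mono mult_strict_left_mono mult_strict_right_mono C(1) D(1) K1 K2)
        (use mn in auto)
    also have "\<dots> = e" using C D by simp
    finally show ?thesis .
  qed
  then show "\<exists>K. \<forall>m\<ge>K. \<forall>n\<ge>K. opN (s m * t m - s n * t n) < e" by blast
qed

lemma Cs_st: "s \<in> Cs \<Longrightarrow> (\<lambda>k. st (s k)) \<in> Cs"
  by (simp add: Cs_def opN_st flip: st_diff)
lemma Cs_sc: "s \<in> Cs \<Longrightarrow> (\<lambda>k. sc c * s k) \<in> Cs"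
  by (rule Cs_mult[OF Cs_const])
lemma Cs_minus: "s \<in> Cs \<Longrightarrow> (\<lambda>k. - s k) \<in> Cs"
  using Cs_sc[of s "-1"] by (simp add: sc_minus sc_one)
lemma Cs_diff: "s \<in> Cs \<Longrightarrow> t \<in> Cs \<Longrightarrow> (\<lambda>k. s k - t k) \<in> Cs"
  using Cs_add[OF _ Cs_minus, of s t] by simp

definition null :: "(nat \<Rightarrow> 'b) \<Rightarrow> bool" where "null s \<longleftrightarrow> (\<lambda>k. opN (s k)) \<longlonglongrightarrow> 0"

lemma null_add:
  assumes "null s" "null t" shows "null (\<lambda>k. s k + t k)"
  unfolding null_def
proof (rule tendsto_sandwich[OF always_eventually always_eventually tendsto_const])
  show "(\<lambda>k. opN (s k) + opN (t k)) \<longlonglongrightarrow> 0"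
    using tendsto_add[OF assms[unfolded null_def]] by simp
qed (simp_all add: opN_nonneg opN_add)

lemma null_mult:
  assumes "null s" "t \<in> Cs" shows "null (\<lambda>k. s k * t k)" "null (\<lambda>k. t k * s k)"
proof -
  obtain C where C: "C > 0" "\<And>k. opN (t k) \<le> C" using Cs_bounded[OF assms(2)] by blast
  have lim: "(\<lambda>k. C * opN (s k)) \<longlonglongrightarrow> 0"
    using tendsto_mult_left[OF assms(1)[unfolded null_def], of C] by simp
  have bnd: "opN (s k * t k) \<le> C * opN (s k)" "opN (t k * s k) \<le> C * opN (s k)" for k
    using opN_mult[of "s k" "t k"] opN_mult[of "t k" "s k"]
      mult_right_mono[OF C(2)[of k] opN_nonneg[of "s k"]] by (simp_all add: mult.commute)
  show "null (\<lambda>k. s k * t k)" "null (\<lambda>k. t k * s k)"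
    unfolding null_def
    by (rule tendsto_sandwich[OF always_eventually always_eventually tendsto_const lim];
        simp add: opN_nonneg bnd)+
qed

definition "L s = (\<lambda>m n. lim (\<lambda>k. h (st (d m) * s k * d n)))"

lemma coeff_convergent:
  assumes "s \<in> Cs"
  shows "convergent (\<lambda>k. h (st x * s k * y))"
proof (rule Cauchy_convergent, rule CauchyI)
  fix e :: real assume e: "e > 0"
  define C where "C = nrm x * nrm y + 1"
  have C: "C > 0" unfolding C_def using nrm_nonneg[of x] nrm_nonneg[of y] by (simp add: add_nonneg_pos)
  obtain K where K: "\<And>m n. m \<ge> K \<Longrightarrow> n \<ge> K \<Longrightarrow> opN (s m - s n) < e / C"
    using CsD[OF assms, of "e / C"] e C by auto
  have "norm (h (st x * s m * y) - h (st x * s n * y)) < e" if mn: "m \<ge> K" "n \<ge> K" for m n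
  proof -
    have "norm (h (st x * s m * y) - h (st x * s n * y)) \<le> nrm x * opN (s m - s n) * nrm y"
      using h_opN[of x "s m - s n" y] by (simp add: h_diff right_diff_distrib left_diff_distrib)
    also have "\<dots> = (nrm x * nrm y) * opN (s m - s n)" by simp
    also have "\<dots> \<le> C * opN (s m - s n)"
      by (intro mult_right_mono) (simp_all add: C_def opN_nonneg)
    also have "\<dots> < C * (e / C)" using K[OF mn] C by (rule mult_strict_left_mono)
    finally show ?thesis using C by simp
  qed
  then show "\<exists>M. \<forall>m\<ge>M. \<forall>n\<ge>M. norm (h (st x * s m * y) - h (st x * s n * y)) < e" by blast
qed

text \<open>Matrix coefficients separate Cauchy sequences up to null sequences: for fixed large \<open>k\<close>, the square of the norm of \<open>s k x\<close>
differs from the coefficient of \<open>s j\<close> at \<open>(s k x, x)\<close> by at most \<open>nrm (s k * x) * (r / 2) * nrm x\<close>, and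
that coefficient tends to 0 as \<open>j\<close> grows.\<close>

lemma null_if_coefficients_vanish:
  assumes s: "s \<in> Cs" and lim: "\<And>m n. (\<lambda>k. h (st (d m) * s k * d n)) \<longlonglongrightarrow> 0"
  shows "null s"
proof -
  have weak: "(\<lambda>k. h (st x * s k * y)) \<longlonglongrightarrow> 0" for x y
  proof -
    obtain S c where S: "finite S" "x = (\<Sum>n\<in>S. sc (c n) * d n)" using d_spans by blast
    obtain T b where T: "finite T" "y = (\<Sum>n\<in>T. sc (b n) * d n)" using d_spans by blast
    have st_sum: "st (sum f X) = (\<Sum>i\<in>X. st (f i))" for f :: "nat \<Rightarrow> 'b" and X
      by (induction X rule: infinite_finite_induct) (auto simp: st_0 st_add)
    have "h (st x * s k * y) = (\<Sum>m\<in>S. \<Sum>n\<in>T. cnj (c m) * b n * h (st (d m) * s k * d n))" for k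
    proof -
      have "st (sc (c m) * d m) * s k * (sc (b n) * d n)
          = sc (cnj (c m) * b n) * (st (d m) * s k * d n)" for m n
      proof -
        have "st (sc (c m) * d m) * s k * (sc (b n) * d n) =
            st (d m) * sc (cnj (c m)) * s k * sc (b n) * d n"
          by (simp only: st_mult st_sc mult.assoc)
        also have "\<dots> = sc (cnj (c m)) * (st (d m) * s k * sc (b n)) * d n"
          by (simp only: sc_comm[of _ "st (d m)", symmetric] mult.assoc)
        also have "\<dots> = sc (cnj (c m)) * (sc (b n) * (st (d m) * s k)) * d n"
          by (simp only: sc_comm[of _ "st (d m) * s k", symmetric])
        finally show ?thesis by (simp only: sc_mult mult.assoc)
      qed
      then show ?thesis
        unfolding S(2) T(2) st_sum
        by (simp only: sum_distrib_right sum_distrib_left h_sum h_sc) (rule sum.swap)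
    qed
    moreover have "(\<lambda>k. \<Sum>m\<in>S. \<Sum>n\<in>T. cnj (c m) * b n * h (st (d m) * s k * d n)) \<longlonglongrightarrow> 0"
      by (intro tendsto_null_sum tendsto_mult_right_zero lim)
    ultimately show ?thesis by simp
  qed
  show ?thesis
    unfolding null_def
  proof (rule LIMSEQ_I)
    fix r :: real assume r: "r > 0"
    then obtain K where K: "\<And>m n. m \<ge> K \<Longrightarrow> n \<ge> K \<Longrightarrow> opN (s m - s n) < r / 2"
      using CsD[OF s, of "r / 2"] by auto
    have "opN (s k) \<le> r / 2" if k: "k \<ge> K" for k
    proof (rule opN_least)
      fix x
      have "(nrm (s k * x))\<^sup>2 \<le> nrm (s k * x) * (r / 2 * nrm x)"
      proof (rule LIMSEQ_le_const2)
        have "(\<lambda>j. cmod (h (st (s k * x) * s j * x))) \<longlonglongrightarrow> 0"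
          using weak[of "s k * x" x] by (simp add: tendsto_norm_zero_iff)
        then show "(\<lambda>j. (nrm (s k * x))\<^sup>2 - cmod (h (st (s k * x) * s j * x))) \<longlonglongrightarrow> (nrm (s k * x))\<^sup>2"
          using tendsto_diff[OF tendsto_const, of _ 0] by simp
      next
        show "\<exists>N. \<forall>j\<ge>N. (nrm (s k * x))\<^sup>2 - cmod (h (st (s k * x) * s j * x))
            \<le> nrm (s k * x) * (r / 2 * nrm x)"
        proof (intro exI[of _ K] allI impI)
          fix j assume j: "j \<ge> K"
          have "h (st (s k * x) * s k * x) = form (s k * x) (s k * x)"
            by (simp add: form_def mult.assoc)
          then have "(nrm (s k * x))\<^sup>2 = cmod (h (st (s k * x) * s k * x))"
            by (simp add: form_self norm_power)
          also have "h (st (s k * x) * s k * x) =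
              h (st (s k * x) * (s k - s j) * x) + h (st (s k * x) * s j * x)"
            by (simp only: right_diff_distrib left_diff_distrib h_diff) simp
          also have "cmod \<dots> \<le> cmod (h (st (s k * x) * (s k - s j) * x)) + cmod (h (st (s k * x) * s j * x))"
            by (rule norm_triangle_ineq)
          finally have "(nrm (s k * x))\<^sup>2 - cmod (h (st (s k * x) * s j * x))
             \<le> nrm (s k * x) * opN (s k - s j) * nrm x"
            using h_opN[of "s k * x" "s k - s j" x] by linarith
          also have "\<dots> \<le> nrm (s k * x) * (r / 2) * nrm x"
            using K[OF k j] nrm_nonneg
            by (intro mult_right_mono mult_left_mono) auto
          finally show "(nrm (s k * x))\<^sup>2 - cmod (h (st (s k * x) * s j * x))
             \<le> nrm (s k * x) * (r / 2 * nrm x)" by (simp add: mult.assoc)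
        qed
      qed
      then have "nrm (s k * x) * nrm (s k * x) \<le> nrm (s k * x) * (r / 2 * nrm x)"
        by (simp add: power2_eq_square)
      then show "nrm (s k * x) \<le> r / 2 * nrm x"
        using nrm_nonneg[of "s k * x"] nrm_nonneg[of x] r
        by (cases "nrm (s k * x) = 0") (auto simp: mult_le_cancel_left)
    qed (use r in simp)
    then have "norm (opN (s k) - 0) < r" if "k \<ge> K" for k
      using that r opN_nonneg[of "s k"] by (smt (verit) field_sum_of_halves real_norm_def)
    then show "\<exists>no. \<forall>n\<ge>no. norm (opN (s n) - 0) < r" by blast
  qed
qed

lemma L_eq_iff:
  assumes "s \<in> Cs" "t \<in> Cs"
  shows "L s = L t \<longleftrightarrow> null (\<lambda>k. s k - t k)"
proof -
  have lim: "(\<lambda>k. h (st x * (s k - t k) * y)) \<longlonglongrightarrow>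
      lim (\<lambda>k. h (st x * s k * y)) - lim (\<lambda>k. h (st x * t k * y))" for x y
    using tendsto_diff[OF coeff_convergent[OF assms(1), unfolded convergent_LIMSEQ_iff, of x y]
        coeff_convergent[OF assms(2), unfolded convergent_LIMSEQ_iff, of x y]]
    by (simp add: right_diff_distrib left_diff_distrib h_diff)
  show ?thesis
  proof
    assume "L s = L t"
    then have "lim (\<lambda>k. h (st (d m) * s k * d n)) = lim (\<lambda>k. h (st (d m) * t k * d n))" for m n
      by (simp add: L_def fun_eq_iff)
    then show "null (\<lambda>k. s k - t k)"
      by (intro null_if_coefficients_vanish[OF Cs_diff[OF assms]] tendsto_eq_rhs[OF lim]) simp
  next
    assume n: "null (\<lambda>k. s k - t k)"
    have "(\<lambda>k. h (st x * (s k - t k) * y)) \<longlonglongrightarrow> 0" for x y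
    proof (rule tendsto_0_le[OF n[unfolded null_def]])
      show "\<forall>\<^sub>F k in sequentially. norm (h (st x * (s k - t k) * y)) \<le> norm (opN (s k - t k)) * (nrm x * nrm y)"
        using h_opN[of x _ y] by (intro always_eventually allI) (simp add: opN_nonneg mult_ac)
    qed
    then have "lim (\<lambda>k. h (st x * s k * y)) = lim (\<lambda>k. h (st x * t k * y))" for x y
      using LIMSEQ_unique[OF lim[of x y], of 0] by (simp only: right_minus_eq)
    then show "L s = L t" by (simp add: L_def)
  qed
qed

end

context state_on_star_algebra begin

text \<open>Operations are defined on arbitrary representatives; the lemmas \<open>gns_mult\<close> etc. show that any
representative may be used.\<close>

definition rep where "rep b = (SOME s. s \<in> Cs \<and> L s = b)"

lemma rep_L:
  assumes "s \<in> Cs"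
  shows "rep (L s) \<in> Cs" and "null (\<lambda>k. rep (L s) k - s k)"
proof -
  have "rep (L s) \<in> Cs \<and> L (rep (L s)) = L s"
    unfolding rep_def by (rule someI[of _ s]) (simp add: assms)
  then show "rep (L s) \<in> Cs" "null (\<lambda>k. rep (L s) k - s k)"
    using L_eq_iff assms by auto
qed

definition gns :: "(nat \<Rightarrow> nat \<Rightarrow> complex) cstar" where
  "gns = \<lparr>carrier = L ` Cs, mult = (\<lambda>x y. L (\<lambda>k. rep x k * rep y k)), one = L (\<lambda>_. 1),
     zero = L (\<lambda>_. 0), add = (\<lambda>x y. L (\<lambda>k. rep x k + rep y k)),
     cscale = (\<lambda>c x. L (\<lambda>k. sc c * rep x k)), star = (\<lambda>x. L (\<lambda>k. st (rep x k))),
     cnorm = (\<lambda>x. lim (\<lambda>k. opN (rep x k)))\<rparr>"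

lemma gns_carrier: "carrier gns = L ` Cs" and gns_one: "\<one>\<^bsub>gns\<^esub> = L (\<lambda>_. 1)"
  and gns_zero: "\<zero>\<^bsub>gns\<^esub> = L (\<lambda>_. 0)"
  by (simp_all add: gns_def)

lemma gns_mult:
  assumes "s \<in> Cs" "t \<in> Cs"
  shows "L s \<otimes>\<^bsub>gns\<^esub> L t = L (\<lambda>k. s k * t k)"
proof -
  let ?s = "rep (L s)" and ?t = "rep (L t)"
  have "null (\<lambda>k. (?s k - s k) * ?t k + s k * (?t k - t k))"
    by (intro null_add null_mult rep_L assms)
  then have "null (\<lambda>k. ?s k * ?t k - s k * t k)"
    by (simp add: algebra_simps)
  then show ?thesis
    using L_eq_iff[OF Cs_mult Cs_mult, of ?s ?t s t] rep_L assms by (simp add: gns_def)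
qed

lemma gns_add:
  assumes "s \<in> Cs" "t \<in> Cs"
  shows "L s \<oplus>\<^bsub>gns\<^esub> L t = L (\<lambda>k. s k + t k)"
proof -
  let ?s = "rep (L s)" and ?t = "rep (L t)"
  have "null (\<lambda>k. (?s k - s k) + (?t k - t k))"
    by (intro null_add rep_L assms)
  then have "null (\<lambda>k. ?s k + ?t k - (s k + t k))"
    by (simp add: algebra_simps)
  then show ?thesis
    using L_eq_iff[OF Cs_add Cs_add, of ?s ?t s t] rep_L assms by (simp add: gns_def)
qed

lemma gns_cscale:
  assumes "s \<in> Cs"
  shows "cscale gns c (L s) = L (\<lambda>k. sc c * s k)"
proof -
  have "null (\<lambda>k. sc c * (rep (L s) k - s k))"
    by (intro null_mult(2)[of _ "\<lambda>_. sc c"] rep_L assms Cs_const)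
  then show ?thesis
    using L_eq_iff[OF Cs_sc Cs_sc, of "rep (L s)" s] rep_L assms
    by (simp add: gns_def right_diff_distrib)
qed

lemma gns_star:
  assumes "s \<in> Cs"
  shows "star gns (L s) = L (\<lambda>k. st (s k))"
proof -
  have "null (\<lambda>k. st (rep (L s) k - s k))"
    using rep_L(2)[OF assms] by (simp add: null_def opN_st)
  then show ?thesis
    using L_eq_iff[OF Cs_st Cs_st, of "rep (L s)" s] rep_L assms
    by (simp add: gns_def st_diff)
qed

lemma gns_cnorm:
  assumes "s \<in> Cs"
  shows "cnorm gns (L s) = lim (\<lambda>k. opN (s k))"
proof -
  let ?r = "\<lambda>k. opN (rep (L s) k - s k)"
  have "(\<lambda>k. \<bar>opN (rep (L s) k) - opN (s k)\<bar>) \<longlonglongrightarrow> 0"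
    by (rule tendsto_sandwich[OF always_eventually always_eventually tendsto_const
          rep_L(2)[OF assms, unfolded null_def]]) (simp_all add: opN_diff_le)
  then have "(\<lambda>k. opN (rep (L s) k) - opN (s k)) \<longlonglongrightarrow> 0"
    by (rule tendsto_rabs_zero_cancel)
  then have "(\<lambda>k. opN (rep (L s) k) - opN (s k) + opN (s k)) \<longlonglongrightarrow> 0 + lim (\<lambda>k. opN (s k))"
    by (rule tendsto_add[OF _ Cs_norm_convergent[OF assms, unfolded convergent_LIMSEQ_iff]])
  then show ?thesis
    by (simp add: gns_def limI)
qed

lemma cnorm_lim:
  assumes "s \<in> Cs"
  shows "(\<lambda>k. opN (s k)) \<longlonglongrightarrow> cnorm gns (L s)"
  using Cs_norm_convergent[OF assms] by (simp add: gns_cnorm[OF assms] convergent_LIMSEQ_iff)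

lemma ring_gns: "ring gns"
proof (rule ringI)
  show "abelian_group gns"
  proof (rule abelian_groupI)
    fix x assume "x \<in> carrier gns"
    then obtain s where s: "s \<in> Cs" "x = L s" by (auto simp: gns_carrier)
    then have "L (\<lambda>k. - s k) \<oplus>\<^bsub>gns\<^esub> x = \<zero>\<^bsub>gns\<^esub>"
      by (simp add: gns_add Cs_minus gns_zero)
    then show "\<exists>y\<in>carrier gns. y \<oplus>\<^bsub>gns\<^esub> x = \<zero>\<^bsub>gns\<^esub>"
      using s Cs_minus by (auto simp: gns_carrier)
  qed (auto simp: gns_carrier gns_add gns_zero Cs_add Cs_const add_ac)
  show "Group.monoid gns"
    by (rule monoidI) (auto simp: gns_carrier gns_mult gns_one Cs_mult Cs_const mult.assoc)
qed (auto simp: gns_carrier gns_add gns_mult Cs_add Cs_mult algebra_simps)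

lemma gns_diff:
  assumes "s \<in> Cs" "t \<in> Cs"
  shows "L s \<ominus>\<^bsub>gns\<^esub> L t = L (\<lambda>k. s k - t k)"
proof -
  interpret R: ring gns by (rule ring_gns)
  have "\<ominus>\<^bsub>gns\<^esub> L t = L (\<lambda>k. - t k)"
    using assms by (intro R.minus_equality) (auto simp: gns_add Cs_minus gns_zero gns_carrier)
  then show ?thesis using assms by (simp add: R.minus_eq gns_add Cs_minus)
qed

text \<open>Each term \<open>X n\<close> is approximated up to \<open>1 / Suc n\<close> by one member \<open>a n\<close> of its Cauchy sequence, and the diagonal
sequence \<open>a\<close> represents the limit.\<close>

lemma gns_complete:
  assumes X: "\<And>n. X n \<in> carrier gns" and Cauchy: "cstar_Cauchy gns X"
  shows "\<exists>a\<in>carrier gns. cstar_limit gns X a"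
proof -
  have "\<exists>s\<in>Cs. X n = L s" for n using X[of n] by (auto simp: gns_carrier)
  then obtain s where s: "\<And>n. s n \<in> Cs" "\<And>n. X n = L (s n)" by metis
  have "\<exists>K. \<forall>k\<ge>K. opN (s n k - s n K) < 1 / real (Suc n)" for n
    using CsD[OF s(1)[of n], of "1 / real (Suc n)"] by (auto intro: order_refl)
  then obtain K where K: "\<And>n k. k \<ge> K n \<Longrightarrow> opN (s n k - s n (K n)) < 1 / real (Suc n)" by metis
  define a where "a n = s n (K n)" for n
  have near: "\<forall>\<^sub>F k in sequentially. opN (s n k - a n) \<le> 1 / real (Suc n)" for n
    unfolding eventually_sequentially a_def using K less_imp_le by blast
  have aCs: "a \<in> Cs"
    unfolding Cs_def
  proof (intro CollectI allI impI)
    fix e :: real assume e: "e > 0"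
    obtain N1 where N1: "\<And>m n. m \<ge> N1 \<Longrightarrow> n \<ge> N1 \<Longrightarrow> cnorm gns (X m \<ominus>\<^bsub>gns\<^esub> X n) < e / 3"
      using Cauchy[unfolded cstar_Cauchy_def, rule_format, of "e / 3"] e by auto
    obtain N2 where N2: "1 / real (Suc N2) < e / 3"
      using e reals_Archimedean[of "e / 3"] by (auto simp: inverse_eq_divide)
    have "opN (a m - a n) < e" if mn: "m \<ge> max N1 N2" "n \<ge> max N1 N2" for m n
    proof -
      have "(\<lambda>k. opN (s m k - s n k)) \<longlonglongrightarrow> cnorm gns (X m \<ominus>\<^bsub>gns\<^esub> X n)"
        using cnorm_lim[OF Cs_diff[OF s(1) s(1)], of m n] by (simp add: s gns_diff)
      moreover have "cnorm gns (X m \<ominus>\<^bsub>gns\<^esub> X n) < e / 3" using N1 mn by simp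
      ultimately have "\<forall>\<^sub>F k in sequentially. opN (s m k - s n k) < e / 3"
        by (rule order_tendstoD(2))
      then have "\<forall>\<^sub>F k in sequentially. opN (s m k - s n k) < e / 3 \<and>
          opN (s m k - a m) \<le> 1 / real (Suc m) \<and> opN (s n k - a n) \<le> 1 / real (Suc n)"
        using near by (simp add: eventually_conj_iff)
      then obtain k where k: "opN (s m k - s n k) < e / 3"
          "opN (s m k - a m) \<le> 1 / real (Suc m)" "opN (s n k - a n) \<le> 1 / real (Suc n)"
        using eventually_happens' sequentially_bot by (metis (no_types, lifting))
      have "1 / real (Suc m) \<le> 1 / real (Suc N2)" "1 / real (Suc n) \<le> 1 / real (Suc N2)"
        using mn by (auto intro!: divide_left_mono)
      then show ?thesis
        using opN_triangle[of "a m" "a n" "s m k"] opN_triangle[of "s m k" "a n" "s n k"]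
          opN_diff_commute[of "a m" "s m k"] k N2 by linarith
    qed
    then show "\<exists>K. \<forall>m\<ge>K. \<forall>n\<ge>K. opN (a m - a n) < e" by blast
  qed
  have "(\<lambda>n. cnorm gns (X n \<ominus>\<^bsub>gns\<^esub> L a)) \<longlonglongrightarrow> 0"
  proof (rule LIMSEQ_I)
    fix e :: real assume e: "e > 0"
    obtain N1 where N1: "\<And>m n. m \<ge> N1 \<Longrightarrow> n \<ge> N1 \<Longrightarrow> opN (a m - a n) < e / 3"
      using CsD[OF aCs, of "e / 3"] e by auto
    obtain N2 where N2: "1 / real (Suc N2) < e / 3"
      using e reals_Archimedean[of "e / 3"] by (auto simp: inverse_eq_divide)
    have "norm (cnorm gns (X n \<ominus>\<^bsub>gns\<^esub> L a) - 0) < e" if n: "n \<ge> max N1 N2" for n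
    proof -
      have lim: "(\<lambda>k. opN (s n k - a k)) \<longlonglongrightarrow> cnorm gns (X n \<ominus>\<^bsub>gns\<^esub> L a)"
        using cnorm_lim[OF Cs_diff[OF s(1) aCs], of n] by (simp add: s gns_diff aCs)
      have "\<forall>\<^sub>F k in sequentially. opN (s n k - a k) \<le> 2 * e / 3"
        using near[of n] eventually_ge_at_top[of N1]
      proof eventually_elim
        case (elim k)
        have "1 / real (Suc n) \<le> 1 / real (Suc N2)"
          using n by (auto intro!: divide_left_mono)
        then show ?case
          using elim N1[of n k] n N2 opN_triangle[of "s n k" "a k" "a n"] by simp
      qed
      then have "cnorm gns (X n \<ominus>\<^bsub>gns\<^esub> L a) \<le> 2 * e / 3"
        by (rule tendsto_upperbound[OF lim]) simp
      moreover have "0 \<le> cnorm gns (X n \<ominus>\<^bsub>gns\<^esub> L a)"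
        by (rule tendsto_lowerbound[OF lim]) (simp_all add: opN_nonneg)
      ultimately show ?thesis using e by simp
    qed
    then show "\<exists>no. \<forall>n\<ge>no. norm (cnorm gns (X n \<ominus>\<^bsub>gns\<^esub> L a) - 0) < e" by blast
  qed
  then show ?thesis using aCs by (auto simp: cstar_limit_def gns_carrier)
qed

theorem cstar_algebra_gns: "unital_cstar_algebra gns"
proof -
  interpret R: ring gns by (rule ring_gns)
  note S = gns_carrier gns_add gns_mult gns_cscale gns_star Cs_add Cs_mult Cs_sc Cs_st
  have ex: "\<exists>s\<in>Cs. x = L s" if "x \<in> carrier gns" for x using that by (auto simp: gns_carrier)
  show ?thesis
  proof unfold_locales
    fix x y c c'
    assume x: "x \<in> carrier gns"
    obtain s where s: "s \<in> Cs" "x = L s" using ex[OF x] by blast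
    show "cscale gns c x \<in> carrier gns" using s by (simp add: S)
    show "cscale gns (c + c') x = cscale gns c x \<oplus>\<^bsub>gns\<^esub> cscale gns c' x"
      using s by (simp add: S sc_add distrib_right)
    show "cscale gns c (cscale gns c' x) = cscale gns (c * c') x"
      using s by (simp add: S sc_mult mult.assoc)
    show "cscale gns 1 x = x" using s by (simp add: S sc_one)
    show "star gns x \<in> carrier gns" using s by (simp add: S)
    show "star gns (star gns x) = x" using s by (simp add: S st_st)
    show "star gns (cscale gns c x) = cscale gns (cnj c) (star gns x)"
      using s by (simp add: S st_mult st_sc) (simp add: sc_comm)
    show "0 \<le> cnorm gns x"
      using tendsto_lowerbound[OF cnorm_lim[OF s(1)], of 0] s by (simp add: opN_nonneg)
    show "(cnorm gns x = 0) = (x = \<zero>\<^bsub>gns\<^esub>)"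
    proof -
      have "cnorm gns x = 0 \<longleftrightarrow> null s"
        using cnorm_lim[OF s(1)] LIMSEQ_unique by (auto simp: s(2) null_def)
      also have "\<dots> \<longleftrightarrow> L s = L (\<lambda>_. 0)" using L_eq_iff[OF s(1) Cs_const, of 0] by simp
      finally show ?thesis by (simp add: s(2) gns_zero)
    qed
    show "cnorm gns (cscale gns c x) = cmod c * cnorm gns x"
      using LIMSEQ_unique[OF cnorm_lim[OF Cs_sc[OF s(1)]]] tendsto_mult_left[OF cnorm_lim[OF s(1)]]
      by (simp add: s S opN_sc)
    show "cnorm gns (star gns x \<otimes>\<^bsub>gns\<^esub> x) = (cnorm gns x)\<^sup>2"
      using LIMSEQ_unique[OF cnorm_lim[OF Cs_mult[OF Cs_st[OF s(1)] s(1)]]]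
        tendsto_power[OF cnorm_lim[OF s(1)], of 2]
      by (simp add: s S opN_cstar)
    {
      assume y: "y \<in> carrier gns"
      obtain t where t: "t \<in> Cs" "y = L t" using ex[OF y] by blast
      show "cscale gns c (x \<oplus>\<^bsub>gns\<^esub> y) = cscale gns c x \<oplus>\<^bsub>gns\<^esub> cscale gns c y"
        using s t by (simp add: S distrib_left)
      show "cscale gns c x \<otimes>\<^bsub>gns\<^esub> y = cscale gns c (x \<otimes>\<^bsub>gns\<^esub> y)"
        using s t by (simp add: S mult.assoc)
      show "x \<otimes>\<^bsub>gns\<^esub> cscale gns c y = cscale gns c (x \<otimes>\<^bsub>gns\<^esub> y)"
      proof -
        have "s k * (sc c * t k) = sc c * (s k * t k)" for k
          using sc_comm[of c "s k"] by (simp flip: mult.assoc)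
        then show ?thesis using s t by (simp add: S)
      qed
      show "star gns (x \<oplus>\<^bsub>gns\<^esub> y) = star gns x \<oplus>\<^bsub>gns\<^esub> star gns y"
        using s t by (simp add: S st_add)
      show "star gns (x \<otimes>\<^bsub>gns\<^esub> y) = star gns y \<otimes>\<^bsub>gns\<^esub> star gns x"
        using s t by (simp add: S st_mult)
      show "cnorm gns (x \<oplus>\<^bsub>gns\<^esub> y) \<le> cnorm gns x + cnorm gns y"
        using s t LIMSEQ_le[OF cnorm_lim[OF Cs_add[OF s(1) t(1)]]
            tendsto_add[OF cnorm_lim[OF s(1)] cnorm_lim[OF t(1)]]]
        by (simp add: S opN_add)
      show "cnorm gns (x \<otimes>\<^bsub>gns\<^esub> y) \<le> cnorm gns x * cnorm gns y"
        using s t LIMSEQ_le[OF cnorm_lim[OF Cs_mult[OF s(1) t(1)]]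
            tendsto_mult[OF cnorm_lim[OF s(1)] cnorm_lim[OF t(1)]]]
        by (simp add: S opN_mult)
    }
  qed (rule gns_complete)
qed

text \<open>The canonical homomorphism from the *-algebra into its completion.\<close>

definition "\<iota> a = L (\<lambda>_. a)"

lemma \<iota>_eq_iff: "\<iota> a = \<iota> b \<longleftrightarrow> (\<forall>x y. h (x * (a - b) * y) = 0)"
proof -
  have "\<iota> a = \<iota> b \<longleftrightarrow> opN (a - b) = 0"
    unfolding \<iota>_def L_eq_iff[OF Cs_const Cs_const] null_def by (simp add: LIMSEQ_const_iff)
  then show ?thesis by (simp add: opN_eq_0_iff)
qed

lemma \<iota>_hom:
  "\<iota> a \<in> carrier gns" "\<iota> a \<otimes>\<^bsub>gns\<^esub> \<iota> b = \<iota> (a * b)" "\<iota> a \<oplus>\<^bsub>gns\<^esub> \<iota> b = \<iota> (a + b)"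
  "\<one>\<^bsub>gns\<^esub> = \<iota> 1" "\<zero>\<^bsub>gns\<^esub> = \<iota> 0" "cscale gns c (\<iota> a) = \<iota> (sc c * a)" "star gns (\<iota> a) = \<iota> (st a)"
  by (simp_all add: \<iota>_def gns_carrier Cs_const gns_mult gns_add gns_one gns_zero gns_cscale gns_star)

lemma \<iota>_finsum: "finite S \<Longrightarrow> (\<Oplus>\<^bsub>gns\<^esub>i\<in>S. \<iota> (f i)) = \<iota> (\<Sum>i\<in>S. f i)"
proof -
  interpret R: ring gns by (rule ring_gns)
  show "finite S \<Longrightarrow> ?thesis"
    by (induction S rule: finite_induct) (simp_all add: \<iota>_hom R.finsum_insert)
qed

end

section \<open>Projection kernels of noncrossing spans\<close>
definition nc_kernel :: "nat \<Rightarrow> nat \<Rightarrow> idx list \<Rightarrow> idx list \<Rightarrow> complex" where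
  "nc_kernel p n = kern (SOME E. onb (words p n) (F p n) E)"

lemma nc_kernel_onb: obtains E where "onb (words p n) (F p n) E" "nc_kernel p n = kern E"
  unfolding nc_kernel_def
  using someI_ex[OF onb_exists[OF finite_words fsubspace_F]] by blast

lemma nc_kernel_support:
  assumes "z \<notin> words p n \<or> y \<notin> words p n"
  shows "nc_kernel p n z y = 0"
proof -
  obtain E where E: "onb (words p n) (F p n) E" "nc_kernel p n = kern E" by (rule nc_kernel_onb)
  have "e z * cnj (e y) = 0" if "e \<in> E" for e
    using that E(1) assms F_support[of e p n] unfolding onb_def by auto
  then show ?thesis unfolding E(2) kern_def by (intro sum.neutral ballI)
qed

lemma nc_kernel_cnj: "cnj (nc_kernel p n z y) = nc_kernel p n y z"
  by (rule nc_kernel_onb[of p n]) (simp add: cnj_kern)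

lemma nc_kernel_fixed:
  assumes "\<And>w. w \<notin> words p n \<Longrightarrow> f w = 0"
    and "\<And>z. z \<in> words p n \<Longrightarrow> (\<Sum>y\<in>words p n. nc_kernel p n z y * f y) = f z"
  shows "f \<in> F p n"
proof -
  obtain E where E: "onb (words p n) (F p n) E" "nc_kernel p n = kern E" by (rule nc_kernel_onb)
  have "(\<lambda>z. \<Sum>y\<in>words p n. nc_kernel p n z y * f y) \<in> F p n"
    using kern_range[OF E(1) fsubspace_F] by (simp add: E)
  also have "(\<lambda>z. \<Sum>y\<in>words p n. nc_kernel p n z y * f y) = f"
  proof
    fix z show "(\<Sum>y\<in>words p n. nc_kernel p n z y * f y) = f z"
      using assms by (cases "z \<in> words p n") (auto simp: nc_kernel_support)
  qed
  finally show ?thesis .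
qed

lemma nc_kernel_intertwine:
  assumes "\<And>f. f \<in> F p n \<Longrightarrow> (\<lambda>s'. \<Sum>s\<in>words p n. t s' s * f s) \<in> F p m"
    and "\<And>g. g \<in> F p m \<Longrightarrow> (\<lambda>s. \<Sum>s'\<in>words p m. cnj (t s' s) * g s') \<in> F p n"
  shows "(\<Sum>s\<in>words p n. t s' s * nc_kernel p n s r) = (\<Sum>r'\<in>words p m. nc_kernel p m s' r' * t r' r)"
proof -
  obtain E where E: "onb (words p n) (F p n) E" "nc_kernel p n = kern E" by (rule nc_kernel_onb)
  obtain E' where E': "onb (words p m) (F p m) E'" "nc_kernel p m = kern E'" by (rule nc_kernel_onb)
  show ?thesis
    unfolding E(2) E'(2)
    by (rule kern_intertwine[OF E(1) fsubspace_F E'(1) fsubspace_F assms])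
qed

lemma sum_indicator_words:
  "(\<Sum>s\<in>words p n. (if s = s0 then 1 else 0) * f s) = (if s0 \<in> words p n then f s0 else (0::complex))"
proof -
  have "(\<Sum>s\<in>words p n. (if s = s0 then 1 else 0) * f s) = (\<Sum>s\<in>words p n. if s = s0 then f s0 else 0)"
    by (rule sum.cong) auto
  then show ?thesis by (simp add: sum.delta' finite_words)
qed

lemma dupw_words: "s \<in> words p n \<Longrightarrow> a < n \<Longrightarrow> dupw a s \<in> words p (Suc n)"
  by (auto simp: dupw_def words_def dest: in_set_takeD in_set_dropD)
lemma delw_words: "s \<in> words p (Suc n) \<Longrightarrow> a \<le> n \<Longrightarrow> delw a s \<in> words p n"
  by (auto simp: delw_def words_def dest: in_set_takeD in_set_dropD)
lemma insw_words: "s \<in> words p n \<Longrightarrow> a \<le> n \<Longrightarrow> z \<in> Jset p \<Longrightarrow> insw a z s \<in> words p (Suc n)"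
  by (auto simp: insw_def words_def dest: in_set_takeD in_set_dropD)
lemma barw_words: "s \<in> words p n \<Longrightarrow> a < n \<Longrightarrow> barw a s \<in> words p n"
  by (auto simp: barw_def words_def dest: in_set_takeD in_set_dropD)
lemma barw_barw: "a < length s \<Longrightarrow> barw a (barw a s) = s"
  by (metis conj_conj edit_simps(4) id_take_nth_drop length_take min.absorb4)

lemma dupw_eq_iff:
  assumes "s' \<in> words p n" "s \<in> words p (Suc n)" "a < n"
  shows "s = dupw a s' \<longleftrightarrow> s ! a = s ! Suc a \<and> s' = delw a s"
proof
  assume s: "s = dupw a s'"
  obtain u z v where "s' = u @ z # v" "length u = a" by (rule words_splitE[OF assms(1,3)])
  then show "s ! a = s ! Suc a \<and> s' = delw a s" using s by (auto simp: nth_append)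
next
  assume *: "s ! a = s ! Suc a \<and> s' = delw a s"
  obtain u z v' where s: "s = u @ z # v'" "length u = a"
    using words_splitE[OF assms(2), of a] assms(3) by (metis less_SucI)
  moreover obtain z' v where "v' = z' # v" using s assms by (cases v') (auto simp: words_def)
  ultimately show "s = dupw a s'" using * by (auto simp: nth_append)
qed

text \<open>Merging and doubling are adjoint to each other, the bar is self-adjoint, and inserting is adjoint to
summing over a letter. So \<open>kern_intertwine\<close> applies to each of them.\<close>

lemma nc_kernel_merge:
  assumes "s' \<in> words p n" "a < n"
  shows "nc_kernel p (Suc n) (dupw a s') r =
    (if r \<in> words p (Suc n) \<and> r ! a = r ! Suc a then nc_kernel p n s' (delw a r) else 0)"
proof -
  define t :: "idx list \<Rightarrow> idx list \<Rightarrow> complex" where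
    "t s' s = (if s' \<in> words p n \<and> s = dupw a s' then 1 else 0)" for s' s
  have t1: "(\<Sum>s\<in>words p (Suc n). t s' s * f s) = (if s' \<in> words p n then f (dupw a s') else 0)" for f s'
    using sum_indicator_words[of "dupw a s'" f p "Suc n"] dupw_words[of s' p n a] assms(2)
    by (auto simp: t_def cong: if_cong)
  have t2: "(\<Sum>s'\<in>words p n. t s' s * g s') =
      (if s \<in> words p (Suc n) \<and> s ! a = s ! Suc a then g (delw a s) else 0)" for g s
  proof (cases "s \<in> words p (Suc n)")
    case True
    have "(\<Sum>s'\<in>words p n. t s' s * g s') =
        (\<Sum>s'\<in>words p n. (if s' = delw a s then 1 else 0) * (if s ! a = s ! Suc a then g s' else 0))"
      by (rule sum.cong) (use True assms(2) dupw_eq_iff[of _ p n s a] in \<open>auto simp: t_def\<close>)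
    then show ?thesis
      using True delw_words[OF True, of a] assms(2) by (simp only: sum_indicator_words) simp
  next
    case False
    then show ?thesis using dupw_words assms(2) by (auto simp: t_def intro!: sum.neutral)
  qed
  have tc: "cnj (t s' s) = t s' s" for s' s by (simp add: t_def)
  have "(\<Sum>s\<in>words p (Suc n). t s' s * nc_kernel p (Suc n) s r) = (\<Sum>r'\<in>words p n. nc_kernel p n s' r' * t r' r)"
    by (rule nc_kernel_intertwine) (simp_all only: t1 t2 tc F_merge[OF _ assms(2)] F_dup[OF _ assms(2)])
  also have "\<dots> = (\<Sum>r'\<in>words p n. t r' r * nc_kernel p n s' r')" by (simp add: mult.commute)
  finally show ?thesis using assms(1) by (simp only: t1 t2 if_True)
qed

lemma nc_kernel_bar:
  assumes "s' \<in> words p n" "r \<in> words p n" "a < n"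
  shows "nc_kernel p n (barw a s') r = nc_kernel p n s' (barw a r)"
proof -
  define t :: "idx list \<Rightarrow> idx list \<Rightarrow> complex" where
    "t s' s = (if s' \<in> words p n \<and> s = barw a s' then 1 else 0)" for s' s
  have t1: "(\<Sum>s\<in>words p n. t s' s * f s) = (if s' \<in> words p n then f (barw a s') else 0)" for f s'
    using sum_indicator_words[of "barw a s'" f p n] barw_words[of s' p n a] assms(3)
    by (auto simp: t_def cong: if_cong)
  have t2: "(\<Sum>s'\<in>words p n. t s' s * g s') = (if s \<in> words p n then g (barw a s) else 0)" for g s
  proof (cases "s \<in> words p n")
    case True
    have "s = barw a s' \<longleftrightarrow> s' = barw a s" if "s' \<in> words p n" for s'
      using True that assms(3) barw_barw[of a s] barw_barw[of a s'] words_length by metis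
    then have "(\<Sum>s'\<in>words p n. t s' s * g s') =
        (\<Sum>s'\<in>words p n. (if s' = barw a s then 1 else 0) * g s')"
      by (intro sum.cong) (auto simp: t_def)
    then show ?thesis
      using True barw_words[OF True, of a] assms(3) by (simp add: sum_indicator_words)
  next
    case False
    then show ?thesis using barw_words assms(3) by (auto simp: t_def intro!: sum.neutral)
  qed
  have tc: "cnj (t s' s) = t s' s" for s' s by (simp add: t_def)
  have "(\<Sum>s\<in>words p n. t s' s * nc_kernel p n s r) = (\<Sum>r'\<in>words p n. nc_kernel p n s' r' * t r' r)"
    by (rule nc_kernel_intertwine) (simp_all only: t1 t2 tc F_bar[OF _ assms(3)])
  also have "\<dots> = (\<Sum>r'\<in>words p n. t r' r * nc_kernel p n s' r')" by (simp add: mult.commute)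
  finally show ?thesis using assms by (simp only: t1 t2 if_True)
qed

lemma sum_delw:
  assumes "s \<in> words p n" "a \<le> n"
  shows "(\<Sum>s'\<in>words p (Suc n). if s = delw a s' then g s' else 0) = (\<Sum>z\<in>Jset p. g (insw a z s :: idx list) :: complex)"
proof -
  have "(\<Sum>s'\<in>words p (Suc n). if s = delw a s' then g s' else 0) =
      (\<Sum>s'\<in>{s'\<in>words p (Suc n). s = delw a s'}. g s')"
    by (simp add: sum.If_cases finite_words Int_def)
  also have "\<dots> = (\<Sum>z\<in>Jset p. g (insw a z s))"
  proof (rule sum.reindex_bij_witness[where i = "\<lambda>z. insw a z s" and j = "\<lambda>s'. s' ! a"])
    fix s' assume "s' \<in> {s' \<in> words p (Suc n). s = delw a s'}"
    then have s': "s' \<in> words p (Suc n)" "s = delw a s'" by auto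
    obtain u z v where "s' = u @ z # v" "length u = a" "z \<in> Jset p"
      by (rule words_splitE[OF s'(1), of a]) (use assms in auto)
    then show "insw a (s' ! a) s = s'" "s' ! a \<in> Jset p" "g (insw a (s' ! a) s) = g s'"
      using s' by (auto simp: nth_append)
  next
    fix z assume "z \<in> Jset p"
    moreover have "s = take a s @ drop a s" "length (take a s) = a" using assms by (auto simp: words_def)
    ultimately show "insw a z s ! a = z" "insw a z s \<in> {s' \<in> words p (Suc n). s = delw a s'}"
      using insw_words[OF assms] by (auto simp: insw_def nth_append delw_def)
  qed
  finally show ?thesis .
qed

lemma nc_kernel_new:
  assumes "s' \<in> words p (Suc n)" "r \<in> words p n" "a \<le> n"
  shows "nc_kernel p n (delw a s') r = (\<Sum>z\<in>Jset p. nc_kernel p (Suc n) s' (insw a z r))"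
proof -
  define t :: "idx list \<Rightarrow> idx list \<Rightarrow> complex" where
    "t s' s = (if s' \<in> words p (Suc n) \<and> s = delw a s' then 1 else 0)" for s' s
  have t1: "(\<Sum>s\<in>words p n. t s' s * f s) = (if s' \<in> words p (Suc n) then f (delw a s') else 0)" for f s'
    using sum_indicator_words[of "delw a s'" f p n] delw_words[of s' p n a] assms(3)
    by (auto simp: t_def cong: if_cong)
  have t2: "(\<Sum>s'\<in>words p (Suc n). t s' s * g s') =
      (if s \<in> words p n then \<Sum>z\<in>Jset p. g (insw a z s) else 0)" for g s
  proof (cases "s \<in> words p n")
    case True
    have "(\<Sum>s'\<in>words p (Suc n). t s' s * g s') =
        (\<Sum>s'\<in>words p (Suc n). if s = delw a s' then g s' else 0)"
      by (intro sum.cong) (auto simp: t_def)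
    then show ?thesis using True sum_delw[OF True assms(3)] by simp
  next
    case False
    then show ?thesis using delw_words assms(3) by (auto simp: t_def intro!: sum.neutral)
  qed
  have tc: "cnj (t s' s) = t s' s" for s' s by (simp add: t_def)
  have "(\<Sum>s\<in>words p n. t s' s * nc_kernel p n s r) = (\<Sum>r'\<in>words p (Suc n). nc_kernel p (Suc n) s' r' * t r' r)"
    by (rule nc_kernel_intertwine) (simp_all only: t1 t2 tc F_new[OF _ assms(3)] F_cap[OF _ assms(3)])
  also have "\<dots> = (\<Sum>r'\<in>words p (Suc n). t r' r * nc_kernel p (Suc n) s' r')" by (simp add: mult.commute)
  finally show ?thesis using assms by (simp only: t1 t2 if_True)
qed

lemma nc_kernel_0: "nc_kernel p 0 [] [] = 1"
proof -
  obtain E where E: "onb (words p 0) (F p 0) E" "nc_kernel p 0 = kern E" by (rule nc_kernel_onb)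
  have "pvec p [] \<in> F p 0" by (intro F_base) (auto simp: nc_def)
  then have "(\<Sum>t\<in>words p 0. nc_kernel p 0 [] t * pvec p [] t) = pvec p [] []"
    using kern_reproduces[OF E(1)] by (simp add: E)
  then show ?thesis by (simp add: pvec_def pat_def)
qed

type_synonym letter = "idx \<times> idx"

text \<open>The value of the Haar functional at a word of entries \<open>u\<^sub>z\<^sub>y\<close>. It vanishes as soon as an index lies outside
\<open>Jset p\<close>, so letters with such indices act as 0.\<close>

definition haar_word :: "nat \<Rightarrow> letter list \<Rightarrow> complex" where
  "haar_word p w = nc_kernel p (length w) (map fst w) (map snd w)"

lemma haar_word_Nil: "haar_word p [] = 1" by (simp add: haar_word_def nc_kernel_0)

lemma haar_word_outside:
  assumes "(z, y) \<in> set w" "z \<notin> Jset p \<or> y \<notin> Jset p"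
  shows "haar_word p w = 0"
  unfolding haar_word_def using assms by (intro nc_kernel_support) (force simp: words_def)

lemma haar_word_row:
  "haar_word p (U @ (z, y) # (z, y') # V) = (if y = y' then haar_word p (U @ (z, y) # V) else 0)"
proof -
  let ?a = "length U" and ?n = "Suc (length U + length V)"
  let ?s = "map fst U @ z # map fst V" and ?r = "map snd U @ y # y' # map snd V"
  show ?thesis
  proof (cases "?s \<in> words p ?n")
    case True
    have "nc_kernel p (Suc ?n) (dupw ?a ?s) ?r =
        (if ?r \<in> words p (Suc ?n) \<and> ?r ! ?a = ?r ! Suc ?a then nc_kernel p ?n ?s (delw ?a ?r) else 0)"
      by (rule nc_kernel_merge[OF True]) simp
    moreover have "?r \<notin> words p (Suc ?n) \<Longrightarrow> y = y' \<Longrightarrow> delw ?a ?r \<notin> words p ?n"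
      by (auto simp: words_def)
    moreover have "nc_kernel p ?n ?s (delw ?a ?r) = 0" if "delw ?a ?r \<notin> words p ?n"
      using that by (intro nc_kernel_support) simp
    ultimately show ?thesis by (auto simp: haar_word_def nth_append)
  next
    case False
    moreover from this have "map fst U @ z # z # map fst V \<notin> words p (Suc ?n)" by (auto simp: words_def)
    ultimately show ?thesis by (simp add: haar_word_def nc_kernel_support)
  qed
qed

text \<open>Projections are self-adjoint, hence exchanging rows and columns conjugates the values. This turns row relations
into column relations.\<close>

lemma haar_word_swap: "haar_word p (map prod.swap w) = cnj (haar_word p w)"
  by (simp add: haar_word_def nc_kernel_cnj comp_def)

lemma haar_word_col:
  "haar_word p (U @ (z, y) # (z', y) # V) = (if z = z' then haar_word p (U @ (z, y) # V) else 0)"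
proof -
  have "cnj (haar_word p (U @ (z, y) # (z', y) # V)) = cnj (if z = z' then haar_word p (U @ (z, y) # V) else 0)"
    using haar_word_row[of p "map prod.swap U" y z z' "map prod.swap V"] haar_word_swap[of p "U @ (z, y) # V"]
    by (simp flip: haar_word_swap)
  then show ?thesis by (simp only: complex_cnj_cancel_iff)
qed

lemma haar_word_bar: "haar_word p (U @ (conj_idx z, conj_idx y) # V) = haar_word p (U @ (z, y) # V)"
proof -
  let ?a = "length U" and ?n = "Suc (length U + length V)"
  let ?s = "map fst U @ z # map fst V" and ?r = "map snd U @ conj_idx y # map snd V"
  show ?thesis
  proof (cases "?s \<in> words p ?n \<and> ?r \<in> words p ?n")
    case True
    then have "nc_kernel p ?n (barw ?a ?s) ?r = nc_kernel p ?n ?s (barw ?a ?r)"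
      by (intro nc_kernel_bar) auto
    then show ?thesis by (simp add: haar_word_def)
  next
    case False
    have eq: "u @ conj_idx z # v \<in> words p ?n \<longleftrightarrow> u @ z # v \<in> words p ?n" for u v z
      by (auto simp: words_def)
    then have "\<not> (map fst U @ conj_idx z # map fst V \<in> words p ?n \<and> ?r \<in> words p ?n)"
      "\<not> (?s \<in> words p ?n \<and> map snd U @ y # map snd V \<in> words p ?n)"
      using False by auto
    then show ?thesis unfolding haar_word_def using nc_kernel_support by simp
  qed
qed

lemma haar_word_row_sum:
  assumes "z \<in> Jset p"
  shows "(\<Sum>y\<in>Jset p. haar_word p (U @ (z, y) # V)) = haar_word p (U @ V)"
proof -
  let ?a = "length U" and ?n = "length U + length V"
  let ?s = "map fst U @ z # map fst V" and ?r = "map snd U @ map snd V"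
  show ?thesis
  proof (cases "?s \<in> words p (Suc ?n) \<and> ?r \<in> words p ?n")
    case True
    then have "nc_kernel p ?n (delw ?a ?s) ?r = (\<Sum>y\<in>Jset p. nc_kernel p (Suc ?n) ?s (insw ?a y ?r))"
      by (intro nc_kernel_new) auto
    then show ?thesis by (simp add: haar_word_def)
  next
    case False
    then have "\<not> (?s \<in> words p (Suc ?n) \<and> map snd U @ y # map snd V \<in> words p (Suc ?n))"
      "\<not> (map fst U @ map fst V \<in> words p ?n \<and> ?r \<in> words p ?n)" for y
      using assms by (auto simp: words_def)
    then show ?thesis using nc_kernel_support by (simp add: haar_word_def)
  qed
qed

lemma haar_word_col_sum:
  assumes "y \<in> Jset p"
  shows "(\<Sum>z\<in>Jset p. haar_word p (U @ (z, y) # V)) = haar_word p (U @ V)"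
proof -
  have "cnj (\<Sum>z\<in>Jset p. haar_word p (U @ (z, y) # V)) = cnj (haar_word p (U @ V))"
    using haar_word_row_sum[OF assms, of "map prod.swap U" "map prod.swap V"]
    by (simp add: cnj_sum flip: haar_word_swap)
  then show ?thesis by (simp only: complex_cnj_cancel_iff)
qed

section \<open>The free algebra and its magic ideals\<close>
text \<open>With concatenation as addition of words, finitely supported functions on words form the free algebra, the
product being convolution.\<close>

instantiation list :: (type) monoid_add
begin
definition plus_list :: "'a list \<Rightarrow> 'a list \<Rightarrow> 'a list" where "plus_list = (@)"
definition zero_list :: "'a list" where "zero_list = []"
instance by standard (simp_all add: plus_list_def zero_list_def)
end

type_synonym fa = "letter list \<Rightarrow>\<^sub>0 complex"

definition mon :: "letter list \<Rightarrow> fa" where "mon w = Poly_Mapping.single w 1"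
definition sc :: "complex \<Rightarrow> fa" where "sc c = Poly_Mapping.single [] c"
abbreviation gen :: "idx \<Rightarrow> idx \<Rightarrow> fa" where "gen z y \<equiv> mon [(z, y)]"

lemma single_eq: "Poly_Mapping.single w c = sc c * mon w"
  by (simp add: sc_def mon_def mult_single plus_list_def)
lemma mon_mult: "mon v * mon w = mon (v @ w)"
  by (simp add: mon_def mult_single plus_list_def)
lemma mon_Nil: "mon [] = 1"
  by (simp add: mon_def zero_list_def[symmetric] single_one)
lemma sc_add: "sc (c + d) = sc c + sc d" by (simp add: sc_def single_add)
lemma sc_mult: "sc (c * d) = sc c * sc d" by (simp add: sc_def mult_single plus_list_def)
lemma sc_one: "sc 1 = 1" using mon_Nil by (simp add: mon_def sc_def)
lemma sc_zero: "sc 0 = 0" by (simp add: sc_def)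

abbreviation "keys \<equiv> Poly_Mapping.keys"
abbreviation "lookup \<equiv> Poly_Mapping.lookup"

lemma fa_expand: "(x::fa) = (\<Sum>w\<in>keys x. sc (lookup x w) * mon w)"
proof (rule poly_mapping_eqI)
  fix v
  have "lookup (\<Sum>w\<in>keys x. sc (lookup x w) * mon w) v = (\<Sum>w\<in>keys x. if w = v then lookup x w else 0)"
    by (simp add: lookup_sum lookup_single when_def single_eq[symmetric])
  also have "\<dots> = lookup x v" by (simp add: in_keys_iff)
  finally show "lookup x v = lookup (\<Sum>w\<in>keys x. sc (lookup x w) * mon w) v" ..
qed

lemma fa_induct [case_names mon add]:
  assumes "\<And>c w. P (sc c * mon w)" and "\<And>x y. P x \<Longrightarrow> P y \<Longrightarrow> P (x + y)"
  shows "P (x::fa)"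
proof -
  have "P (\<Sum>w\<in>S. sc (lookup x w) * mon w)" if "finite S" for S
    using that
  proof (induction S rule: finite_induct)
    case empty
    then show ?case using assms(1)[of 0 "[]"] by (simp add: sc_zero)
  qed (simp_all add: assms)
  from this[OF finite_keys, of x] show ?thesis
    by (rule back_subst[of P]) (rule fa_expand[symmetric])
qed

lemma sc_comm: "sc c * x = x * sc c"
proof (induction x rule: fa_induct)
  case (mon d w)
  have "sc c * mon w = mon w * sc c"
    by (simp add: sc_def mon_def mult_single plus_list_def)
  then have "sc d * mon w * sc c = sc d * (sc c * mon w)" by (simp only: mult.assoc)
  also have "\<dots> = sc (c * d) * mon w" by (simp add: mult.commute flip: mult.assoc sc_mult)
  finally show ?case by (simp add: sc_mult mult.assoc)
qed (simp add: distrib_left distrib_right)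

definition st :: "fa \<Rightarrow> fa" where
  "st x = (\<Sum>w\<in>keys x. sc (cnj (lookup x w)) * mon (rev w))"

text \<open>The linear extension of a function on words.\<close>

definition lext :: "(letter list \<Rightarrow> complex) \<Rightarrow> fa \<Rightarrow> complex" where
  "lext \<phi> x = (\<Sum>w\<in>keys x. lookup x w * \<phi> w)"

lemma keys_sc_mon: "keys (sc c * mon w) = (if c = 0 then {} else {w})"
  and lookup_sc_mon: "lookup (sc c * mon w) w = c"
  by (simp_all flip: single_eq)

lemma st_add: "st (x + y) = st x + st y"
  unfolding st_def
  by (rule setsum_keys_plus_distrib[where f = "\<lambda>w c. sc (cnj c) * mon (rev w)"])
    (simp_all add: sc_zero sc_add distrib_right)

lemma st_mon: "st (sc c * mon w) = sc (cnj c) * mon (rev w)"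
  by (simp add: st_def keys_sc_mon lookup_sc_mon sc_zero)

lemma lext_add: "lext \<phi> (x + y) = lext \<phi> x + lext \<phi> y"
  unfolding lext_def
  by (rule setsum_keys_plus_distrib[where f = "\<lambda>w c. c * \<phi> w"]) (simp_all add: distrib_right)

lemma lext_mon: "lext \<phi> (sc c * mon w) = c * \<phi> w"
  by (simp add: lext_def keys_sc_mon lookup_sc_mon)

lemma lext_mon1: "lext \<phi> (mon w) = \<phi> w"
  using lext_mon[of \<phi> 1 w] by (simp add: sc_one)

lemma lext_sc: "lext \<phi> (sc c * x) = c * lext \<phi> x"
proof (induction x rule: fa_induct)
  case (mon d w)
  have "sc c * (sc d * mon w) = sc (c * d) * mon w" by (simp add: sc_mult mult.assoc)
  then show ?case by (simp add: lext_mon)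
qed (simp add: distrib_left lext_add)

lemma lext_zero: "lext \<phi> 0 = 0" by (simp add: lext_def)

lemma lext_sum: "lext \<phi> (\<Sum>i\<in>S. f i) = (\<Sum>i\<in>S. lext \<phi> (f i))"
  by (induction S rule: infinite_finite_induct) (simp_all add: lext_zero lext_add)

lemma lext_diff: "lext \<phi> (x - y) = lext \<phi> x - lext \<phi> y"
  using lext_add[of \<phi> "x - y" y] by simp

lemma sc_mon_mult: "(sc c * mon v) * (sc d * mon w) = sc (c * d) * mon (v @ w)"
  by (simp add: mult_single plus_list_def flip: single_eq)

lemma st_mult: "st (x * y) = st y * st x"
proof (induction x rule: fa_induct)
  case (mon c v)
  show ?case
  proof (induction y rule: fa_induct)
    case (mon d w)
    then show ?case by (simp add: sc_mon_mult st_mon mult.commute)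
  qed (simp add: distrib_left distrib_right st_add)
qed (simp add: distrib_left distrib_right st_add)

lemma st_st: "st (st x) = x"
  by (induction x rule: fa_induct) (simp_all add: st_mon st_add)

lemma st_sc: "st (sc c) = sc (cnj c)"
  using st_mon[of c "[]"] by (simp add: mon_Nil)

lemma st_mon1: "st (mon w) = mon (rev w)"
  using st_mon[of 1 w] by (simp add: sc_one)

text \<open>The two-sided ideals modulo which the matrix of generators is a bar-invariant magic unitary: orthogonal entries in
rows and columns, with sum 1. Two such ideals are compared, the kernel of the evaluation in \<open>A\<close> and the
ideal of the Haar functional; arguments that use the relations alone are carried out once, modulo an arbitrary
such ideal.\<close>

definition magic_ideal :: "nat \<Rightarrow> fa set \<Rightarrow> bool" where
  "magic_ideal p I \<longleftrightarrow> 0 \<in> I \<and> (\<forall>a\<in>I. \<forall>b\<in>I. a + b \<in> I) \<and> (\<forall>a\<in>I. \<forall>x. x * a \<in> I \<and> a * x \<in> I) \<and>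
     (\<forall>z\<in>Jset p. \<forall>y\<in>Jset p. \<forall>y'\<in>Jset p. gen z y * gen z y' - (if y = y' then gen z y else 0) \<in> I) \<and>
     (\<forall>z\<in>Jset p. \<forall>z'\<in>Jset p. \<forall>y\<in>Jset p. gen z y * gen z' y - (if z = z' then gen z y else 0) \<in> I) \<and>
     (\<forall>z\<in>Jset p. \<forall>y\<in>Jset p. gen (conj_idx z) (conj_idx y) - gen z y \<in> I) \<and>
     (\<forall>z\<in>Jset p. (\<Sum>y\<in>Jset p. gen z y) - 1 \<in> I) \<and>
     (\<forall>y\<in>Jset p. (\<Sum>z\<in>Jset p. gen z y) - 1 \<in> I)"

locale magic =
  fixes p :: nat and I :: "fa set"
  assumes magic: "magic_ideal p I"
begin

definition eqv :: "fa \<Rightarrow> fa \<Rightarrow> bool" (infix "\<approx>" 50) where "a \<approx> b \<longleftrightarrow> a - b \<in> I"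

lemma I_zero: "0 \<in> I" and I_add: "a \<in> I \<Longrightarrow> b \<in> I \<Longrightarrow> a + b \<in> I"
  and I_mult: "a \<in> I \<Longrightarrow> x * a \<in> I" "a \<in> I \<Longrightarrow> a * x \<in> I"
  using magic unfolding magic_ideal_def by blast+

lemma row: "z \<in> Jset p \<Longrightarrow> y \<in> Jset p \<Longrightarrow> y' \<in> Jset p \<Longrightarrow> gen z y * gen z y' \<approx> (if y = y' then gen z y else 0)"
  and col: "z \<in> Jset p \<Longrightarrow> z' \<in> Jset p \<Longrightarrow> y \<in> Jset p \<Longrightarrow> gen z y * gen z' y \<approx> (if z = z' then gen z y else 0)"
  and bar: "z \<in> Jset p \<Longrightarrow> y \<in> Jset p \<Longrightarrow> gen (conj_idx z) (conj_idx y) \<approx> gen z y"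
  and row_sum: "z \<in> Jset p \<Longrightarrow> (\<Sum>y\<in>Jset p. gen z y) \<approx> 1"
  and col_sum: "y \<in> Jset p \<Longrightarrow> (\<Sum>z\<in>Jset p. gen z y) \<approx> 1"
  using magic unfolding magic_ideal_def eqv_def by blast+

lemma eqv_refl [simp]: "a \<approx> a" by (simp add: eqv_def I_zero)
lemma eqv_sym: "a \<approx> b \<Longrightarrow> b \<approx> a"
  using I_mult(1)[of "a - b" "-1"] by (simp add: eqv_def)
lemma eqv_trans [trans]: "a \<approx> b \<Longrightarrow> b \<approx> c \<Longrightarrow> a \<approx> c"
  using I_add[of "a - b" "b - c"] by (simp add: eqv_def)
lemma eqv_eq_trans [trans]: "a \<approx> b \<Longrightarrow> b = c \<Longrightarrow> a \<approx> c" "a = b \<Longrightarrow> b \<approx> c \<Longrightarrow> a \<approx> c" by simp_all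
lemma eqv_add: "a \<approx> b \<Longrightarrow> c \<approx> d \<Longrightarrow> a + c \<approx> b + d"
  using I_add[of "a - b" "c - d"] by (simp add: eqv_def algebra_simps)
lemma eqv_mult:
  assumes "a \<approx> b" "c \<approx> d" shows "a * c \<approx> b * d"
proof -
  have "(a - b) * c + b * (c - d) \<in> I" using assms by (intro I_add I_mult) (simp_all add: eqv_def)
  then show ?thesis by (simp add: eqv_def algebra_simps)
qed
lemma eqv_sum: "(\<And>i. i \<in> S \<Longrightarrow> f i \<approx> g i) \<Longrightarrow> (\<Sum>i\<in>S. f i) \<approx> (\<Sum>i\<in>S. g i)"
  by (induction S rule: infinite_finite_induct) (simp_all add: eqv_add)

end

abbreviation "haar p \<equiv> lext (haar_word p)"

text \<open>The kernel of the GNS representation of the Haar functional.\<close>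

definition "haar_ideal p = {a. \<forall>x y. haar p (x * a * y) = 0}"

lemma haar_idealI:
  assumes "\<And>v w. haar p (mon v * a * mon w) = 0"
  shows "a \<in> haar_ideal p"
proof -
  have "haar p (x * a * y) = 0" for x y
  proof (induction x rule: fa_induct)
    case (mon c v)
    show ?case
    proof (induction y rule: fa_induct)
      case (mon d w)
      have "mon v * a * (sc d * mon w) = sc d * (mon v * a) * mon w"
        unfolding sc_comm[of d "mon v * a"] by (simp only: mult.assoc)
      then have "sc c * mon v * a * (sc d * mon w) = sc c * (sc d * (mon v * a * mon w))"
        by (simp only: mult.assoc)
      then show ?case using assms by (simp add: lext_sc)
    qed (simp add: distrib_left lext_add)
  qed (simp add: distrib_right lext_add)
  then show ?thesis by (simp add: haar_ideal_def)
qed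

lemma haar_mon: "haar p (mon v * mon [(z, y)] * mon w) = haar_word p (v @ (z, y) # w)"
    "haar p (mon v * (mon [(z, y)] * mon [(z', y')]) * mon w) = haar_word p (v @ (z, y) # (z', y') # w)"
    "haar p (mon v * 1 * mon w) = haar_word p (v @ w)"
  by (simp_all add: mon_mult lext_mon1)

lemma mult_diff_distrib3: "x * (a - b) * y = x * a * y - x * b * (y::'a::ring)"
  by (simp add: algebra_simps)

text \<open>Between words, each defining relation is one of the commutation rules of the projections with the elementary
operations.\<close>

lemma magic_haar_ideal: "magic_ideal p (haar_ideal p)"
  unfolding magic_ideal_def
proof (intro conjI ballI allI)
  fix z y y' assume J: "z \<in> Jset p" "y \<in> Jset p" "y' \<in> Jset p"
  show "gen z y * gen z y' - (if y = y' then gen z y else 0) \<in> haar_ideal p"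
    by (rule haar_idealI) (simp add: mult_diff_distrib3 lext_diff haar_mon haar_word_row lext_zero)
  show "gen y z * gen y' z - (if y = y' then gen y z else 0) \<in> haar_ideal p"
    by (rule haar_idealI) (simp add: mult_diff_distrib3 lext_diff haar_mon haar_word_col lext_zero)
  show "gen (conj_idx z) (conj_idx y) - gen z y \<in> haar_ideal p"
    by (rule haar_idealI) (simp add: mult_diff_distrib3 lext_diff haar_mon haar_word_bar)
  show "(\<Sum>y\<in>Jset p. gen z y) - 1 \<in> haar_ideal p"
    by (rule haar_idealI)
      (simp only: mult_diff_distrib3 lext_diff sum_distrib_left sum_distrib_right lext_sum haar_mon haar_word_row_sum[OF J(1)], simp)
  show "(\<Sum>z\<in>Jset p. gen z y) - 1 \<in> haar_ideal p"
    by (rule haar_idealI)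
      (simp only: mult_diff_distrib3 lext_diff sum_distrib_left sum_distrib_right lext_sum haar_mon haar_word_col_sum[OF J(2)], simp)
next
  show "0 \<in> haar_ideal p" by (simp add: haar_ideal_def lext_zero)
  fix a b x assume a: "a \<in> haar_ideal p"
  then show "x * a \<in> haar_ideal p" "a * x \<in> haar_ideal p"
    unfolding haar_ideal_def by (simp_all add: mult.assoc[symmetric]) (metis mult.assoc)+
  assume "b \<in> haar_ideal p"
  then show "a + b \<in> haar_ideal p"
    using a by (simp add: haar_ideal_def distrib_left distrib_right lext_add)
qed

lemma haar_insert:
  assumes "a - b \<in> haar_ideal p"
  shows "haar p (x * a * y) = haar p (x * b * y)"
  using assms by (simp add: haar_ideal_def mult_diff_distrib3 lext_diff)

section \<open>Positivity of the Haar functional\<close>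
text \<open>A word of length \<open>n + n\<close> is folded into a pair of words of length \<open>n\<close>, reversing the first half. This
identifies \<open>F p (n + n)\<close> with a *-subalgebra of the matrices indexed by words of length \<open>n\<close>, isometrically for the
inner products.\<close>

context
  fixes p n :: nat
begin

definition fold_word :: "(idx list \<Rightarrow> complex) \<Rightarrow> idx list \<times> idx list \<Rightarrow> complex" where
  "fold_word f = (\<lambda>(i, j). if i \<in> words p n \<and> j \<in> words p n then f (rev i @ j) else 0)"

lemma fold_word_apply: "i \<in> words p n \<Longrightarrow> j \<in> words p n \<Longrightarrow> fold_word f (i, j) = f (rev i @ j)"
  by (simp add: fold_word_def)

lemma sum_rev_words: "(\<Sum>i\<in>words p n. \<phi> (rev i)) = (\<Sum>i\<in>words p n. \<phi> i)"
  by (rule sum.reindex_bij_witness[where i = rev and j = rev]) auto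

lemma ip_fold_word:
  "ip (words p n \<times> words p n) (fold_word f) (fold_word g) = ip (words p (n + n)) f g"
proof -
  have "ip (words p n \<times> words p n) (fold_word f) (fold_word g) =
      (\<Sum>i\<in>words p n. \<Sum>j\<in>words p n. cnj (f (rev i @ j)) * g (rev i @ j))"
    unfolding ip_square by (intro sum.cong refl) (simp add: fold_word_apply)
  also have "\<dots> = ip (words p (n + n)) f g"
    unfolding ip_def sum_words_append
    by (rule sum_rev_words[of "\<lambda>i. \<Sum>j\<in>words p n. cnj (f (i @ j)) * g (i @ j)"])
  finally show ?thesis .
qed

lemma fold_word_inj: "inj_on fold_word (F p (n + n))"
proof (rule inj_onI)
  fix f g assume fg: "f \<in> F p (n + n)" "g \<in> F p (n + n)" "fold_word f = fold_word g"
  show "f = g"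
  proof
    fix w
    show "f w = g w"
    proof (cases "w \<in> words p (n + n)")
      case True
      then have uv: "rev (take n w) \<in> words p n" "drop n w \<in> words p n"
        by (auto simp: words_def dest: in_set_takeD in_set_dropD)
      have "fold_word f (rev (take n w), drop n w) = fold_word g (rev (take n w), drop n w)"
        using fg(3) by simp
      then show ?thesis using uv by (simp only: fold_word_apply) simp
    qed (simp add: F_support[OF fg(1)] F_support[OF fg(2)])
  qed
qed

lemma fold_word_linear:
  "fold_word (\<lambda>w. f w + g w) = (\<lambda>s. fold_word f s + fold_word g s)"
  "fold_word (\<lambda>w. c * f w) = (\<lambda>s. c * fold_word f s)"
  "fold_word (\<lambda>w. \<Sum>k\<in>K. b k * g' k w) = (\<lambda>s. \<Sum>k\<in>K. b k * fold_word (g' k) s)"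
  by (auto simp: fold_word_def fun_eq_iff)

lemma matrix_star_algebra_F:
  assumes "onb (words p (n + n)) (F p (n + n)) E"
  shows "matrix_star_algebra (words p n) (fold_word ` F p (n + n)) (fold_word ` E)"
proof
  let ?I = "words p n" and ?F = "F p (n + n)"
  show "finite ?I" by (rule finite_words)
  show "fsubspace (?I \<times> ?I) (fold_word ` ?F)"
    unfolding fsubspace_def
  proof (intro conjI ballI allI impI)
    show "(\<lambda>_. 0) \<in> fold_word ` ?F"
      by (rule image_eqI[OF _ F_zero]) (auto simp: fold_word_def)
  qed (auto simp: fold_word_linear[symmetric] F_add F_scale, auto simp: fold_word_def split: if_splits)
  show "mm ?I a b \<in> fold_word ` ?F" if ab: "a \<in> fold_word ` ?F" "b \<in> fold_word ` ?F" for a b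
  proof -
    obtain f g where f: "a = fold_word f" "f \<in> ?F" and g: "b = fold_word g" "g \<in> ?F" using ab by blast
    define k where "k = (\<lambda>w. if w \<in> words p (n + n) then
        \<Sum>x\<in>words p n. f (take n w @ x) * g (rev x @ drop n w) else 0)"
    have "k \<in> ?F" unfolding k_def by (rule F_compose[OF f(2) g(2)])
    moreover have "mm ?I a b = fold_word k"
    proof
      fix s :: "idx list \<times> idx list"
      obtain i j where s: "s = (i, j)" by (cases s)
      show "mm ?I a b s = fold_word k s"
      proof (cases "i \<in> ?I \<and> j \<in> ?I")
        case True
        then have "rev i @ j \<in> words p (n + n)" "length (rev i) = n"
          by (auto simp: words_def)
        then show ?thesis
          using True by (simp add: s mm_apply f g fold_word_apply k_def)
      qed (auto simp: s mm_apply f g fold_word_def)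
    qed
    ultimately show ?thesis by blast
  qed
  show "adj a \<in> fold_word ` ?F" if a: "a \<in> fold_word ` ?F" for a
  proof -
    obtain f where f: "a = fold_word f" "f \<in> ?F" using a by blast
    have "adj a = fold_word (\<lambda>w. cnj (f (rev w)))"
      by (auto simp: f adj_def fold_word_def fun_eq_iff)
    then show ?thesis using F_cnj[OF F_rev[OF f(2)]] by blast
  qed
  show "onb (?I \<times> ?I) (fold_word ` ?F) (fold_word ` E)"
    unfolding onb_def
  proof (intro conjI ballI)
    have EF: "E \<subseteq> ?F" and finE: "finite E" using assms by (auto simp: onb_def)
    have injE: "inj_on fold_word E" using fold_word_inj EF inj_on_subset by blast
    show "finite (fold_word ` E)" using finE by simp
    show "fold_word ` E \<subseteq> fold_word ` ?F" using EF by blast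
    fix m assume "m \<in> fold_word ` ?F"
    then obtain f where f: "m = fold_word f" "f \<in> ?F" by blast
    have "f = (\<lambda>w. \<Sum>e\<in>E. ip (words p (n + n)) e f * e w)"
      using assms f(2) unfolding onb_def by (elim conjE) (drule (1) bspec)
    then have "fold_word f = fold_word (\<lambda>w. \<Sum>e\<in>E. ip (words p (n + n)) e f * e w)"
      by (rule arg_cong)
    then have eq: "fold_word f = (\<lambda>s. \<Sum>e\<in>E. ip (words p (n + n)) e f * fold_word e s)"
      by (simp only: fold_word_linear)
    show "m = (\<lambda>s. \<Sum>e\<in>fold_word ` E. ip (?I \<times> ?I) e m * e s)"
      unfolding f(1) sum.reindex[OF injE] comp_def ip_fold_word by (rule eq)
  next
    fix e f assume "e \<in> fold_word ` E" "f \<in> fold_word ` E"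
    then obtain e' f' where ef: "e = fold_word e'" "f = fold_word f'" "e' \<in> E" "f' \<in> E" by blast
    moreover have "E \<subseteq> ?F" using assms by (auto simp: onb_def)
    ultimately have "e = f \<longleftrightarrow> e' = f'" using fold_word_inj by (metis inj_onD subsetD)
    then show "ip (?I \<times> ?I) e f = (if e = f then 1 else 0)"
      using assms ef by (simp add: ip_fold_word onb_def)
  qed
qed

lemma nc_kernel_completely_positive:
  "\<exists>r\<ge>0. (\<Sum>i\<in>words p n. \<Sum>j\<in>words p n. \<Sum>i'\<in>words p n. \<Sum>j'\<in>words p n.
     cnj (c (i, j)) * c (i', j') * nc_kernel p (n + n) (rev i @ i') (rev j @ j')) = complex_of_real r"
proof -
  obtain E where E: "onb (words p (n + n)) (F p (n + n)) E" "nc_kernel p (n + n) = kern E" by (rule nc_kernel_onb)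
  interpret matrix_star_algebra "words p n" "fold_word ` F p (n + n)" "fold_word ` E"
    by (rule matrix_star_algebra_F[OF E(1)])
  have EF: "E \<subseteq> F p (n + n)" using E(1) by (auto simp: onb_def)
  have injE: "inj_on fold_word E" using fold_word_inj EF inj_on_subset by blast
  have "kern (fold_word ` E) (i, i') (j, j') = nc_kernel p (n + n) (rev i @ i') (rev j @ j')"
    if "i \<in> words p n" "i' \<in> words p n" "j \<in> words p n" "j' \<in> words p n" for i i' j j'
    using that by (simp add: kern_def sum.reindex[OF injE] E(2) fold_word_apply)
  then show ?thesis
    using kern_completely_positive[of c] by (simp cong: sum.cong)
qed

end

lemma haar_form:
  "haar p (st x * y) = (\<Sum>w\<in>keys x. \<Sum>w'\<in>keys y.
     cnj (lookup x w) * lookup y w' * haar_word p (rev w @ w'))"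
proof -
  have "haar p (st x * y) = haar p (st x * (\<Sum>w\<in>keys y. sc (lookup y w) * mon w))"
    using fa_expand[of y] by simp
  also have "\<dots> = (\<Sum>w\<in>keys x. \<Sum>w'\<in>keys y.
     cnj (lookup x w) * lookup y w' * haar_word p (rev w @ w'))"
    by (simp add: st_def sum_product lext_sum sc_mon_mult lext_mon)
  finally show ?thesis .
qed

definition homogeneous :: "nat \<Rightarrow> fa \<Rightarrow> bool" where
  "homogeneous n x \<longleftrightarrow> (\<forall>w\<in>keys x. length w = n)"

lemma homogeneous_mult: "homogeneous m x \<Longrightarrow> homogeneous n y \<Longrightarrow> homogeneous (m + n) (x * y)"
  using keys_mult[of x y] unfolding homogeneous_def plus_list_def by fastforce

lemma homogeneous_mon: "homogeneous (length w) (sc c * mon w)" "homogeneous (length w) (mon w)"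
  by (simp add: homogeneous_def keys_sc_mon, simp add: homogeneous_def mon_def)

lemma homogeneous_add: "homogeneous n x \<Longrightarrow> homogeneous n y \<Longrightarrow> homogeneous n (x + y)"
  unfolding homogeneous_def using keys_add[of x y] by blast

lemma homogeneous_sum: "(\<And>i. i \<in> S \<Longrightarrow> homogeneous n (f i)) \<Longrightarrow> homogeneous n (\<Sum>i\<in>S. f i)"
proof (induction S rule: infinite_finite_induct)
  case (insert i S)
  then show ?case by (simp add: homogeneous_add)
qed (simp_all add: homogeneous_def)

lemma homogeneous_power: "homogeneous 1 x \<Longrightarrow> homogeneous k (x ^ k)"
proof (induction k)
  case 0
  then show ?case using homogeneous_mon(2)[of "[]"] by (simp add: mon_Nil)
next
  case (Suc k)
  then show ?case using homogeneous_mult[of 1 x k "x ^ k"] by simp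
qed

text \<open>For words \<open>zip i j\<close> and \<open>zip i' j'\<close> of length \<open>n\<close> the value of the functional at the product of the adjoint of the first with
the second is the projection kernel at \<open>(rev i @ i', rev j @ j')\<close>, so positivity is an instance of
complete positivity.\<close>

lemma haar_pos_homogeneous:
  assumes "homogeneous n x"
  shows "\<exists>r\<ge>0. haar p (st x * x) = complex_of_real r"
proof -
  let ?l = "lookup x" and ?K = "keys x"
  define W where "W = (\<lambda>(i, j). zip i j) ` (words p n \<times> words p n)"
  define g where "g = (\<lambda>(w, w'). cnj (?l w) * ?l w' * haar_word p (rev w @ w'))"
  have W_iff: "w \<in> W \<longleftrightarrow> length w = n \<and> set w \<subseteq> Jset p \<times> Jset p" for w
  proof
    assume "w \<in> W"
    then show "length w = n \<and> set w \<subseteq> Jset p \<times> Jset p"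
      by (auto simp: W_def words_def dest: set_zip_leftD set_zip_rightD)
  next
    assume w: "length w = n \<and> set w \<subseteq> Jset p \<times> Jset p"
    have "w = zip (map fst w) (map snd w)" by (simp add: zip_map_fst_snd)
    moreover have "map fst w \<in> words p n" "map snd w \<in> words p n" using w by (auto simp: words_def)
    ultimately show "w \<in> W" unfolding W_def by force
  qed
  have inj: "inj_on (\<lambda>(i, j). zip i j) (words p n \<times> words p n)"
    by (rule inj_on_inverseI[where g = "\<lambda>w. (map fst w, map snd w)"]) (auto simp: words_def)
  have finW: "finite W" by (simp add: W_def finite_words)
  have outside: "g (w, w') = 0" if w: "w \<in> ?K" "w' \<in> ?K" "w \<notin> W \<or> w' \<notin> W" for w w'
  proof -
    have "length w = n" "length w' = n" using w assms by (auto simp: homogeneous_def)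
    then obtain l where "l \<in> set (rev w @ w')" "l \<notin> Jset p \<times> Jset p"
      using w(3) unfolding W_iff by auto
    then have "(fst l, snd l) \<in> set (rev w @ w')" "fst l \<notin> Jset p \<or> snd l \<notin> Jset p"
      by (simp_all add: mem_Times_iff)
    then have "haar_word p (rev w @ w') = 0" by (rule haar_word_outside)
    then show ?thesis by (simp add: g_def)
  qed
  have "haar p (st x * x) = (\<Sum>s\<in>?K \<times> ?K. g s)"
    by (simp add: haar_form sum.cartesian_product g_def)
  also have "\<dots> = (\<Sum>s\<in>W \<times> W. g s)"
  proof (rule sum.mono_neutral_cong)
    show "g s = 0" if "s \<in> ?K \<times> ?K - W \<times> W" for s
      using that outside[of "fst s" "snd s"] by (auto simp: mem_Times_iff)
    show "g s = 0" if "s \<in> W \<times> W - ?K \<times> ?K" for s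
      using that by (auto simp: g_def in_keys_iff split: prod.splits)
  qed (simp_all add: finW)
  also have "\<dots> = (\<Sum>w\<in>W. \<Sum>w'\<in>W. g (w, w'))"
    by (simp add: sum.cartesian_product)
  also have "\<dots> = (\<Sum>i\<in>words p n. \<Sum>j\<in>words p n. \<Sum>i'\<in>words p n. \<Sum>j'\<in>words p n. g (zip i j, zip i' j'))"
    unfolding W_def sum.reindex[OF inj] by (simp add: sum.cartesian_product' comp_def)
  also have "\<dots> = (\<Sum>i\<in>words p n. \<Sum>j\<in>words p n. \<Sum>i'\<in>words p n. \<Sum>j'\<in>words p n.
     cnj (?l (zip i j)) * ?l (zip i' j') * nc_kernel p (n + n) (rev i @ i') (rev j @ j'))"
  proof (intro sum.cong refl)
    fix i j i' j' assume "i \<in> words p n" "j \<in> words p n" "i' \<in> words p n" "j' \<in> words p n"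
    then have len: "length i = n" "length j = n" "length i' = n" "length j' = n"
      by (simp_all add: words_def)
    then have "haar_word p (rev (zip i j) @ zip i' j') = nc_kernel p (n + n) (rev i @ i') (rev j @ j')"
      by (simp add: haar_word_def rev_map[symmetric])
    then show "g (zip i j, zip i' j') = cnj (?l (zip i j)) * ?l (zip i' j') * nc_kernel p (n + n) (rev i @ i') (rev j @ j')"
      by (simp add: g_def)
  qed
  finally show ?thesis
    using nc_kernel_completely_positive[where p = p and n = n and c = "\<lambda>(i, j). ?l (zip i j)"] by simp
qed

text \<open>Multiplying each word from the left by a power of the row sum \<open>s\<close> makes all words equally long. In the
product of the adjoint with the element itself the powers of \<open>s\<close> meet in the middle, where they can be replaced by 1.\<close>

lemma haar_pos:
  assumes p: "p \<ge> 1"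
  shows "\<exists>r\<ge>0. haar p (st x * x) = complex_of_real r"
proof -
  interpret magic p "haar_ideal p" by standard (rule magic_haar_ideal)
  define z0 :: idx where "z0 = (False, 1)"
  have z0: "z0 \<in> Jset p" using p by (simp add: z0_def Jset_def)
  define s where "s = (\<Sum>y\<in>Jset p. gen z0 y)"
  have s: "eqv s 1" unfolding s_def by (rule row_sum[OF z0])
  have sk: "eqv (s ^ k) 1" for k
  proof (induction k)
    case (Suc k)
    then show ?case using eqv_mult[OF s Suc] by simp
  qed simp
  have st_sum: "st (\<Sum>i\<in>S. f i) = (\<Sum>i\<in>S. st (f i))" for f :: "'x \<Rightarrow> fa" and S
  proof -
    have "st 0 = 0" by (simp add: st_def)
    then show ?thesis by (induction S rule: infinite_finite_induct) (simp_all add: st_add)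
  qed
  have "st s = s" by (simp add: s_def st_sum st_mon1)
  then have st_sk: "st (s ^ k) = s ^ k" for k
    by (induction k) (simp_all add: st_mult power_commutes, metis mon_Nil rev.simps(1) st_mon1)
  have s1: "homogeneous 1 s" unfolding s_def
  proof (rule homogeneous_sum)
    show "homogeneous 1 (gen z0 y)" for y using homogeneous_mon(2)[of "[(z0, y)]"] by simp
  qed
  let ?K = "keys x"
  define m where "m w = sc (lookup x w) * mon w" for w
  obtain n where n: "\<And>w. w \<in> ?K \<Longrightarrow> length w \<le> n"
    using finite_nat_set_iff_bounded_le[of "length ` ?K"] by auto
  define x' where "x' = (\<Sum>w\<in>?K. s ^ (n - length w) * m w)"
  have "homogeneous n x'" unfolding x'_def
  proof (rule homogeneous_sum)
    fix w assume w: "w \<in> ?K"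
    have "homogeneous (n - length w + length w) (s ^ (n - length w) * m w)"
      unfolding m_def by (intro homogeneous_mult homogeneous_power s1 homogeneous_mon)
    then show "homogeneous n (s ^ (n - length w) * m w)" using n[OF w] by simp
  qed
  moreover have "haar p (st x' * x') = haar p (st x * x)"
  proof -
    have "st x' * x' = (\<Sum>w\<in>?K. \<Sum>w'\<in>?K. st (m w) * s ^ (n - length w + (n - length w')) * m w')"
      by (simp add: x'_def st_sum st_mult st_sk sum_product power_add mult.assoc)
    moreover have "st x * x = (\<Sum>w\<in>?K. \<Sum>w'\<in>?K. st (m w) * 1 * m w')"
    proof -
      have "st (\<Sum>w\<in>?K. m w) * (\<Sum>w\<in>?K. m w) = (\<Sum>w\<in>?K. \<Sum>w'\<in>?K. st (m w) * 1 * m w')"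
        by (simp add: st_sum sum_product)
      moreover have "(\<Sum>w\<in>?K. m w) = x" unfolding m_def by (rule fa_expand[symmetric])
      ultimately show ?thesis by simp
    qed
    moreover have "haar p (st (m w) * s ^ k * m w') = haar p (st (m w) * 1 * m w')" for w w' k
      by (rule haar_insert) (use sk[of k] in \<open>simp add: eqv_def\<close>)
    ultimately show ?thesis by (simp only: lext_sum)
  qed
  ultimately show ?thesis using haar_pos_homogeneous by metis
qed

text \<open>For \<open>p \<ge> 1\<close> there is a row of generators to pad words with, so the functional is positive.\<close>

locale haar_functional =
  fixes p :: nat
  assumes p: "p \<ge> 1"
begin

sublocale positive_functional st sc "haar p"
  by unfold_locales
    (rule sc_add sc_mult sc_one sc_comm st_add st_mult st_st st_sc lext_add lext_sc haar_pos[OF p])+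

text \<open>Generators act as self-adjoint idempotents on a space with semidefinite form, hence contractively.\<close>

lemma nrm_gen: "nrm (gen z y * x) \<le> nrm x"
proof -
  have idem: "gen z y * gen z y - gen z y \<in> haar_ideal p"
    by (rule haar_idealI) (simp add: mult_diff_distrib3 lext_diff haar_mon haar_word_row)
  have "(nrm (gen z y * x))\<^sup>2 = cmod (form (gen z y * x) (gen z y * x))"
    by (simp add: form_self norm_power)
  also have "form (gen z y * x) (gen z y * x) = haar p (st x * (gen z y * gen z y) * x)"
    by (simp add: form_def st_mult st_mon1 mult.assoc)
  also have "\<dots> = form x (gen z y * x)"
    unfolding haar_insert[OF idem] by (simp add: form_def mult.assoc)
  also have "cmod \<dots> \<le> nrm x * nrm (gen z y * x)" by (rule Cauchy_Schwarz)
  finally have "nrm (gen z y * x) * nrm (gen z y * x) \<le> nrm x * nrm (gen z y * x)"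
    by (simp add: power2_eq_square)
  then show ?thesis
    using nrm_nonneg[of "gen z y * x"] nrm_nonneg[of x]
    by (cases "nrm (gen z y * x) = 0") auto
qed

lemma nrm_mon: "nrm (mon w * x) \<le> nrm x"
proof (induction w)
  case Nil
  then show ?case by (simp add: mon_Nil)
next
  case (Cons l w)
  have "mon (l # w) * x = gen (fst l) (snd l) * (mon w * x)"
    by (simp add: mon_mult flip: mult.assoc)
  then show ?case using nrm_gen[of "fst l" "snd l" "mon w * x"] Cons by simp
qed

sublocale state_on_star_algebra st sc "haar p" "\<lambda>n. mon (from_nat n)"
proof
  fix a :: fa
  show "\<exists>K\<ge>0. \<forall>x. nrm (a * x) \<le> K * nrm x"
  proof (induction a rule: fa_induct)
    case (mon c w)
    have "nrm (sc c * mon w * x) \<le> cmod c * nrm x" for x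
      using nrm_mon[of w x] by (simp add: mult.assoc nrm_sc mult_left_mono)
    then show ?case by (intro exI[of _ "cmod c"]) simp
  next
    case (add a b)
    then obtain K K' where K: "K \<ge> 0" "\<And>x. nrm (a * x) \<le> K * nrm x" "K' \<ge> 0" "\<And>x. nrm (b * x) \<le> K' * nrm x"
      by blast
    have "nrm ((a + b) * x) \<le> (K + K') * nrm x" for x
      using nrm_triangle[of "a * x" "b * x"] K(2)[of x] K(4)[of x] by (simp add: distrib_right)
    then show ?case using K by (intro exI[of _ "K + K'"]) simp
  qed
  let ?K = "keys a"
  have "a = (\<Sum>n\<in>to_nat ` ?K. sc (lookup a (from_nat n)) * mon (from_nat n))"
    using fa_expand[of a] by (simp add: sum.reindex[OF inj_on_subset[OF inj_to_nat]] comp_def)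
  then show "\<exists>S c. finite S \<and> a = (\<Sum>n\<in>S. sc (c n) * mon (from_nat n))"
    by (intro exI[of _ "to_nat ` ?K"] exI[of _ "\<lambda>n. lookup a (from_nat n)"]) simp
qed

lemma \<iota>_eq: "\<iota> a = \<iota> b \<longleftrightarrow> a - b \<in> haar_ideal p"
  unfolding \<iota>_eq_iff haar_ideal_def by simp

theorem gns_magic: "As_relations p gns (\<lambda>z y. \<iota> (gen z y))"
proof -
  interpret magic p "haar_ideal p" by standard (rule magic_haar_ideal)
  have eqv: "\<iota> a = \<iota> b" if "eqv a b" for a b using that by (simp add: \<iota>_eq eqv_def)
  show ?thesis
    unfolding As_relations_def
  proof (intro ballI conjI)
    fix z y assume J: "z \<in> Jset p" "y \<in> Jset p"
    show "\<iota> (gen z y) \<in> carrier gns" by (rule \<iota>_hom)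
    show "\<iota> (gen z y) \<otimes>\<^bsub>gns\<^esub> \<iota> (gen z y) = \<iota> (gen z y)"
      unfolding \<iota>_hom using row[OF J J(2)] by (intro eqv) simp
    show "star gns (\<iota> (gen z y)) = \<iota> (gen z y)"
      by (simp add: \<iota>_hom st_mon1)
    show "\<iota> (gen z y) = star gns (\<iota> (gen (conj_idx z) (conj_idx y)))"
      using eqv[OF bar[OF J]] by (simp add: \<iota>_hom st_mon1)
    have "eqv (\<Sum>x\<in>Jset p. gen z x * gen y x) (\<Sum>x\<in>Jset p. if z = y then gen z x else 0)"
      by (rule eqv_sum) (use col J in blast)
    also have "eqv \<dots> (if z = y then 1 else 0)" using row_sum[OF J(1)] by auto
    finally show "(\<Oplus>\<^bsub>gns\<^esub>x\<in>Jset p. \<iota> (gen z x) \<otimes>\<^bsub>gns\<^esub> star gns (\<iota> (gen y x))) =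
        (if z = y then \<one>\<^bsub>gns\<^esub> else \<zero>\<^bsub>gns\<^esub>)"
      using eqv by (auto simp: \<iota>_hom st_mon1 \<iota>_finsum split: if_splits)
    have "eqv (\<Sum>x\<in>Jset p. gen x z * gen x y) (\<Sum>x\<in>Jset p. if z = y then gen x z else 0)"
      by (rule eqv_sum) (use row J in blast)
    also have "eqv \<dots> (if z = y then 1 else 0)" using col_sum[OF J(1)] by auto
    finally show "(\<Oplus>\<^bsub>gns\<^esub>x\<in>Jset p. star gns (\<iota> (gen x z)) \<otimes>\<^bsub>gns\<^esub> \<iota> (gen x y)) =
        (if z = y then \<one>\<^bsub>gns\<^esub> else \<zero>\<^bsub>gns\<^esub>)"
      using eqv by (auto simp: \<iota>_hom st_mon1 \<iota>_finsum split: if_splits)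
  qed
qed

end

section \<open>Projections with sum one in a C*-algebra\<close>
text \<open>The tail of the exponential series of 2. It is small compared with the quadratic term of that series, which is the
numerical reason behind \<open>corner_zero\<close>.\<close>

lemma exp2_tail: "(\<Sum>k=6..<n. 2 ^ k / fact k :: real) \<le> 8 / 45"
proof (cases "n \<le> 6")
  case False
  have "(\<Sum>k=6..<Suc m. 2 ^ k / fact k :: real) + 2 ^ m / fact m \<le> 8 / 45" if "m \<ge> 6" for m
    using that
  proof (induction m rule: nat_induct_at_least)
    case base
    have "{6..<Suc 6} = {6::nat}" by auto
    then show ?case by (simp add: fact_numeral)
  next
    case (Suc m)
    have "2 * (2 ^ Suc m / fact (Suc m)) \<le> (2 ^ m / fact m :: real)"
    proof -
      have "2 * (2 ^ Suc m / fact (Suc m)) = (2 ^ m / fact m :: real) * (4 / (real m + 1))"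
        by (simp add: field_simps)
      also have "\<dots> \<le> (2 ^ m / fact m) * 1"
        using Suc.hyps by (intro mult_left_mono) auto
      finally show ?thesis by simp
    qed
    moreover have "(\<Sum>k=6..<Suc (Suc m). 2 ^ k / fact k :: real)
        = (\<Sum>k=6..<Suc m. 2 ^ k / fact k) + 2 ^ Suc m / fact (Suc m)"
      using Suc.hyps by (intro sum.atLeastLessThan_Suc) simp
    ultimately show ?case using Suc.IH by linarith
  qed
  from this[of "n - 1"] False have "(\<Sum>k=6..<n. 2 ^ k / fact k :: real) + 2 ^ (n - 1) / fact (n - 1) \<le> 8 / 45"
    by simp
  moreover have "0 \<le> (2 ^ (n - 1) / fact (n - 1) :: real)" by simp
  ultimately show ?thesis by linarith
qed simp

lemma binomial_upper: "real (n choose k) \<le> real n ^ k / fact k"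
proof (cases "k \<le> n")
  case True
  have "(n choose k) * fact k \<le> n ^ k"
  proof -
    have "fact n = ((n choose k) * fact k) * (fact (n - k) :: nat)"
      using binomial_fact_lemma[OF True] by (simp add: mult_ac)
    then have "fact n div fact (n - k) = (n choose k) * fact k" by simp
    then show ?thesis using fact_div_fact_le_pow[OF True] by simp
  qed
  then have "real (n choose k) * fact k \<le> real n ^ k"
    by (metis of_nat_fact of_nat_le_iff of_nat_mult of_nat_power)
  then show ?thesis by (simp add: field_simps)
qed (simp add: binomial_eq_0)

context unital_cstar_algebra
begin

lemma cscale_zero_right: "cscale A a \<zero> = \<zero>"
  using cscale_add_right[of \<zero> \<zero> a] cscale_closed[of \<zero> a] by (metis r_zero zero_closed add.l_cancel_one')
lemma cscale_zero_left: "x \<in> carrier A \<Longrightarrow> cscale A 0 x = \<zero>"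
  using cscale_add_left[of x 0 0] cscale_closed[of x 0] by (metis add_0 add.l_cancel_one')
lemma cscale_minus: "x \<in> carrier A \<Longrightarrow> cscale A (- 1) x = \<ominus> x"
  using cscale_add_left[of x "- 1" 1] cscale_closed[of x "-1"]
  by (metis cscale_one cscale_zero_left minus_equality add.left_inverse)
lemma cnorm_zero: "cnorm A \<zero> = 0"
  by (simp add: cnorm_eq_0_iff)
lemma cnorm_minus: "x \<in> carrier A \<Longrightarrow> cnorm A (\<ominus> x) = cnorm A x"
  using cnorm_cscale[of x "- 1"] by (simp add: cscale_minus)
lemma cnorm_diff: "x \<in> carrier A \<Longrightarrow> y \<in> carrier A \<Longrightarrow> cnorm A (x \<ominus> y) \<le> cnorm A x + cnorm A y"
  using cnorm_triangle[of x "\<ominus> y"] by (simp add: minus_eq cnorm_minus)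
lemma cnorm_finsum: "f \<in> S \<rightarrow> carrier A \<Longrightarrow> cnorm A (\<Oplus>i\<in>S. f i) \<le> (\<Sum>i\<in>S. cnorm A (f i))"
proof (induction S rule: infinite_finite_induct)
  case (insert x S)
  then have "cnorm A (f x \<oplus> (\<Oplus>i\<in>S. f i)) \<le> cnorm A (f x) + cnorm A (\<Oplus>i\<in>S. f i)"
    by (intro cnorm_triangle) auto
  then show ?case using insert by (simp add: finsum_insert Pi_def)
qed (simp_all add: cnorm_zero)

lemma star_zero: "star A \<zero> = \<zero>"
  using star_cscale[of \<zero> 0] by (simp add: cscale_zero_right cscale_zero_left star_closed)
lemma star_one: "star A \<one> = \<one>"
  using star_mult[of \<one> "star A \<one>"] star_closed[of \<one>] star_star[of \<one>] by (metis l_one one_closed r_one)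
lemma cnorm_projection:
  assumes "e \<in> carrier A" "e \<otimes> e = e" "star A e = e"
  shows "cnorm A e \<le> 1"
proof -
  have "cnorm A e * cnorm A e = cnorm A e"
    using cstar_identity[OF assms(1)] assms by (simp add: power2_eq_square)
  then show ?thesis by (metis mult_cancel_left2 order_refl zero_le_one)
qed

end

text \<open>The unit of the corner is the projection \<open>e\<close>, and \<open>peval N f\<close> is the value at \<open>c\<close> of the polynomial with the
first \<open>N\<close> coefficients \<open>f\<close>, computed in the corner.\<close>

locale corner_element = unital_cstar_algebra +
  fixes e c
  assumes e: "e \<in> carrier A" "e \<otimes> e = e" "star A e = e"
    and c: "c \<in> carrier A" "e \<otimes> c = c" "c \<otimes> e = c" "star A c = c"
begin

primrec cpow where
  "cpow 0 = e"
| "cpow (Suc k) = c \<otimes> cpow k"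

primrec peval where
  "peval 0 f = \<zero>"
| "peval (Suc N) f = peval N f \<oplus> cscale A (f N) (cpow N)"

lemma cpow_closed [simp]: "cpow k \<in> carrier A"
  by (induction k) (simp_all add: e c)
lemma peval_closed [simp]: "peval N f \<in> carrier A"
  by (induction N) (simp_all add: cscale_closed)

lemma peval_add: "peval N (\<lambda>k. f k + g k) = peval N f \<oplus> peval N g"
proof (induction N)
  case (Suc N)
  then show ?case by (simp add: cscale_add_left cscale_closed a_ac)
qed simp

lemma peval_scale: "peval N (\<lambda>k. a * f k) = cscale A a (peval N f)"
  by (induction N) (simp_all add: cscale_zero_right cscale_add_right cscale_cscale cscale_closed)

lemma peval_cong: "(\<And>k. k < N \<Longrightarrow> f k = g k) \<Longrightarrow> peval N f = peval N g"
  by (induction N) simp_all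

lemma peval_shift: "peval (Suc N) (\<lambda>k. case k of 0 \<Rightarrow> 0 | Suc j \<Rightarrow> f j) = c \<otimes> peval N f"
proof (induction N)
  case 0
  then show ?case by (simp add: cscale_zero_left c e)
next
  case (Suc N)
  then show ?case by (simp add: r_distr c cscale_closed cscale_mult_right)
qed

lemma cnorm_e: "cnorm A e \<le> 1" using cnorm_projection e by simp

lemma cnorm_cpow: "cnorm A (cpow k) \<le> cnorm A c ^ k"
proof (induction k)
  case (Suc k)
  have "cnorm A (c \<otimes> cpow k) \<le> cnorm A c * cnorm A (cpow k)" by (simp add: cnorm_mult c)
  also have "\<dots> \<le> cnorm A c * cnorm A c ^ k" using Suc by (intro mult_left_mono) (simp_all add: cnorm_nonneg c)
  finally show ?case by simp
qed (simp add: cnorm_e)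

lemma cnorm_peval: "cnorm A (peval N f) \<le> (\<Sum>k<N. cmod (f k) * cnorm A c ^ k)"
proof (induction N)
  case (Suc N)
  have "cnorm A (peval (Suc N) f) \<le> cnorm A (peval N f) + cmod (f N) * cnorm A (cpow N)"
    using cnorm_triangle[of "peval N f" "cscale A (f N) (cpow N)"]
    by (simp add: cscale_closed cnorm_cscale)
  also have "\<dots> \<le> (\<Sum>k<N. cmod (f k) * cnorm A c ^ k) + cmod (f N) * cnorm A c ^ N"
    using Suc cnorm_cpow by (intro add_mono mult_left_mono) auto
  finally show ?case by simp
qed (simp add: cnorm_zero)

lemma e_cpow: "e \<otimes> cpow k = cpow k"
  by (cases k) (simp_all add: e c flip: m_assoc)
lemma e_peval: "e \<otimes> peval N f = peval N f"
  by (induction N) (simp_all add: e r_distr cscale_closed cscale_mult_right e_cpow)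

lemma peval_binomial_bound:
  assumes "cnorm A (e \<oplus> cscale A z c) \<le> 1"
  shows "cnorm A (peval (Suc n) (\<lambda>k. of_nat (n choose k) * z ^ k)) \<le> 1"
proof (induction n)
  case 0
  have "peval (Suc 0) (\<lambda>k. of_nat (0 choose k) * z ^ k) = e" by (simp add: cscale_one e)
  then show ?case by (simp only: cnorm_e)
next
  case (Suc n)
  let ?f = "\<lambda>n k. complex_of_nat (n choose k) * z ^ k"
  let ?w = "peval (Suc n) (?f n)"
  have split: "?f (Suc n) k = ?f n k + z * (case k of 0 \<Rightarrow> 0 | Suc j \<Rightarrow> ?f n j)" for k
    by (cases k) (simp_all add: algebra_simps)
  have "peval (Suc (Suc n)) (?f (Suc n)) =
      peval (Suc (Suc n)) (\<lambda>k. ?f n k + z * (case k of 0 \<Rightarrow> 0 | Suc j \<Rightarrow> ?f n j))"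
    by (rule peval_cong) (rule split)
  also have "\<dots> = peval (Suc (Suc n)) (?f n) \<oplus> cscale A z (c \<otimes> ?w)"
    by (simp only: peval_add peval_scale peval_shift)
  also have "peval (Suc (Suc n)) (?f n) = ?w"
    by (simp add: cscale_zero_left cscale_closed c binomial_eq_0)
  also have "?w \<oplus> cscale A z (c \<otimes> ?w) = (e \<oplus> cscale A z c) \<otimes> ?w"
  proof -
    have "(e \<oplus> cscale A z c) \<otimes> ?w = e \<otimes> ?w \<oplus> cscale A z c \<otimes> ?w"
      by (rule l_distr) (simp_all add: e c cscale_closed del: peval.simps)
    then show ?thesis by (simp only: e_peval cscale_mult_left[OF c(1) peval_closed])
  qed
  finally have "cnorm A (peval (Suc (Suc n)) (?f (Suc n))) \<le> cnorm A (e \<oplus> cscale A z c) * cnorm A ?w"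
    using cnorm_mult[of "e \<oplus> cscale A z c" ?w] by (simp add: e c cscale_closed del: peval.simps)
  also have "\<dots> \<le> 1 * 1"
    using assms Suc by (intro mult_mono) (simp_all add: cnorm_nonneg e c cscale_closed del: peval.simps)
  finally show ?case by simp
qed

lemma fourth_roots_average:
  "(1 + (-1) * \<i> ^ k + (-1) ^ k + (-1) * (- \<i>) ^ k) / 4 = (if k mod 4 = 2 then 1 else (0::complex))"
proof -
  obtain q r where k: "k = 4 * q + r" "r < 4" by (metis mult.commute div_mult_mod_eq mod_less_divisor zero_less_numeral)
  have "\<i> ^ k = \<i> ^ r" "(-1) ^ k = (-1::complex) ^ r" "(- \<i>) ^ k = (- \<i>) ^ r"
    unfolding k(1) power_add power_mult by simp_all
  moreover have "k mod 4 = r" using k by simp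
  moreover have "r = 0 \<or> r = 1 \<or> r = 2 \<or> r = 3" using k(2) by auto
  ultimately show ?thesis by (auto simp: power3_eq_cube)
qed

text \<open>Averaging the powers \<open>(e + z c)\<^sup>n\<close> over the fourth roots of unity \<open>z\<close> with weights \<open>z\<^sup>-\<^sup>2\<close> keeps only the exponents
congruent to 2 modulo 4.\<close>

lemma sparse_binomial_bound:
  assumes "\<And>z. z \<in> {1, \<i>, -1, -\<i>} \<Longrightarrow> cnorm A (e \<oplus> cscale A z c) \<le> 1"
  shows "cnorm A (peval (Suc n) (\<lambda>k. if k mod 4 = 2 then of_nat (n choose k) else 0)) \<le> 1"
proof -
  let ?w = "\<lambda>z. peval (Suc n) (\<lambda>k. of_nat (n choose k) * z ^ k)"
  have eq1: "peval (Suc n) (\<lambda>k. if k mod 4 = 2 then of_nat (n choose k) else 0) =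
    peval (Suc n) (\<lambda>k. ((1 / 4) * (of_nat (n choose k) * 1 ^ k) + (- 1 / 4) * (of_nat (n choose k) * \<i> ^ k)) +
      ((1 / 4) * (of_nat (n choose k) * (- 1) ^ k) + (- 1 / 4) * (of_nat (n choose k) * (- \<i>) ^ k)))"
  proof (rule peval_cong)
    fix k
    have "((1 / 4) * (of_nat (n choose k) * 1 ^ k) + (- 1 / 4) * (of_nat (n choose k) * \<i> ^ k)) +
      ((1 / 4) * (of_nat (n choose k) * (- 1) ^ k) + (- 1 / 4) * (of_nat (n choose k) * (- \<i>) ^ k))
      = of_nat (n choose k) * ((1 + (-1) * \<i> ^ k + (-1) ^ k + (-1) * (- \<i>) ^ k) / 4)"
      by (simp add: field_simps)
    then show "(if k mod 4 = 2 then of_nat (n choose k) else 0) =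
      ((1 / 4) * (of_nat (n choose k) * 1 ^ k) + (- 1 / 4) * (of_nat (n choose k) * \<i> ^ k)) +
      ((1 / 4) * (of_nat (n choose k) * (- 1) ^ k) + (- 1 / 4) * (of_nat (n choose k) * (- \<i>) ^ k))"
      unfolding fourth_roots_average by simp
  qed
  have "cnorm A (peval (Suc n) (\<lambda>k. if k mod 4 = 2 then of_nat (n choose k) else 0)) \<le> (1 / 4 * cnorm A (?w 1) + 1 / 4 * cnorm A (?w \<i>)) +
      (1 / 4 * cnorm A (?w (- 1)) + 1 / 4 * cnorm A (?w (- \<i>)))"
  proof -
    have 2: "cnorm A (cscale A a x \<oplus> cscale A b y) \<le> cmod a * cnorm A x + cmod b * cnorm A y"
      if "x \<in> carrier A" "y \<in> carrier A" for a b x y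
      using cnorm_triangle[of "cscale A a x" "cscale A b y"] that by (simp add: cscale_closed cnorm_cscale)
    let ?L = "cscale A (1 / 4) (?w 1) \<oplus> cscale A (- 1 / 4) (?w \<i>)"
    let ?R = "cscale A (1 / 4) (?w (- 1)) \<oplus> cscale A (- 1 / 4) (?w (- \<i>))"
    have "cnorm A (?L \<oplus> ?R) \<le> cnorm A ?L + cnorm A ?R"
      by (rule cnorm_triangle) (simp_all add: cscale_closed del: peval.simps)
    moreover have "cnorm A ?L \<le> 1 / 4 * cnorm A (?w 1) + 1 / 4 * cnorm A (?w \<i>)"
      by (rule order_trans[OF 2[OF peval_closed peval_closed]]) (simp add: norm_divide del: peval.simps)
    moreover have "cnorm A ?R \<le> 1 / 4 * cnorm A (?w (- 1)) + 1 / 4 * cnorm A (?w (- \<i>))"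
      by (rule order_trans[OF 2[OF peval_closed peval_closed]]) (simp add: norm_divide del: peval.simps)
    ultimately have "cnorm A (?L \<oplus> ?R) \<le> (1 / 4 * cnorm A (?w 1) + 1 / 4 * cnorm A (?w \<i>)) +
        (1 / 4 * cnorm A (?w (- 1)) + 1 / 4 * cnorm A (?w (- \<i>)))"
      by (rule order_trans[OF _ add_mono])
    then show ?thesis unfolding eq1 peval_add peval_scale .
  qed
  also have "\<dots> \<le> 1"
  proof -
    have avg: "(1 / 4 * a + 1 / 4 * b) + (1 / 4 * a' + 1 / 4 * b') \<le> 1"
      if "a \<le> 1" "b \<le> 1" "a' \<le> 1" "b' \<le> 1" for a b a' b' :: real
      using that by linarith
    show ?thesis by (intro avg peval_binomial_bound assms) simp_all
  qed
  finally show ?thesis .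
qed

text \<open>In the averaged power the quadratic term has norm \<open>(n choose 2) * cnorm A c ^ 2\<close> because \<open>c\<close> is
self-adjoint; the next exponent that survives is 6.\<close>

lemma binomial_norm_inequality:
  assumes "\<And>z. z \<in> {1, \<i>, -1, -\<i>} \<Longrightarrow> cnorm A (e \<oplus> cscale A z c) \<le> 1" and n: "n \<ge> 2"
  shows "real (n choose 2) * cnorm A c ^ 2 \<le> 1 + (\<Sum>k=6..<Suc n. real (n choose k) * cnorm A c ^ k)"
proof -
  let ?r = "cnorm A c"
  let ?s = "\<lambda>k. if k mod 4 = 2 then complex_of_nat (n choose k) else 0"
  let ?d = "\<lambda>k. if k = 2 then complex_of_nat (n choose 2) else 0"
  let ?t = "\<lambda>k. if k mod 4 = 2 \<and> k \<noteq> 2 then complex_of_nat (n choose k) else 0"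
  have "peval (Suc N) ?d = (if N \<ge> 2 then cscale A (of_nat (n choose 2)) (c \<otimes> c) else \<zero>)" for N
  proof (induction N)
    case 0
    then show ?case by (simp add: cscale_zero_left e)
  next
    case (Suc N)
    show ?case
    proof (cases "N = 1")
      case True
      then show ?thesis using Suc by (simp add: cscale_closed c del: cpow.simps) (simp add: c)
    next
      case False
      then show ?thesis using Suc by (auto simp: cscale_zero_left cscale_closed c simp del: cpow.simps)
    qed
  qed
  then have d: "peval (Suc n) ?d = cscale A (of_nat (n choose 2)) (c \<otimes> c)" using n by simp
  have "peval (Suc n) ?s = peval (Suc n) (\<lambda>k. ?d k + ?t k)" by (rule peval_cong) auto
  then have s: "peval (Suc n) ?s = cscale A (of_nat (n choose 2)) (c \<otimes> c) \<oplus> peval (Suc n) ?t"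
    by (simp only: peval_add d)
  have s1: "cnorm A (peval (Suc n) ?s) \<le> 1"
    by (rule sparse_binomial_bound) (rule assms(1))
  let ?x = "cscale A (of_nat (n choose 2)) (c \<otimes> c)" and ?y = "peval (Suc n) ?t"
  have xy: "?x \<in> carrier A" "?y \<in> carrier A" by (simp_all add: cscale_closed c del: peval.simps)
  have "cnorm A (c \<otimes> c) = ?r ^ 2" using cstar_identity[OF c(1)] c(4) by simp
  then have "real (n choose 2) * ?r ^ 2 = cnorm A ?x" by (simp add: cnorm_cscale c)
  also have "?x = (?x \<oplus> ?y) \<ominus> ?y" using xy by (simp add: minus_eq a_assoc r_neg del: peval.simps)
  also have "cnorm A \<dots> \<le> cnorm A (?x \<oplus> ?y) + cnorm A ?y" using xy by (intro cnorm_diff) (simp_all del: peval.simps)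
  also have "cnorm A (?x \<oplus> ?y) \<le> 1" using s1 unfolding s .
  also have "cnorm A ?y \<le> (\<Sum>k<Suc n. cmod (?t k) * ?r ^ k)" by (rule cnorm_peval)
  also have "\<dots> \<le> (\<Sum>k=6..<Suc n. real (n choose k) * ?r ^ k)"
  proof -
    have "(\<Sum>k<Suc n. cmod (?t k) * ?r ^ k) = (\<Sum>k=6..<Suc n. cmod (?t k) * ?r ^ k)"
    proof (rule sum.mono_neutral_right)
      show "\<forall>k\<in>{..<Suc n} - {6..<Suc n}. cmod (?t k) * ?r ^ k = 0"
      proof
        fix k assume "k \<in> {..<Suc n} - {6..<Suc n}"
        then have "k < 6" by auto
        then have "k = 0 \<or> k = 1 \<or> k = 2 \<or> k = 3 \<or> k = 4 \<or> k = 5" by auto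
        then show "cmod (?t k) * ?r ^ k = 0" by auto
      qed
    qed auto
    also have "\<dots> \<le> (\<Sum>k=6..<Suc n. real (n choose k) * ?r ^ k)"
      by (intro sum_mono mult_right_mono) (simp_all add: cnorm_nonneg c)
    finally show ?thesis .
  qed
  finally show ?thesis by simp
qed

text \<open>\<open>e + c\<^sup>2\<close> is the mean of \<open>(e + c)\<^sup>2\<close> and \<open>(e - c)\<^sup>2\<close>.\<close>

lemma cnorm_square_plus:
  assumes "cnorm A (e \<oplus> c) \<le> 1" "cnorm A (e \<ominus> c) \<le> 1"
  shows "cnorm A (e \<oplus> c \<otimes> c) \<le> 1"
proof -
  let ?w = "\<lambda>z. peval (Suc 2) (\<lambda>k. of_nat (2 choose k) * z ^ k)"
  have w: "cnorm A (?w 1) \<le> 1" "cnorm A (?w (- 1)) \<le> 1"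
    using peval_binomial_bound[of 1 2] peval_binomial_bound[of "- 1" 2] assms
    by (simp_all add: cscale_one cscale_minus c minus_eq del: peval.simps)
  have eq1: "peval (Suc 2) (\<lambda>k. if k = 1 then 0 else 1) = peval (Suc 2) (\<lambda>k.
      (1 / 2) * (of_nat (2 choose k) * 1 ^ k) + (1 / 2) * (of_nat (2 choose k) * (- 1) ^ k))"
  proof (rule peval_cong)
    fix k :: nat assume "k < Suc 2"
    then have "k = 0 \<or> k = 1 \<or> k = 2" by auto
    then show "(if k = 1 then 0 else 1) =
        (1 / 2) * (of_nat (2 choose k) * 1 ^ k) + (1 / 2) * (of_nat (2 choose k) * (- 1) ^ k :: complex)"
      by auto
  qed
  have "cnorm A (peval (Suc 2) (\<lambda>k. if k = 1 then 0 else 1)) \<le> 1 / 2 * cnorm A (?w 1) + 1 / 2 * cnorm A (?w (- 1))"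
    unfolding eq1 peval_add peval_scale
    using cnorm_triangle[of "cscale A (1 / 2) (?w 1)" "cscale A (1 / 2) (?w (- 1))"]
    by (simp add: cscale_closed cnorm_cscale norm_divide del: peval.simps)
  also have "\<dots> \<le> 1" using w by linarith
  finally have "cnorm A (peval (Suc 2) (\<lambda>k. if k = 1 then 0 else 1)) \<le> 1" .
  moreover have "peval (Suc 2) (\<lambda>k. if k = 1 then 0 else 1) = e \<oplus> c \<otimes> c"
    by (simp add: numeral_2_eq_2 cscale_zero_left cscale_one e c)
  ultimately show ?thesis by simp
qed

text \<open>By the C*-identity the squared norm of \<open>e \<plusminus> \<i> c\<close> is the norm of \<open>e + c\<^sup>2\<close>.\<close>

lemma cnorm_imaginary:
  assumes "cnorm A (e \<oplus> c) \<le> 1" "cnorm A (e \<ominus> c) \<le> 1" and z: "z = \<i> \<or> z = - \<i>"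
  shows "cnorm A (e \<oplus> cscale A z c) \<le> 1"
proof -
  let ?x = "e \<oplus> cscale A z c"
  have zc: "cscale A z c \<in> carrier A" "cscale A (- z) c \<in> carrier A" by (simp_all add: cscale_closed c)
  have "cnj z = - z" "- z * z = 1" using z by auto
  then have "star A ?x \<otimes> ?x = (e \<oplus> cscale A (- z) c) \<otimes> (e \<oplus> cscale A z c)"
    by (simp add: star_add star_cscale cscale_closed e c)
  also have "\<dots> = e \<oplus> (cscale A z c \<oplus> cscale A (- z) c) \<oplus> c \<otimes> c"
  proof -
    have "e \<otimes> cscale A z c = cscale A z c" "cscale A (- z) c \<otimes> e = cscale A (- z) c"
      by (simp_all add: cscale_mult_left cscale_mult_right e c)
    moreover have "cscale A (- z) c \<otimes> cscale A z c = c \<otimes> c"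
      using \<open>- z * z = 1\<close> zc
      by (simp only: cscale_mult_left[OF c(1) zc(1)] cscale_mult_right[OF c(1) c(1)]
          cscale_cscale[OF m_closed[OF c(1) c(1)]] cscale_one[OF m_closed[OF c(1) c(1)]])
    ultimately have "(e \<oplus> cscale A (- z) c) \<otimes> (e \<oplus> cscale A z c) =
        (e \<oplus> cscale A (- z) c) \<oplus> (cscale A z c \<oplus> c \<otimes> c)"
      using zc by (simp only: l_distr r_distr e(1,2) a_closed)
    also have "\<dots> = e \<oplus> (cscale A z c \<oplus> cscale A (- z) c) \<oplus> c \<otimes> c"
      using zc e(1) m_closed[OF c(1) c(1)] by (simp only: a_ac a_closed)
    finally show ?thesis .
  qed
  also have "cscale A z c \<oplus> cscale A (- z) c = \<zero>"
    using cscale_add_left[OF c(1), of z "- z"] by (simp add: cscale_zero_left c)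
  finally have "(cnorm A ?x)\<^sup>2 = cnorm A (e \<oplus> c \<otimes> c)"
    using cstar_identity[of ?x] zc by (simp add: e c)
  then have "(cnorm A ?x)\<^sup>2 \<le> 1" using cnorm_square_plus[OF assms(1,2)] by (rule ord_eq_le_trans)
  then show ?thesis by (simp add: abs_square_le_1 abs_le_iff)
qed

end

context unital_cstar_algebra
begin

lemma cnorm_scaled:
  assumes "e \<in> carrier A" "cnorm A e \<le> 1" "x \<in> carrier A" "cnorm A (e \<oplus> x) \<le> 1" "0 \<le> t" "t \<le> 1"
  shows "cnorm A (e \<oplus> cscale A (of_real t) x) \<le> 1"
proof -
  have "cscale A (of_real (1 - t)) e \<oplus> cscale A (of_real t) (e \<oplus> x) =
      (cscale A (of_real (1 - t)) e \<oplus> cscale A (of_real t) e) \<oplus> cscale A (of_real t) x"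
    using assms(1,3) by (simp add: cscale_add_right cscale_closed a_assoc)
  also have "cscale A (of_real (1 - t)) e \<oplus> cscale A (of_real t) e = e"
    by (simp only: cscale_add_left[OF assms(1), symmetric] of_real_add[symmetric]) (simp add: cscale_one assms)
  finally have "cnorm A (e \<oplus> cscale A (of_real t) x) \<le>
      cnorm A (cscale A (of_real (1 - t)) e) + cnorm A (cscale A (of_real t) (e \<oplus> x))"
    using cnorm_triangle[of "cscale A (of_real (1 - t)) e" "cscale A (of_real t) (e \<oplus> x)"] assms(1,3)
    by (simp add: cscale_closed)
  also have "\<dots> = (1 - t) * cnorm A e + t * cnorm A (e \<oplus> x)"
    using assms by (simp add: cnorm_cscale norm_of_real del: of_real_diff)
  also have "\<dots> \<le> (1 - t) * 1 + t * 1"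
    using assms by (intro add_mono mult_left_mono) auto
  finally show ?thesis by simp
qed

text \<open>The unit is an extreme point of the unit ball. After rescaling, \<open>c\<close> has norm \<open>2 / n\<close> with \<open>n\<close> large, and
\<open>e + z c\<close> is contractive for all fourth roots of unity \<open>z\<close>. Then the quadratic term of the averaged
\<open>n\<close>-th power, at least \<open>3 / 2\<close>, would have to be at most 1 plus the tail of the exponential series of 2.\<close>

lemma corner_zero:
  assumes e0: "e \<in> carrier A" "e \<otimes> e = e" "star A e = e"
    and c0: "c \<in> carrier A" "e \<otimes> c = c" "c \<otimes> e = c" "star A c = c"
    and plus: "cnorm A (e \<oplus> c) \<le> 1" and minus: "cnorm A (e \<ominus> c) \<le> 1"
  shows "c = \<zero>"
proof (rule ccontr)
  assume "c \<noteq> \<zero>"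
  define r where "r = cnorm A c"
  have r: "r > 0" using c0(1) \<open>c \<noteq> \<zero>\<close> cnorm_nonneg[OF c0(1)] cnorm_eq_0_iff[OF c0(1)] by (simp add: r_def)
  obtain n0 where n0: "2 / r \<le> real n0" using real_arch_simple by blast
  define n where "n = max 4 n0"
  have n: "n \<ge> 4" "2 / r \<le> real n" using n0 by (auto simp: n_def)
  define t where "t = 2 / (real n * r)"
  have t: "0 < t" "t \<le> 1" using n r by (auto simp: t_def field_simps)
  define b where "b = cscale A (of_real t) c"
  have b: "b \<in> carrier A" "e \<otimes> b = b" "b \<otimes> e = b" "star A b = b"
    using c0 e0 by (simp_all add: b_def cscale_closed cscale_mult_left cscale_mult_right star_cscale)
  have nb: "cnorm A b = 2 / real n"
  proof -
    have "cnorm A b = t * r" using t by (simp add: b_def cnorm_cscale c0 r_def)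
    then show ?thesis using r n by (simp add: t_def)
  qed
  interpret corner_element A e b by unfold_locales (use e0 b in auto)
  have plus': "cnorm A (e \<oplus> b) \<le> 1"
    unfolding b_def using t by (intro cnorm_scaled e0(1) cnorm_e c0(1) plus) auto
  have minus': "cnorm A (e \<ominus> b) \<le> 1"
  proof -
    have "cnorm A (e \<oplus> cscale A (of_real t) (\<ominus> c)) \<le> 1"
      using t minus by (intro cnorm_scaled e0(1) cnorm_e a_inv_closed c0(1)) (auto simp: minus_eq)
    moreover have "cscale A (of_real t) (\<ominus> c) = \<ominus> b"
      by (simp add: b_def c0 cscale_cscale cscale_closed flip: cscale_minus)
    ultimately show ?thesis by (simp add: minus_eq)
  qed
  have "cnorm A (e \<oplus> cscale A z b) \<le> 1" if "z \<in> {1, \<i>, -1, -\<i>}" for z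
    using that plus' minus' cnorm_imaginary[OF plus' minus']
    by (auto simp: cscale_one cscale_minus minus_eq b)
  then have "real (n choose 2) * (2 / real n) ^ 2 \<le> 1 + (\<Sum>k=6..<Suc n. real (n choose k) * (2 / real n) ^ k)"
    using binomial_norm_inequality[of n] n by (simp add: nb)
  also have "(\<Sum>k=6..<Suc n. real (n choose k) * (2 / real n) ^ k) \<le> (\<Sum>k=6..<Suc n. 2 ^ k / fact k)"
  proof (rule sum_mono)
    fix k
    have "real (n choose k) * (2 / real n) ^ k \<le> real n ^ k / fact k * (2 / real n) ^ k"
      by (intro mult_right_mono binomial_upper) simp
    also have "\<dots> = 2 ^ k / fact k" using n by (simp add: power_divide)
    finally show "real (n choose k) * (2 / real n) ^ k \<le> 2 ^ k / fact k" .
  qed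
  also have "\<dots> \<le> 8 / 45" by (rule exp2_tail)
  finally have "real (n choose 2) * (2 / real n) ^ 2 \<le> 1 + 8 / 45" by simp
  moreover have "real (n choose 2) * (2 / real n) ^ 2 = 2 * (real n - 1) / real n"
  proof -
    have "2 * (n choose 2) = n * (n - 1)"
      using n by (simp add: choose_two)
    then have "real (2 * (n choose 2)) = real (n * (n - 1))" by (rule arg_cong)
    then have "2 * real (n choose 2) = real n * (real n - 1)"
      using n by (simp add: of_nat_diff)
    then have "real (n choose 2) = real n * (real n - 1) / 2" by simp
    then show ?thesis using n by (simp add: power2_eq_square field_simps)
  qed
  moreover have "2 * (real n - 1) / real n \<ge> 3 / 2" using n by (simp add: field_simps)
  ultimately have "3 / 2 \<le> 1 + 8 / (45 :: real)" by (metis order_trans)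
  then show False by simp
qed

text \<open>Compress all projections to the corner of \<open>e = P a\<close>: the compressions \<open>e P x e\<close> with \<open>x \<noteq> a\<close> have sum 0, and each \<open>e - e P x e\<close> is a
contraction. So \<open>e - c\<close> is contractive for a small multiple \<open>c\<close> of the compression of \<open>P b\<close>, and \<open>e + c\<close> as well,
being an average of \<open>e\<close> and the contractions of the other indices. Hence the compression of \<open>P b\<close> vanishes
(\<open>corner_zero\<close>), and it equals \<open>y\<^sup>* y\<close> for \<open>y = P b P a\<close>.\<close>

lemma projections_orthogonal:
  assumes J: "finite J" "a \<in> J" "b \<in> J" "a \<noteq> b"
    and P: "\<And>x. x \<in> J \<Longrightarrow> P x \<in> carrier A \<and> P x \<otimes> P x = P x \<and> star A (P x) = P x"
    and sum: "(\<Oplus>x\<in>J. P x) = \<one>"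
  shows "P a \<otimes> P b = \<zero>"
proof -
  define e where "e = P a"
  have e: "e \<in> carrier A" "e \<otimes> e = e" "star A e = e" using P[OF J(2)] by (simp_all add: e_def)
  define B where "B x = e \<otimes> P x \<otimes> e" for x
  have B: "B x \<in> carrier A" "e \<otimes> B x = B x" "B x \<otimes> e = B x" "star A (B x) = B x" if "x \<in> J" for x
  proof -
    note Px = P[OF that]
    show "B x \<in> carrier A" using Px e by (simp add: B_def)
    show "B x \<otimes> e = B x" using Px e by (simp add: B_def m_assoc)
    show "e \<otimes> B x = B x" using Px e by (simp add: B_def flip: m_assoc)
    show "star A (B x) = B x" using Px e by (simp add: B_def star_mult m_assoc)
  qed
  have eB: "cnorm A (e \<ominus> B x) \<le> 1" if "x \<in> J" for x
  proof -
    note Px = P[OF that]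
    define Q where "Q = \<one> \<ominus> P x"
    have Q: "Q \<in> carrier A" using Px by (simp add: Q_def)
    have "Q \<otimes> Q = Q" "star A Q = Q"
    proof -
      have "star A (\<ominus> P x) = \<ominus> P x"
        using star_cscale[of "P x" "- 1"] Px by (simp add: cscale_minus)
      then show "star A Q = Q" using Px by (simp add: Q_def minus_eq star_add star_one)
      have "Q \<otimes> P x = \<zero>" using Px by (simp add: Q_def minus_eq l_distr l_minus r_neg)
      moreover have "Q \<otimes> Q = Q \<ominus> Q \<otimes> P x"
        using Q Px by (subst (2) Q_def) (simp add: minus_eq r_distr r_minus)
      ultimately show "Q \<otimes> Q = Q" using Q by (simp add: minus_eq)
    qed
    then have nQ: "cnorm A Q \<le> 1" using Q by (intro cnorm_projection)
    have ne: "cnorm A e \<le> 1" using e by (intro cnorm_projection)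
    have "e \<otimes> Q \<otimes> e = e \<ominus> B x"
      using e Px by (simp add: Q_def B_def minus_eq l_distr r_distr r_minus l_minus)
    then have "cnorm A (e \<ominus> B x) \<le> cnorm A (e \<otimes> Q) * cnorm A e"
      using cnorm_mult[of "e \<otimes> Q" e] e Q by simp
    also have "\<dots> \<le> (cnorm A e * cnorm A Q) * cnorm A e"
      by (intro mult_right_mono cnorm_mult cnorm_nonneg e Q)
    also have "\<dots> \<le> (1 * 1) * 1"
      by (intro mult_mono ne nQ cnorm_nonneg e Q mult_nonneg_nonneg) simp_all
    finally show ?thesis by simp
  qed
  define K where "K = J - {a} - {b}"
  define D where "D = (\<Oplus>x\<in>K. e \<ominus> B x)"
  have K: "finite K" "K \<subseteq> J" "a \<notin> K" "b \<notin> K" "J = insert a (insert b K)" using J by (auto simp: K_def)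
  have D: "D \<in> carrier A" unfolding D_def using B e K(2) by (intro finsum_closed) auto
  have nD: "cnorm A D \<le> real (card K)"
  proof -
    have "cnorm A D \<le> (\<Sum>x\<in>K. cnorm A (e \<ominus> B x))"
      unfolding D_def using B e K(2) by (intro cnorm_finsum) auto
    also have "\<dots> \<le> (\<Sum>x\<in>K. 1)" using eB K(2) by (intro sum_mono) auto
    finally show ?thesis by simp
  qed
  have sumB: "e = (\<Oplus>x\<in>J. B x)"
  proof -
    have "e = e \<otimes> (\<Oplus>x\<in>J. P x) \<otimes> e" using e by (simp add: sum)
    also have "\<dots> = (\<Oplus>x\<in>J. e \<otimes> P x) \<otimes> e"
      using J(1) P e by (subst finsum_rdistr) auto
    also have "\<dots> = (\<Oplus>x\<in>J. e \<otimes> P x \<otimes> e)"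
      using J(1) P e by (subst finsum_ldistr) auto
    finally show ?thesis by (simp add: B_def)
  qed
  define m where "m = real (card K) + 1"
  have m: "m \<ge> 1" by (simp add: m_def)
  \<comment> \<open>the compressions \<open>B x\<close> with \<open>x \<noteq> a\<close> have sum 0, so those over \<open>K\<close> add up to \<open>- B b\<close>\<close>
  have key: "D \<ominus> B b = cscale A (of_nat (card K)) e"
  proof -
    have "B a = e" using e by (simp add: B_def e_def)
    have all: "(\<Oplus>x\<in>J. B x) = B a \<oplus> (B b \<oplus> (\<Oplus>x\<in>K. B x))"
    proof -
      have "(\<Oplus>x\<in>insert a (insert b K). B x) = B a \<oplus> (\<Oplus>x\<in>insert b K. B x)"
        using K B J by (intro finsum_insert) auto
      moreover have "(\<Oplus>x\<in>insert b K. B x) = B b \<oplus> (\<Oplus>x\<in>K. B x)"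
        using K B J by (intro finsum_insert) auto
      ultimately show ?thesis by (subst K(5)) (simp only:)
    qed
    define R where "R = (\<Oplus>x\<in>K. B x)"
    have R: "R \<in> carrier A" unfolding R_def using B K(2) by (intro finsum_closed) auto
    have Bb: "B b \<in> carrier A" using B J by simp
    have "e \<oplus> (B b \<oplus> R) = e" using \<open>B a = e\<close> sumB all by (simp only: R_def)
    then have BR: "B b \<oplus> R = \<zero>" by (simp only: add.l_cancel_one[OF e(1) a_closed[OF Bb R]])
    have fD: "D \<oplus> R = cscale A (of_nat (card K)) e"
    proof -
      have "D \<oplus> R = (\<Oplus>x\<in>K. (e \<ominus> B x) \<oplus> B x)"
        unfolding D_def R_def using B e K(2) by (intro finsum_addf[symmetric]) auto
      also have "\<dots> = (\<Oplus>x\<in>K. e)"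
        using B e K(2) by (intro finsum_cong') (auto simp: minus_eq a_assoc l_neg)
      also have "\<dots> = cscale A (of_nat (card K)) e"
        using K(1) e
      proof (induction K rule: finite_induct)
        case (insert x K)
        then show ?case by (simp add: finsum_insert cscale_add_left cscale_one)
      qed (simp add: cscale_zero_left)
      finally show ?thesis .
    qed
    have "\<ominus> B b = R" using BR R Bb by (metis minus_equality a_comm)
    then show ?thesis using fD by (simp add: minus_eq)
  qed
  define c where "c = cscale A (of_real (1 / m)) (B b)"
  note Bb = B[OF J(3)]
  have c: "c \<in> carrier A" "e \<otimes> c = c" "c \<otimes> e = c" "star A c = c"
    using Bb e by (simp_all add: c_def cscale_closed cscale_mult_left cscale_mult_right star_cscale)
  have ne: "cnorm A e \<le> 1" using e by (intro cnorm_projection)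
  have "cnorm A (e \<oplus> cscale A (of_real (1 / m)) (\<ominus> B b)) \<le> 1"
    using eB[OF J(3)] m Bb(1) by (intro cnorm_scaled e(1) ne a_inv_closed) (auto simp: minus_eq)
  moreover have "cscale A (of_real (1 / m)) (\<ominus> B b) = \<ominus> c"
    using Bb(1) by (simp add: c_def cscale_cscale cscale_closed flip: cscale_minus)
  ultimately have minus: "cnorm A (e \<ominus> c) \<le> 1" by (simp add: minus_eq)
  have "e \<oplus> c = cscale A (of_real (1 / m)) (e \<oplus> D)"
  proof -
    have "D = cscale A (of_nat (card K)) e \<oplus> B b"
      using key D Bb(1) e(1) by (metis a_assoc a_inv_closed l_neg minus_eq r_zero)
    then have "e \<oplus> D = cscale A (of_real m) e \<oplus> B b"
      using e Bb(1) cscale_add_left[OF e(1), of "of_nat (card K)" 1]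
      by (simp add: m_def cscale_one cscale_closed a_ac)
    then have "cscale A (of_real (1 / m)) (e \<oplus> D) = cscale A (of_real (1 / m) * of_real m) e \<oplus> c"
      using e Bb(1) by (simp add: cscale_add_right cscale_cscale cscale_closed c_def)
    moreover have "of_real (1 / m) * of_real m = (1 :: complex)" using m by (simp flip: of_real_mult)
    ultimately show ?thesis using e by (simp add: cscale_one)
  qed
  moreover have "cnorm A (cscale A (of_real (1 / m)) (e \<oplus> D)) \<le> 1"
  proof -
    have "cnorm A (e \<oplus> D) \<le> m" using cnorm_triangle[OF e(1) D] ne nD by (simp add: m_def)
    then show ?thesis using m e D by (simp add: cnorm_cscale norm_divide divide_le_eq)
  qed
  ultimately have "c = \<zero>" using corner_zero[OF e c _ minus] by simp
  then have "cscale A (of_real m) c = \<zero>" by (simp add: cscale_zero_right)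
  moreover have "cscale A (of_real m) c = B b"
    using Bb(1) m by (simp add: c_def cscale_cscale cscale_one flip: of_real_mult)
  ultimately have "B b = \<zero>" by simp
  define y where "y = P b \<otimes> e"
  have y: "y \<in> carrier A" "star A y = e \<otimes> P b" using P[OF J(3)] e by (simp_all add: y_def star_mult)
  have "star A y \<otimes> y = B b"
  proof -
    have "e \<otimes> P b \<otimes> (P b \<otimes> e) = e \<otimes> (P b \<otimes> P b) \<otimes> e"
      using P[OF J(3), THEN conjunct1] e(1) by (simp only: m_assoc m_closed)
    then show ?thesis using P[OF J(3)] y(2) by (simp add: y_def B_def)
  qed
  then have "cnorm A y = 0" using cstar_identity[OF y(1)] \<open>B b = \<zero>\<close> by (simp add: cnorm_zero)
  then have "y = \<zero>" using cnorm_eq_0_iff y(1) by simp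
  then have "star A y = \<zero>" by (simp add: star_zero)
  then show ?thesis using y(2) by (simp add: e_def)
qed

end

section \<open>Evaluation of the free algebra in A\<close>
locale magic_cstar = unital_cstar_algebra +
  fixes p :: nat and U
  assumes relations: "As_relations p A U"
begin

text \<open>Letters with an index outside \<open>Jset p\<close> are sent to 0, where \<open>U\<close> need not take values in the carrier.\<close>

definition letter_val :: "letter \<Rightarrow> 'a" where
  "letter_val l = (if fst l \<in> Jset p \<and> snd l \<in> Jset p then U (fst l) (snd l) else \<zero>)"

lemma rel:
  assumes "z \<in> Jset p" "y \<in> Jset p"
  shows "U z y \<in> carrier A" "U z y \<otimes> U z y = U z y" "star A (U z y) = U z y"
    "(\<Oplus>x\<in>Jset p. U z x \<otimes> star A (U y x)) = (if z = y then \<one> else \<zero>)"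
    "(\<Oplus>x\<in>Jset p. star A (U x z) \<otimes> U x y) = (if z = y then \<one> else \<zero>)"
    "U z y = star A (U (conj_idx z) (conj_idx y))"
  using relations[unfolded As_relations_def, rule_format, OF assms] by - (elim conjE, assumption)+

lemmas U_closed = rel(1) and U_idem = rel(2) and U_star = rel(3)

lemma U_bar: "z \<in> Jset p \<Longrightarrow> y \<in> Jset p \<Longrightarrow> U (conj_idx z) (conj_idx y) = U z y"
  using rel(6)[of z y] U_star[of "conj_idx z" "conj_idx y"] by simp

lemma U_row_sum: "z \<in> Jset p \<Longrightarrow> (\<Oplus>x\<in>Jset p. U z x) = \<one>"
proof -
  assume z: "z \<in> Jset p"
  have "(\<Oplus>x\<in>Jset p. U z x) = (\<Oplus>x\<in>Jset p. U z x \<otimes> star A (U z x))"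
    using z by (intro finsum_cong') (auto simp: U_star U_idem U_closed)
  also have "\<dots> = \<one>" using rel(4)[OF z z] by simp
  finally show ?thesis .
qed

lemma U_col_sum: "z \<in> Jset p \<Longrightarrow> (\<Oplus>x\<in>Jset p. U x z) = \<one>"
proof -
  assume z: "z \<in> Jset p"
  have "(\<Oplus>x\<in>Jset p. U x z) = (\<Oplus>x\<in>Jset p. star A (U x z) \<otimes> U x z)"
    using z by (intro finsum_cong') (auto simp: U_star U_idem U_closed)
  also have "\<dots> = \<one>" using rel(5)[OF z z] by simp
  finally show ?thesis .
qed

lemma U_row: "z \<in> Jset p \<Longrightarrow> y \<in> Jset p \<Longrightarrow> y' \<in> Jset p \<Longrightarrow> y \<noteq> y' \<Longrightarrow> U z y \<otimes> U z y' = \<zero>"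
  by (rule projections_orthogonal[OF finite_J]) (auto simp: U_row_sum U_closed U_idem U_star)

lemma U_col: "z \<in> Jset p \<Longrightarrow> z' \<in> Jset p \<Longrightarrow> y \<in> Jset p \<Longrightarrow> z \<noteq> z' \<Longrightarrow> U z y \<otimes> U z' y = \<zero>"
  by (rule projections_orthogonal[OF finite_J, where P = "\<lambda>x. U x y"])
    (auto simp: U_col_sum U_closed U_idem U_star)

lemma letter_val_closed [simp]: "letter_val l \<in> carrier A"
  by (simp add: letter_val_def U_closed)

definition word_val :: "letter list \<Rightarrow> 'a" where
  "word_val w = foldr (\<lambda>l x. letter_val l \<otimes> x) w \<one>"

lemma word_val_simps [simp]: "word_val [] = \<one>" "word_val (l # w) = letter_val l \<otimes> word_val w"
  by (simp_all add: word_val_def)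

lemma word_val_closed [simp]: "word_val w \<in> carrier A"
  by (induction w) simp_all

lemma word_val_append: "word_val (v @ w) = word_val v \<otimes> word_val w"
  by (induction v) (simp_all add: m_assoc)

definition ev :: "fa \<Rightarrow> 'a" where
  "ev x = (\<Oplus>w\<in>keys x. cscale A (lookup x w) (word_val w))"

lemma ev_closed [simp]: "ev x \<in> carrier A"
  unfolding ev_def by (intro finsum_closed) (simp add: cscale_closed)

lemma ev_superset:
  assumes "finite S" "keys x \<subseteq> S"
  shows "ev x = (\<Oplus>w\<in>S. cscale A (lookup x w) (word_val w))"
  unfolding ev_def using assms
  by (intro add.finprod_mono_neutral_cong_left) (auto simp: cscale_zero_left cscale_closed in_keys_iff)

lemma ev_add: "ev (x + y) = ev x \<oplus> ev y"
proof -
  let ?S = "keys x \<union> keys y"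
  have "ev (x + y) = (\<Oplus>w\<in>?S. cscale A (lookup (x + y) w) (word_val w))"
    by (rule ev_superset) (use keys_add[of x y] in auto)
  also have "\<dots> = (\<Oplus>w\<in>?S. cscale A (lookup x w) (word_val w) \<oplus> cscale A (lookup y w) (word_val w))"
    by (simp add: lookup_add cscale_add_left)
  also have "\<dots> = (\<Oplus>w\<in>?S. cscale A (lookup x w) (word_val w)) \<oplus>
      (\<Oplus>w\<in>?S. cscale A (lookup y w) (word_val w))"
    by (rule finsum_addf) (auto simp: cscale_closed)
  also have "\<dots> = ev x \<oplus> ev y" by (simp add: ev_superset[of ?S])
  finally show ?thesis .
qed

lemma ev_mon: "ev (sc c * mon w) = cscale A c (word_val w)"
  by (simp add: ev_def keys_sc_mon lookup_sc_mon cscale_zero_left cscale_closed)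

lemma ev_mon1: "ev (mon w) = word_val w"
  using ev_mon[of 1 w] by (simp add: sc_one cscale_one)

lemma ev_zero: "ev 0 = \<zero>" by (simp add: ev_def)
lemma ev_one: "ev 1 = \<one>" using ev_mon1[of "[]"] by (simp add: mon_Nil)

lemma ev_mult: "ev (x * y) = ev x \<otimes> ev y"
proof (induction x rule: fa_induct)
  case (mon c v)
  show ?case
  proof (induction y rule: fa_induct)
    case (mon d w)
    then show ?case
      by (simp only: sc_mon_mult ev_mon word_val_append cscale_mult_left cscale_mult_right
          cscale_cscale word_val_closed cscale_closed m_closed mult.commute[of d c])
  qed (simp add: distrib_left ev_add r_distr)
qed (simp add: distrib_right ev_add l_distr)

lemma ev_sc: "ev (sc c * x) = cscale A c (ev x)"
proof -
  have "ev (sc c) = cscale A c \<one>" using ev_mon[of c "[]"] by (simp add: mon_Nil)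
  then show ?thesis by (simp add: ev_mult cscale_mult_left)
qed

lemma ev_sum: "ev (\<Sum>i\<in>S. f i) = (\<Oplus>i\<in>S. ev (f i))"
  by (induction S rule: infinite_finite_induct) (simp_all add: ev_zero ev_add)

lemma ev_gen: "z \<in> Jset p \<Longrightarrow> y \<in> Jset p \<Longrightarrow> ev (gen z y) = U z y"
  by (simp add: ev_mon1 letter_val_def U_closed)

lemma ev_eq_iff: "ev a = ev b \<longleftrightarrow> a - b \<in> {a. ev a = \<zero>}"
proof -
  have "ev a = ev (a - b) \<oplus> ev b" using ev_add[of "a - b" b] by simp
  then show ?thesis by (auto simp: add.r_cancel_one)
qed

lemma magic_kernel: "magic_ideal p {a. ev a = \<zero>}"
  unfolding magic_ideal_def
proof (intro conjI ballI allI)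
  note iff = ev_eq_iff[symmetric]
  fix z y y' assume J: "z \<in> Jset p" "y \<in> Jset p" "y' \<in> Jset p"
  show "gen z y * gen z y' - (if y = y' then gen z y else 0) \<in> {a. ev a = \<zero>}"
    unfolding iff using J by (simp add: ev_mult ev_gen ev_zero U_row U_idem)
  show "gen y z * gen y' z - (if y = y' then gen y z else 0) \<in> {a. ev a = \<zero>}"
    unfolding iff using J by (simp add: ev_mult ev_gen ev_zero U_col U_idem)
  show "gen (conj_idx z) (conj_idx y) - gen z y \<in> {a. ev a = \<zero>}"
    unfolding iff using J by (simp add: ev_gen U_bar)
  have "(\<Oplus>y\<in>Jset p. ev (gen z y)) = (\<Oplus>y\<in>Jset p. U z y)"
    using J by (intro finsum_cong') (auto simp: ev_gen U_closed)
  then show "(\<Sum>y\<in>Jset p. gen z y) - 1 \<in> {a. ev a = \<zero>}"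
    unfolding iff ev_sum ev_one using J U_row_sum by simp
  have "(\<Oplus>z\<in>Jset p. ev (gen z y)) = (\<Oplus>z\<in>Jset p. U z y)"
    using J by (intro finsum_cong') (auto simp: ev_gen U_closed)
  then show "(\<Sum>z\<in>Jset p. gen z y) - 1 \<in> {a. ev a = \<zero>}"
    unfolding iff ev_sum ev_one using J U_col_sum by simp
qed (auto simp: ev_zero ev_add ev_mult)

lemma tensor_power_ev:
  assumes "z \<in> words p n" "y \<in> words p n"
  shows "tensor_power A U z y = ev (mon (zip z y))"
proof -
  have "length z = length y" using assms by (simp add: words_def)
  moreover have "set z \<subseteq> Jset p" "set y \<subseteq> Jset p" using assms by (auto simp: words_def)
  ultimately have "tensor_power A U z y = word_val (zip z y)"
    by (induction z y rule: list_induct2) (simp_all add: tensor_power_def letter_val_def)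
  then show ?thesis by (simp add: ev_mon1)
qed

end

lemma universal_magic_cstar:
  assumes "universal_As p A U"
  shows "magic_cstar A p U"
  using assms unfolding universal_As_def magic_cstar_def magic_cstar_axioms_def
  by (elim conjE) (intro conjI, assumption+)

text \<open>The homomorphism that universality provides for the GNS algebra turns the evaluation in \<open>A\<close> into the canonical map of the
free algebra.\<close>

lemma kernel_in_haar_ideal:
  assumes p: "p \<ge> 1" and univ: "universal_As p A U" and a: "magic_cstar.ev A p U a = \<zero>\<^bsub>A\<^esub>"
  shows "a \<in> haar_ideal p"
proof -
  interpret magic_cstar A p U by (rule universal_magic_cstar[OF univ])
  interpret haar_functional p by standard (rule p)
  interpret B: unital_cstar_algebra gns by (rule cstar_algebra_gns)
  have "\<exists>\<phi>\<in>star_hom A gns. \<forall>z\<in>Jset p. \<forall>y\<in>Jset p. \<phi> (U z y) = \<iota> (gen z y)"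
    using univ[unfolded universal_As_def, THEN conjunct2, THEN conjunct2, THEN conjunct2, rule_format,
        OF conjI[OF cstar_algebra_gns gns_magic]] .
  then obtain \<phi> where \<phi>: "\<phi> \<in> star_hom A gns" "\<And>z y. z \<in> Jset p \<Longrightarrow> y \<in> Jset p \<Longrightarrow> \<phi> (U z y) = \<iota> (gen z y)"
    by blast
  have hom: "\<phi> \<in> ring_hom A gns" and \<phi>_scale: "\<And>c x. x \<in> carrier A \<Longrightarrow> \<phi> (cscale A c x) = cscale gns c (\<phi> x)"
    using \<phi>(1) by (auto simp: star_hom_def)
  have \<phi>_zero: "\<phi> \<zero>\<^bsub>A\<^esub> = \<iota> 0"
    using \<phi>_scale[of "\<zero>\<^bsub>A\<^esub>" 0] ring_hom_closed[OF hom, of "\<zero>\<^bsub>A\<^esub>"]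
    by (simp add: cscale_zero_right B.cscale_zero_left flip: \<iota>_hom)
  have letter: "\<phi> (letter_val l) = \<iota> (mon [l])" for l
  proof (cases "fst l \<in> Jset p \<and> snd l \<in> Jset p")
    case True
    then show ?thesis using \<phi>(2)[of "fst l" "snd l"] by (simp add: letter_val_def)
  next
    case False
    have "haar p (mon v * mon [l] * mon w) = 0" for v w
      using haar_mon(1)[of p v "fst l" "snd l" w] haar_word_outside[of "fst l" "snd l" "v @ l # w" p] False by auto
    then have "mon [l] - 0 \<in> haar_ideal p" using haar_idealI[of p "mon [l]"] by simp
    then show ?thesis using False \<phi>_zero \<iota>_eq[of "mon [l]" 0] by (auto simp: letter_val_def)
  qed
  have word: "\<phi> (word_val w) = \<iota> (mon w)" for w
  proof (induction w)
    case Nil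
    then show ?case using ring_hom_one[OF hom] by (simp add: mon_Nil \<iota>_hom)
  next
    case (Cons l w)
    then show ?case using ring_hom_mult[OF hom, of "letter_val l" "word_val w"]
      by (simp add: letter \<iota>_hom mon_mult)
  qed
  have "\<phi> (ev x) = \<iota> x" for x
  proof (induction x rule: fa_induct)
    case (mon c w)
    then show ?case by (simp add: ev_mon \<phi>_scale word \<iota>_hom)
  next
    case (add x y)
    then show ?case using ring_hom_add[OF hom, of "ev x" "ev y"] by (simp add: ev_add \<iota>_hom)
  qed
  then have "\<iota> a = \<iota> 0" using a \<phi>_zero by metis
  then show ?thesis by (simp add: \<iota>_eq)
qed

section \<open>Fixed vectors and Frobenius reciprocity\<close>
text \<open>The matrix \<open>t\<close> of a map from the \<open>k\<close>-th to the \<open>l\<close>-th tensor power as a vector: the upper legs are bent down to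
the right of the lower ones, which reverses their order.\<close>

definition bend :: "nat \<Rightarrow> nat \<Rightarrow> nat \<Rightarrow> (idx list \<Rightarrow> idx list \<Rightarrow> complex) \<Rightarrow> idx list \<Rightarrow> complex" where
  "bend p k l t w = (if w \<in> words p (l + k) then t (take l w) (rev (drop l w)) else 0)"

context magic
begin

lemma eqv_mult_left: "a \<approx> b \<Longrightarrow> x * a \<approx> x * b" and eqv_mult_right: "a \<approx> b \<Longrightarrow> a * x \<approx> b * x"
  by (auto intro: eqv_mult)

definition fix_space :: "nat \<Rightarrow> (idx list \<Rightarrow> complex) set" where
  "fix_space n = {f. (\<forall>w. w \<notin> words p n \<longrightarrow> f w = 0) \<and>
     (\<forall>z\<in>words p n. (\<Sum>y\<in>words p n. sc (f y) * mon (zip z y)) \<approx> sc (f z))}"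

lemma sum_words_mid:
  "(\<Sum>w\<in>words p (a + Suc b). \<phi> w) = (\<Sum>u\<in>words p a. \<Sum>z\<in>Jset p. \<Sum>v\<in>words p b. \<phi> (u @ z # v))"
  by (simp only: sum_words_append sum_words_Suc)

text \<open>A new singleton is absorbed because a row sums to 1. For a doubled point, the second letter is
determined by the first; the bar moves from the column to the row index, and the orthogonality
within columns merges the two generators into one.\<close>

lemma pvec_in_fix_space: "nc q \<Longrightarrow> pvec p q \<in> fix_space (length q)"
proof (induction q rule: nc_induct)
  case Nil
  then show ?case by (auto simp: fix_space_def pvec_def mon_Nil)
next
  case (fresh q1 q2 l c)
  let ?q = "q1 @ (l, c) # q2" and ?a = "length q1" and ?b = "length q2"
  have IH: "(\<Sum>y\<in>words p (?a + ?b). sc (pvec p (q1 @ q2) y) * mon (zip z y)) \<approx> sc (pvec p (q1 @ q2) z)"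
    if "z \<in> words p (?a + ?b)" for z
    using fresh.IH that by (simp add: fix_space_def)
  have pv: "pvec p ?q (u @ z # v) = pvec p (q1 @ q2) (u @ v)"
    if "u \<in> words p ?a" "z \<in> Jset p" "v \<in> words p ?b" for u z v
    using that pat_fresh[of u q1 l q2 c z v] fresh.hyps by (simp add: pvec_def words_def)
  have "(\<Sum>y\<in>words p (?a + Suc ?b). sc (pvec p ?q y) * mon (zip z y)) \<approx> sc (pvec p ?q z)"
    if z: "z \<in> words p (?a + Suc ?b)" for z
  proof -
    obtain u z1 v where z': "z = u @ z1 # v" "length u = ?a" "u \<in> words p ?a" "z1 \<in> Jset p" "v \<in> words p ?b"
      by (rule words_splitE[OF z, of ?a]) auto
    have "(\<Sum>y\<in>words p (?a + Suc ?b). sc (pvec p ?q y) * mon (zip z y)) =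
        (\<Sum>u'\<in>words p ?a. \<Sum>y\<in>Jset p. \<Sum>v'\<in>words p ?b.
          sc (pvec p (q1 @ q2) (u' @ v')) * (mon (zip u u') * gen z1 y * mon (zip v v')))"
      unfolding sum_words_mid
      by (intro sum.cong refl) (use z' in \<open>simp add: pv words_length mon_mult\<close>)
    also have "\<dots> = (\<Sum>u'\<in>words p ?a. \<Sum>v'\<in>words p ?b.
          sc (pvec p (q1 @ q2) (u' @ v')) * (mon (zip u u') * (\<Sum>y\<in>Jset p. gen z1 y) * mon (zip v v')))"
      by (subst sum.swap) (simp only: sum_distrib_left sum_distrib_right)
    also have "\<dots> \<approx> (\<Sum>u'\<in>words p ?a. \<Sum>v'\<in>words p ?b.
          sc (pvec p (q1 @ q2) (u' @ v')) * (mon (zip u u') * 1 * mon (zip v v')))"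
      by (intro eqv_sum eqv_mult_left eqv_mult_right row_sum z')
    also have "\<dots> = (\<Sum>y\<in>words p (?a + ?b). sc (pvec p (q1 @ q2) y) * mon (zip (u @ v) y))"
      unfolding sum_words_append
      by (intro sum.cong refl) (use z' in \<open>simp add: words_length mon_mult\<close>)
    also have "\<dots> \<approx> sc (pvec p (q1 @ q2) (u @ v))"
      by (rule IH) (use z' in \<open>simp add: words_append_len\<close>)
    also have "\<dots> = sc (pvec p ?q z)" using z' pv by simp
    finally show ?thesis .
  qed
  then show ?case by (simp add: fix_space_def pvec_def)
next
  case (dup q1 q2 l c c')
  let ?q = "q1 @ (l, c) # (l, c') # q2" and ?r = "q1 @ (l, c) # q2" and ?a = "length q1" and ?b = "length q2"
  let ?d = "c \<noteq> c'"
  have IH: "(\<Sum>y\<in>words p (?a + Suc ?b). sc (pvec p ?r y) * mon (zip z y)) \<approx> sc (pvec p ?r z)"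
    if "z \<in> words p (?a + Suc ?b)" for z
    using dup.IH that by (simp add: fix_space_def)
  have pv: "pvec p ?q (u @ z # z' # v) = (if z' = tw ?d z then pvec p ?r (u @ z # v) else 0)"
    if "u \<in> words p ?a" "z \<in> Jset p" "z' \<in> Jset p" "v \<in> words p ?b" for u z z' v
  proof -
    have len: "length u = length q1" using that by (simp add: words_def)
    have twist: "z = tw c y \<and> z' = tw c' y \<longleftrightarrow> z' = tw ?d z \<and> z = tw c y" for y
      by (auto simp: tw_def)
    have "pat ?q (u @ z # z' # v) \<longleftrightarrow> (\<exists>g. u = map (\<lambda>(l, c). tw c (g l)) q1 \<and>
        (z = tw c (g l) \<and> z' = tw c' (g l)) \<and> v = map (\<lambda>(l, c). tw c (g l)) q2)"
      by (simp only: pat_mid2[OF len] conj_assoc)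
    moreover have "pat ?r (u @ z # v) \<longleftrightarrow> (\<exists>g. u = map (\<lambda>(l, c). tw c (g l)) q1 \<and>
        z = tw c (g l) \<and> v = map (\<lambda>(l, c). tw c (g l)) q2)"
      by (rule pat_mid[OF len])
    ultimately have "pat ?q (u @ z # z' # v) \<longleftrightarrow> z' = tw ?d z \<and> pat ?r (u @ z # v)"
      unfolding twist by blast
    moreover have "u @ z # z' # v \<in> words p (length ?q)" "u @ z # v \<in> words p (length ?r)"
      using that by (auto simp: words_def)
    ultimately show ?thesis by (simp add: pvec_def)
  qed
  have tw_gen: "gen z1 (tw ?d y) \<approx> gen (tw ?d z1) y" if "z1 \<in> Jset p" "y \<in> Jset p" for z1 y
    using bar[of z1 "conj_idx y"] that by (auto simp: tw_def intro: eqv_sym)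
  have "(\<Sum>y\<in>words p (?a + Suc (Suc ?b)). sc (pvec p ?q y) * mon (zip z y)) \<approx> sc (pvec p ?q z)"
    if z: "z \<in> words p (?a + Suc (Suc ?b))" for z
  proof -
    obtain u z1 v1 where z1: "z = u @ z1 # v1" "length u = ?a" "u \<in> words p ?a" "z1 \<in> Jset p" "v1 \<in> words p (Suc ?b)"
      by (rule words_splitE[OF z, of ?a]) auto
    obtain z2 v where v1: "v1 = z2 # v" "z2 \<in> Jset p" "v \<in> words p ?b"
      using z1(5) by (cases v1) (auto simp: words_def)
    note z' = z1(2-4) v1
    let ?m = "\<lambda>u' y v'. sc (pvec p ?r (u' @ y # v'))"
    have "(\<Sum>y\<in>words p (?a + Suc (Suc ?b)). sc (pvec p ?q y) * mon (zip z y)) =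
        (\<Sum>u'\<in>words p ?a. \<Sum>y\<in>Jset p. \<Sum>y2\<in>Jset p. \<Sum>v'\<in>words p ?b.
          sc (pvec p ?q (u' @ y # y2 # v')) * (mon (zip u u') * (gen z1 y * gen z2 y2) * mon (zip v v')))"
      unfolding sum_words_mid sum_words_Suc
      by (intro sum.cong refl)
        (use z' z1 in \<open>simp add: words_length mon_mult\<close>)
    also have "\<dots> = (\<Sum>u'\<in>words p ?a. \<Sum>y\<in>Jset p. \<Sum>v'\<in>words p ?b. \<Sum>y2\<in>Jset p.
          if y2 = tw ?d y then ?m u' y v' * (mon (zip u u') * (gen z1 y * gen z2 y2) * mon (zip v v')) else 0)"
    proof (intro sum.cong[OF refl])
      fix u' y assume "u' \<in> words p ?a" "y \<in> Jset p"
      then show "(\<Sum>y2\<in>Jset p. \<Sum>v'\<in>words p ?b.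
            sc (pvec p ?q (u' @ y # y2 # v')) * (mon (zip u u') * (gen z1 y * gen z2 y2) * mon (zip v v'))) =
          (\<Sum>v'\<in>words p ?b. \<Sum>y2\<in>Jset p.
          if y2 = tw ?d y then ?m u' y v' * (mon (zip u u') * (gen z1 y * gen z2 y2) * mon (zip v v')) else 0)"
        by (subst sum.swap) (intro sum.cong refl, simp only: pv, simp add: sc_zero)
    qed
    also have "\<dots> = (\<Sum>u'\<in>words p ?a. \<Sum>y\<in>Jset p. \<Sum>v'\<in>words p ?b.
          ?m u' y v' * (mon (zip u u') * (gen z1 y * gen z2 (tw ?d y)) * mon (zip v v')))"
      by (intro sum.cong refl) (simp add: sum.delta)
    also have "\<dots> \<approx> (\<Sum>u'\<in>words p ?a. \<Sum>y\<in>Jset p. \<Sum>v'\<in>words p ?b.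
          ?m u' y v' * (mon (zip u u') * (gen z1 y * gen (tw ?d z2) y) * mon (zip v v')))"
      by (intro eqv_sum eqv_mult_left eqv_mult_right tw_gen z')
    also have "\<dots> \<approx> (\<Sum>u'\<in>words p ?a. \<Sum>y\<in>Jset p. \<Sum>v'\<in>words p ?b.
          ?m u' y v' * (mon (zip u u') * (if z1 = tw ?d z2 then gen z1 y else 0) * mon (zip v v')))"
      by (intro eqv_sum eqv_mult_left eqv_mult_right col) (use z' in simp_all)
    also have "\<dots> \<approx> (if z1 = tw ?d z2 then sc (pvec p ?r (u @ z1 # v)) else 0)"
    proof (cases "z1 = tw ?d z2")
      case True
      have "(\<Sum>u'\<in>words p ?a. \<Sum>y\<in>Jset p. \<Sum>v'\<in>words p ?b. ?m u' y v' * (mon (zip u u') * gen z1 y * mon (zip v v')))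
          = (\<Sum>y\<in>words p (?a + Suc ?b). sc (pvec p ?r y) * mon (zip (u @ z1 # v) y))"
        unfolding sum_words_mid
        by (intro sum.cong refl) (use z' in \<open>simp add: words_length mon_mult\<close>)
      also have "\<dots> \<approx> sc (pvec p ?r (u @ z1 # v))"
        by (rule IH) (use z' in \<open>auto simp: words_def\<close>)
      finally show ?thesis using True by simp
    qed simp
    also have "\<dots> = sc (pvec p ?q z)"
      using z' z1(1) pv[of u z1 z2 v] by (auto simp: tw_tw sc_zero)
    finally show ?thesis .
  qed
  then show ?case by (simp add: fix_space_def pvec_def)
qed

theorem F_subset_fix_space: "F p n \<subseteq> fix_space n"
proof
  fix f assume "f \<in> F p n"
  then show "f \<in> fix_space n"
  proof (induction rule: F_induct)
    case (base q)
    then show ?case using pvec_in_fix_space by auto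
  next
    case (add f g)
    then show ?case
      by (auto simp: fix_space_def sc_add distrib_right sum.distrib intro: eqv_add)
  next
    case (scale c f)
    have "(\<Sum>y\<in>words p n. sc (c * f y) * mon (zip z y)) = sc c * (\<Sum>y\<in>words p n. sc (f y) * mon (zip z y))" for z
      by (simp add: sc_mult sum_distrib_left mult.assoc)
    then show ?case using scale by (auto simp: fix_space_def sc_mult intro: eqv_mult_left)
  qed (simp add: fix_space_def sc_zero)
qed

lemma word_unitary_right:
  "x \<in> words p k \<Longrightarrow> i \<in> words p k \<Longrightarrow>
    (\<Sum>y\<in>words p k. mon (zip x y) * mon (rev (zip i y))) \<approx> (if x = i then 1 else 0)"
proof (induction k arbitrary: x i)
  case 0
  then show ?case by (simp add: mon_Nil)
next
  case (Suc k)
  obtain a x' where x: "x = a # x'" "a \<in> Jset p" "x' \<in> words p k"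
    using Suc.prems(1) by (cases x) (auto simp: words_def)
  obtain a' i' where i: "i = a' # i'" "a' \<in> Jset p" "i' \<in> words p k"
    using Suc.prems(2) by (cases i) (auto simp: words_def)
  have "(\<Sum>y\<in>words p (Suc k). mon (zip x y) * mon (rev (zip i y))) =
      (\<Sum>b\<in>Jset p. gen a b * (\<Sum>y\<in>words p k. mon (zip x' y) * mon (rev (zip i' y))) * gen a' b)"
    unfolding sum_words_Suc
    by (simp add: x i sum_distrib_left sum_distrib_right mon_mult)
  also have "\<dots> \<approx> (\<Sum>b\<in>Jset p. gen a b * (if x' = i' then 1 else 0) * gen a' b)"
    by (intro eqv_sum eqv_mult_left eqv_mult_right Suc.IH x i)
  also have "\<dots> = (\<Sum>b\<in>Jset p. (if x' = i' then 1 else 0) * (gen a b * gen a' b))"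
    by (auto intro: sum.cong)
  also have "\<dots> \<approx> (\<Sum>b\<in>Jset p. (if x' = i' then 1 else 0) * (if a = a' then gen a b else 0))"
    by (intro eqv_sum eqv_mult_left col x i)
  also have "\<dots> = (if x = i then (\<Sum>b\<in>Jset p. gen a b) else 0)"
    by (auto simp: x i)
  also have "\<dots> \<approx> (if x = i then 1 else 0)" using row_sum[OF x(2)] by simp
  finally show ?case .
qed

lemma word_unitary_left:
  "y \<in> words p k \<Longrightarrow> w \<in> words p k \<Longrightarrow>
    (\<Sum>x\<in>words p k. mon (rev (zip x y)) * mon (zip x w)) \<approx> (if y = w then 1 else 0)"
proof (induction k arbitrary: y w)
  case 0
  then show ?case by (simp add: mon_Nil)
next
  case (Suc k)
  obtain b y' where y: "y = b # y'" "b \<in> Jset p" "y' \<in> words p k"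
    using Suc.prems(1) by (cases y) (auto simp: words_def)
  obtain b' w' where w: "w = b' # w'" "b' \<in> Jset p" "w' \<in> words p k"
    using Suc.prems(2) by (cases w) (auto simp: words_def)
  have "(\<Sum>x\<in>words p (Suc k). mon (rev (zip x y)) * mon (zip x w)) =
      (\<Sum>x\<in>words p k. mon (rev (zip x y')) * (\<Sum>a\<in>Jset p. gen a b * gen a b') * mon (zip x w'))"
    unfolding sum_words_Suc
    by (subst sum.swap) (simp add: y w sum_distrib_left sum_distrib_right mon_mult)
  also have "\<dots> \<approx> (\<Sum>x\<in>words p k. mon (rev (zip x y')) * (\<Sum>a\<in>Jset p. if b = b' then gen a b else 0) * mon (zip x w'))"
    by (intro eqv_sum eqv_mult_left eqv_mult_right row y w)
  also have "\<dots> \<approx> (\<Sum>x\<in>words p k. mon (rev (zip x y')) * (if b = b' then 1 else 0) * mon (zip x w'))"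
    using col_sum[OF y(2)] by (intro eqv_sum eqv_mult_left eqv_mult_right) auto
  also have "\<dots> = (if b = b' then 1 else 0) * (\<Sum>x\<in>words p k. mon (rev (zip x y')) * mon (zip x w'))"
    by simp
  also have "\<dots> \<approx> (if b = b' then 1 else 0) * (if y' = w' then 1 else 0)"
    by (intro eqv_mult_left Suc.IH y w)
  also have "\<dots> = (if y = w then 1 else 0)" by (simp add: y w)
  finally show ?case .
qed

definition intertwines :: "nat \<Rightarrow> nat \<Rightarrow> (idx list \<Rightarrow> idx list \<Rightarrow> complex) \<Rightarrow> bool" where
  "intertwines k l t \<longleftrightarrow> (\<forall>j\<in>words p l. \<forall>i\<in>words p k.
     (\<Sum>x\<in>words p k. sc (t j x) * mon (zip x i)) \<approx> (\<Sum>x\<in>words p l. sc (t x i) * mon (zip j x)))"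

lemma bend_apply: "j \<in> words p l \<Longrightarrow> i \<in> words p k \<Longrightarrow> bend p k l t (j @ rev i) = t j i"
  by (auto simp: bend_def words_def)

lemma bend_sum:
  assumes "j \<in> words p l" "i \<in> words p k"
  shows "(\<Sum>y\<in>words p (l + k). sc (bend p k l t y) * mon (zip (j @ rev i) y)) =
    (\<Sum>i'\<in>words p k. \<Sum>j'\<in>words p l. sc (t j' i') * (mon (zip j j') * mon (rev (zip i i'))))"
proof -
  have "(\<Sum>y\<in>words p (l + k). sc (bend p k l t y) * mon (zip (j @ rev i) y)) =
      (\<Sum>j'\<in>words p l. \<Sum>i'\<in>words p k. sc (bend p k l t (j' @ i')) * mon (zip (j @ rev i) (j' @ i')))"
    by (rule sum_words_append)
  also have "\<dots> = (\<Sum>j'\<in>words p l. \<Sum>i'\<in>words p k. sc (bend p k l t (j' @ rev i')) * mon (zip (j @ rev i) (j' @ rev i')))"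
    by (rule sum.cong[OF refl]) (rule sum.reindex_bij_witness[where i = rev and j = rev]; simp)
  also have "\<dots> = (\<Sum>j'\<in>words p l. \<Sum>i'\<in>words p k. sc (t j' i') * (mon (zip j j') * mon (rev (zip i i'))))"
    using assms by (intro sum.cong refl) (simp add: bend_apply mon_mult words_length zip_rev)
  also have "\<dots> = (\<Sum>i'\<in>words p k. \<Sum>j'\<in>words p l. sc (t j' i') * (mon (zip j j') * mon (rev (zip i i'))))"
    by (rule sum.swap)
  finally show ?thesis .
qed

lemma bend_fix_space_iff:
  "bend p k l t \<in> fix_space (l + k) \<longleftrightarrow> (\<forall>j\<in>words p l. \<forall>i\<in>words p k.
     (\<Sum>i'\<in>words p k. \<Sum>j'\<in>words p l. sc (t j' i') * (mon (zip j j') * mon (rev (zip i i')))) \<approx> sc (t j i))"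
proof -
  have "(\<forall>z\<in>words p (l + k). P z) \<longleftrightarrow> (\<forall>j\<in>words p l. \<forall>i\<in>words p k. P (j @ rev i))" for P
  proof (intro iffI ballI)
    fix z assume *: "\<forall>j\<in>words p l. \<forall>i\<in>words p k. P (j @ rev i)" and z: "z \<in> words p (l + k)"
    have "take l z \<in> words p l" "rev (drop l z) \<in> words p k"
      using z by (auto simp: words_def dest: in_set_takeD in_set_dropD)
    then have "P (take l z @ rev (rev (drop l z)))" using * by blast
    then show "P z" by simp
  next
    fix j i assume "\<forall>z\<in>words p (l + k). P z" "j \<in> words p l" "i \<in> words p k"
    moreover have "j @ rev i \<in> words p (l + k)" using calculation by (auto simp: words_def)
    ultimately show "P (j @ rev i)" by blast
  qed
  note all = this
  have supp: "\<forall>w. w \<notin> words p (l + k) \<longrightarrow> bend p k l t w = 0" by (simp add: bend_def)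
  show ?thesis unfolding fix_space_def mem_Collect_eq all using supp
    by (simp add: bend_sum bend_apply cong: ball_cong)
qed

text \<open>Frobenius reciprocity: multiplying the intertwining relation by the adjoints of the entries of the \<open>k\<close>-th tensor power and
summing moves these entries to the other side, by unitarity.\<close>

theorem intertwines_iff_fixed: "intertwines k l t \<longleftrightarrow> bend p k l t \<in> fix_space (l + k)"
proof
  assume int: "intertwines k l t"
  show "bend p k l t \<in> fix_space (l + k)"
    unfolding bend_fix_space_iff
  proof (intro ballI)
    fix j i assume ji: "j \<in> words p l" "i \<in> words p k"
    have "(\<Sum>i'\<in>words p k. \<Sum>j'\<in>words p l. sc (t j' i') * (mon (zip j j') * mon (rev (zip i i')))) =
        (\<Sum>i'\<in>words p k. (\<Sum>j'\<in>words p l. sc (t j' i') * mon (zip j j')) * mon (rev (zip i i')))"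
      by (simp add: sum_distrib_right mult.assoc)
    also have "\<dots> \<approx> (\<Sum>i'\<in>words p k. (\<Sum>x\<in>words p k. sc (t j x) * mon (zip x i')) * mon (rev (zip i i')))"
      using int ji unfolding intertwines_def by (intro eqv_sum eqv_mult_right) (blast intro: eqv_sym)
    also have "\<dots> = (\<Sum>x\<in>words p k. sc (t j x) * (\<Sum>i'\<in>words p k. mon (zip x i') * mon (rev (zip i i'))))"
      unfolding sum_distrib_right sum_distrib_left by (subst sum.swap) (simp only: mult.assoc)
    also have "\<dots> \<approx> (\<Sum>x\<in>words p k. sc (t j x) * (if x = i then 1 else 0))"
      by (intro eqv_sum eqv_mult_left word_unitary_right ji)
    also have "\<dots> = (\<Sum>x\<in>words p k. if x = i then sc (t j i) else 0)"
      by (intro sum.cong) auto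
    also have "\<dots> = sc (t j i)" using ji finite_words by (simp add: sum.delta)
    finally show "(\<Sum>i'\<in>words p k. \<Sum>j'\<in>words p l. sc (t j' i') * (mon (zip j j') * mon (rev (zip i i')))) \<approx> sc (t j i)" .
  qed
next
  assume fixed: "bend p k l t \<in> fix_space (l + k)"
  show "intertwines k l t"
    unfolding intertwines_def
  proof (intro ballI, rule eqv_sym)
    fix j w assume jw: "j \<in> words p l" "w \<in> words p k"
    have "(\<Sum>x\<in>words p l. sc (t x w) * mon (zip j x)) =
        (\<Sum>i'\<in>words p k. if i' = w then (\<Sum>x\<in>words p l. sc (t x w) * mon (zip j x)) else 0)"
      using jw finite_words by (simp add: sum.delta)
    also have "\<dots> = (\<Sum>i'\<in>words p k. (\<Sum>j'\<in>words p l. sc (t j' i') * mon (zip j j')) * (if i' = w then 1 else 0))"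
      by (intro sum.cong) auto
    also have "\<dots> \<approx> (\<Sum>i'\<in>words p k. (\<Sum>j'\<in>words p l. sc (t j' i') * mon (zip j j')) *
        (\<Sum>i\<in>words p k. mon (rev (zip i i')) * mon (zip i w)))"
      by (intro eqv_sum eqv_mult_left eqv_sym[OF word_unitary_left] jw)
    also have "\<dots> = (\<Sum>i\<in>words p k. (\<Sum>i'\<in>words p k. \<Sum>j'\<in>words p l.
        sc (t j' i') * (mon (zip j j') * mon (rev (zip i i')))) * mon (zip i w))"
      unfolding sum_distrib_left sum_distrib_right
      by (subst sum.swap) (intro sum.cong refl, simp only: mult.assoc)
    also have "\<dots> \<approx> (\<Sum>i\<in>words p k. sc (t j i) * mon (zip i w))"
      using fixed jw unfolding bend_fix_space_iff by (intro eqv_sum eqv_mult_right) blast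
    finally show "(\<Sum>x\<in>words p l. sc (t x w) * mon (zip j x)) \<approx> (\<Sum>x\<in>words p k. sc (t j x) * mon (zip x w))" .
  qed
qed

end

text \<open>Applying the Haar functional to the equation of a fixed vector gives the equation of the range of the projection.\<close>

lemma fix_space_haar:
  "magic.fix_space p (haar_ideal p) n \<subseteq> F p n"
proof
  interpret magic p "haar_ideal p" by standard (rule magic_haar_ideal)
  fix f assume f: "f \<in> fix_space n"
  show "f \<in> F p n"
  proof (rule nc_kernel_fixed)
    show "w \<notin> words p n \<Longrightarrow> f w = 0" for w using f by (simp add: fix_space_def)
    fix z assume z: "z \<in> words p n"
    have "(\<Sum>y\<in>words p n. sc (f y) * mon (zip z y)) - sc (f z) * mon [] \<in> haar_ideal p"
      using f z by (simp add: fix_space_def eqv_def mon_Nil)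
    then have "haar p (1 * ((\<Sum>y\<in>words p n. sc (f y) * mon (zip z y)) - sc (f z) * mon []) * 1) = 0"
      unfolding haar_ideal_def by blast
    then have "(\<Sum>y\<in>words p n. f y * haar_word p (zip z y)) = f z"
      by (simp add: lext_diff lext_sum lext_mon haar_word_Nil)
    moreover have "haar_word p (zip z y) = nc_kernel p n z y" if "y \<in> words p n" for y
      using that z by (simp add: haar_word_def words_length)
    ultimately show "(\<Sum>y\<in>words p n. nc_kernel p n z y * f y) = f z"
      by (simp add: mult.commute cong: sum.cong)
  qed
qed

section \<open>Marked partitions as patterns\<close>
text \<open>After bending, the points are read along the boundary of the diagram: first the lower row from left to right, then the
upper row from right to left. This is the order opposite to \<^const>\<open>position\<close>.\<close>

definition pt :: "nat \<Rightarrow> nat \<Rightarrow> nat \<Rightarrow> point" where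
  "pt k l n = (if n < l then Inr n else Inl (k - Suc (n - l)))"

definition ix :: "nat \<Rightarrow> nat \<Rightarrow> point \<Rightarrow> nat" where
  "ix k l x = (case x of Inl a \<Rightarrow> l + (k - Suc a) | Inr b \<Rightarrow> b)"

lemma points_cases:
  assumes "x \<in> points k l"
  obtains a where "x = Inl a" "a < k" | b where "x = Inr b" "b < l"
  using assms by (auto simp: points_def)

lemma pt_points: "n < l + k \<Longrightarrow> pt k l n \<in> points k l"
  by (auto simp: pt_def points_def)

lemma ix_less: "x \<in> points k l \<Longrightarrow> ix k l x < l + k"
  by (auto elim!: points_cases simp: ix_def)

lemma pt_ix: "x \<in> points k l \<Longrightarrow> pt k l (ix k l x) = x"
  by (auto elim!: points_cases simp: ix_def pt_def)

lemma ix_pt: "n < l + k \<Longrightarrow> ix k l (pt k l n) = n"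
  by (auto simp: ix_def pt_def)

lemma position_ix: "x \<in> points k l \<Longrightarrow> position k l x = k + l - Suc (ix k l x)"
  by (auto elim!: points_cases simp: ix_def)

lemma position_less_iff:
  "x \<in> points k l \<Longrightarrow> y \<in> points k l \<Longrightarrow> position k l x < position k l y \<longleftrightarrow> ix k l y < ix k l x"
  using ix_less[of x k l] ix_less[of y k l] by (auto simp: position_ix)

lemma label_ix:
  assumes "i \<in> words p k" "j \<in> words p l" "x \<in> points k l"
  shows "label i j x = (j @ rev i) ! ix k l x"
  using assms(3)
proof (cases rule: points_cases)
  case (1 a)
  then show ?thesis using assms by (auto simp: label_def ix_def words_def nth_append rev_nth)
next
  case (2 b)
  then show ?thesis using assms by (simp add: label_def ix_def words_def nth_append)
qed

definition describes :: "nat \<Rightarrow> nat \<Rightarrow> pattern \<Rightarrow> marked \<Rightarrow> bool" where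
  "describes k l q m \<longleftrightarrow> length q = l + k \<and> m \<in> marked_partitions k l \<and>
     (\<forall>x\<in>points k l. \<forall>y\<in>points k l. fst (q ! ix k l x) = fst (q ! ix k l y) \<longleftrightarrow> (\<exists>B\<in>fst m. x \<in> B \<and> y \<in> B)) \<and>
     (\<forall>x\<in>points k l. snd (q ! ix k l x) \<longleftrightarrow> snd m x = White)"

lemma swap_colour_neq: "(c = White) \<noteq> (d = White) \<longleftrightarrow> c \<noteq> d"
  by (cases c; cases d) auto

lemma tw_flip: "tw (a \<noteq> b) (tw b z) = tw a z"
  by (auto simp: tw_def)

lemma describes_delta:
  assumes "describes k l q m" "i \<in> words p k" "j \<in> words p l"
  shows "delta_marked m i j \<longleftrightarrow> pat q (j @ rev i)"
proof -
  let ?w = "j @ rev i"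
  obtain P c where m: "m = (P, c)" by (cases m)
  have len: "length q = l + k" "length ?w = l + k" using assms by (auto simp: describes_def words_def)
  have part: "partition_on (points k l) P"
    using assms(1) by (auto simp: describes_def marked_partitions_def m)
  have blocks: "fst (q ! ix k l x) = fst (q ! ix k l y) \<longleftrightarrow> (\<exists>B\<in>P. x \<in> B \<and> y \<in> B)"
    and colour: "snd (q ! ix k l x) \<longleftrightarrow> c x = White"
    if "x \<in> points k l" "y \<in> points k l" for x y
    using assms(1) that by (auto simp: describes_def m)
  have pat_iff: "pat q ?w \<longleftrightarrow> (\<exists>g. \<forall>n<l + k. ?w ! n = tw (snd (q ! n)) (g (fst (q ! n))))"
    unfolding pat_def list_eq_iff_nth_eq using len by (auto simp: case_prod_beta)
  show ?thesis
  proof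
    assume "pat q ?w"
    then obtain g where g: "\<And>n. n < l + k \<Longrightarrow> ?w ! n = tw (snd (q ! n)) (g (fst (q ! n)))"
      unfolding pat_iff by blast
    show "delta_marked m i j"
      unfolding delta_marked_def m fst_conv snd_conv
    proof (intro ballI)
      fix B x y assume B: "B \<in> P" "x \<in> B" "y \<in> B"
      then have xy: "x \<in> points k l" "y \<in> points k l" using part by (auto simp: partition_on_def)
      have "fst (q ! ix k l x) = fst (q ! ix k l y)" using blocks[OF xy] B by blast
      then have "label i j x = tw (c x = White) (g (fst (q ! ix k l y)))"
        "label i j y = tw (c y = White) (g (fst (q ! ix k l y)))"
        using g[OF ix_less[OF xy(1)]] g[OF ix_less[OF xy(2)]] colour[OF xy] colour[OF xy(2) xy(1)]
          label_ix[OF assms(2,3)] xy by simp_all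
      then have "label i j x = tw ((c x = White) \<noteq> (c y = White)) (label i j y)"
        by (simp only: tw_flip)
      then show "label i j x = (if c x = c y then label i j y else conj_idx (label i j y))"
        unfolding swap_colour_neq by (simp add: tw_def)
    qed
  next
    assume delta: "delta_marked m i j"
    define g where "g b = (let n = (SOME n. n < l + k \<and> fst (q ! n) = b) in tw (snd (q ! n)) (?w ! n))" for b
    have "?w ! n = tw (snd (q ! n)) (g (fst (q ! n)))" if n: "n < l + k" for n
    proof -
      define r where "r = (SOME r. r < l + k \<and> fst (q ! r) = fst (q ! n))"
      have r: "r < l + k" "fst (q ! r) = fst (q ! n)"
        using someI[of "\<lambda>r. r < l + k \<and> fst (q ! r) = fst (q ! n)" n] n by (auto simp: r_def)
      define x y where "x = pt k l n" and "y = pt k l r"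
      have xy: "x \<in> points k l" "y \<in> points k l" "ix k l x = n" "ix k l y = r"
        using n r by (simp_all add: x_def y_def pt_points ix_pt)
      obtain B where B: "B \<in> P" "x \<in> B" "y \<in> B" using blocks[OF xy(1,2)] xy r by auto
      have "label i j x = (if c x = c y then label i j y else conj_idx (label i j y))"
        by (rule delta[unfolded delta_marked_def m fst_conv snd_conv, rule_format, OF B])
      then have "label i j x = tw ((c x = White) \<noteq> (c y = White)) (label i j y)"
        unfolding swap_colour_neq by (simp add: tw_def)
      moreover have "label i j x = ?w ! n" "label i j y = ?w ! r"
        using label_ix[OF assms(2,3)] xy by simp_all
      moreover have "snd (q ! n) \<longleftrightarrow> c x = White" "snd (q ! r) \<longleftrightarrow> c y = White"
        using colour[OF xy(1,2)] colour[OF xy(2,1)] xy by simp_all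
      ultimately have "?w ! n = tw (snd (q ! n)) (tw (snd (q ! r)) (?w ! r))"
        by (simp add: tw_tw)
      then show ?thesis by (simp add: g_def r_def Let_def)
    qed
    then show "pat q ?w" unfolding pat_iff by blast
  qed
qed

lemma describes_nc:
  assumes "describes k l q m"
  shows "noncrossing k l (fst m) \<longleftrightarrow> nc q"
proof -
  obtain P c where m: "m = (P, c)" by (cases m)
  have len: "length q = l + k" using assms by (simp add: describes_def)
  have part: "partition_on (points k l) P"
    using assms by (auto simp: describes_def marked_partitions_def m)
  have blocks: "fst (q ! ix k l x) = fst (q ! ix k l y) \<longleftrightarrow> (\<exists>B\<in>P. x \<in> B \<and> y \<in> B)"
    if "x \<in> points k l" "y \<in> points k l" for x y
    using assms that by (auto simp: describes_def m)
  have unique: "B = C" if "B \<in> P" "C \<in> P" "x \<in> B" "x \<in> C" for B C x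
    using part that unfolding partition_on_def disjoint_def by blast
  have sub: "x \<in> points k l" if "B \<in> P" "x \<in> B" for B x
    using part that by (auto simp: partition_on_def)
  show ?thesis
  proof
    assume ncP: "noncrossing k l (fst m)"
    show "nc q"
      unfolding nc_def
    proof (intro allI impI, elim conjE)
      fix a b c' d
      assume *: "a < b" "b < c'" "c' < d" "d < length q" "fst (q ! a) = fst (q ! c')" "fst (q ! b) = fst (q ! d)"
      have lt: "a < l + k" "b < l + k" "c' < l + k" "d < l + k" using * len by auto
      note pts = pt_points[OF lt(1)] pt_points[OF lt(2)] pt_points[OF lt(3)] pt_points[OF lt(4)]
      note ixs = ix_pt[OF lt(1)] ix_pt[OF lt(2)] ix_pt[OF lt(3)] ix_pt[OF lt(4)]
      obtain B where B: "B \<in> P" "pt k l a \<in> B" "pt k l c' \<in> B"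
        using blocks[OF pts(1,3)] ixs * by auto
      obtain C where C: "C \<in> P" "pt k l b \<in> C" "pt k l d \<in> C"
        using blocks[OF pts(2,4)] ixs * by auto
      have "position k l (pt k l d) < position k l (pt k l c')"
        "position k l (pt k l c') < position k l (pt k l b)"
        "position k l (pt k l b) < position k l (pt k l a)"
        using pts ixs * by (simp_all add: position_less_iff)
      then have "C = B"
        by (intro ncP[unfolded noncrossing_def m fst_conv, rule_format, OF C(1) B(1) C(3) B(3) C(2) B(2)] conjI)
      then show "fst (q ! a) = fst (q ! b)"
        using blocks[OF pts(1,2)] ixs B C by auto
    qed
  next
    assume ncq: "nc q"
    show "noncrossing k l (fst m)"
      unfolding noncrossing_def m fst_conv
    proof (intro ballI impI, elim conjE)
      fix B C a b c' d
      assume B: "B \<in> P" "a \<in> B" "c' \<in> B" and C: "C \<in> P" "b \<in> C" "d \<in> C"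
        and pos: "position k l a < position k l b" "position k l b < position k l c'" "position k l c' < position k l d"
      have pts: "a \<in> points k l" "b \<in> points k l" "c' \<in> points k l" "d \<in> points k l"
        using sub B C by blast+
      have "ix k l d < ix k l c'" "ix k l c' < ix k l b" "ix k l b < ix k l a" "ix k l a < length q"
        using pos pts ix_less[of a k l] len by (simp_all add: position_less_iff)
      moreover have "fst (q ! ix k l d) = fst (q ! ix k l b)" "fst (q ! ix k l c') = fst (q ! ix k l a)"
        unfolding blocks[OF pts(4,2)] blocks[OF pts(3,1)] using B C by blast+
      ultimately have "fst (q ! ix k l d) = fst (q ! ix k l c')" by (rule ncD[OF ncq])
      then obtain D where "D \<in> P" "d \<in> D" "c' \<in> D" using blocks[OF pts(4,3)] by blast
      then show "B = C" using unique B C by metis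
    qed
  qed
qed

lemma describing_pattern_exists:
  assumes m: "m \<in> marked_partitions k l"
  shows "\<exists>q. describes k l q m"
proof -
  obtain P c where Pc: "m = (P, c)" "partition_on (points k l) P" using m by (auto simp: marked_partitions_def)
  have finP: "finite P" using finite_elements[OF _ Pc(2)] by (simp add: points_def)
  obtain num :: "point set \<Rightarrow> nat" where num: "inj_on num P"
    using finite_imp_inj_to_nat_seg[OF finP] by auto
  define blk where "blk x = (THE B. B \<in> P \<and> x \<in> B)" for x
  have blk: "blk x \<in> P" "x \<in> blk x" "\<And>B. B \<in> P \<Longrightarrow> x \<in> B \<Longrightarrow> B = blk x" if "x \<in> points k l" for x
  proof -
    have "\<exists>!B. B \<in> P \<and> x \<in> B"
      using Pc(2) that unfolding partition_on_def disjoint_def by blast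
    from theI'[OF this] this show "blk x \<in> P" "x \<in> blk x" "\<And>B. B \<in> P \<Longrightarrow> x \<in> B \<Longrightarrow> B = blk x"
      unfolding blk_def by auto
  qed
  define q where "q = map (\<lambda>n. (num (blk (pt k l n)), c (pt k l n) = White)) [0..<l + k]"
  have q: "q ! ix k l x = (num (blk x), c x = White)" if "x \<in> points k l" for x
    using ix_less[OF that] pt_ix[OF that] by (simp add: q_def)
  have "fst (q ! ix k l x) = fst (q ! ix k l y) \<longleftrightarrow> (\<exists>B\<in>P. x \<in> B \<and> y \<in> B)"
    if xy: "x \<in> points k l" "y \<in> points k l" for x y
  proof -
    have "fst (q ! ix k l x) = fst (q ! ix k l y) \<longleftrightarrow> blk x = blk y"
      using q xy blk(1) num by (simp add: inj_on_eq_iff)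
    also have "\<dots> \<longleftrightarrow> (\<exists>B\<in>P. x \<in> B \<and> y \<in> B)"
      using blk[OF xy(1)] blk[OF xy(2)] by metis
    finally show ?thesis .
  qed
  moreover have "length q = l + k" by (simp add: q_def)
  ultimately have "describes k l q m" using m q by (simp add: describes_def Pc)
  then show ?thesis ..
qed

lemma described_partition_exists:
  assumes "length q = l + k"
  shows "\<exists>m. describes k l q m"
proof -
  define cls where "cls x = {y \<in> points k l. fst (q ! ix k l y) = fst (q ! ix k l x)}" for x
  define P where "P = cls ` points k l"
  define c where "c = (\<lambda>x\<in>points k l. if snd (q ! ix k l x) then White else Black)"
  have "partition_on (points k l) P"
    unfolding partition_on_def disjoint_def P_def cls_def by auto
  then have "(P, c) \<in> marked_partitions k l"
    by (auto simp: marked_partitions_def c_def)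
  moreover have "fst (q ! ix k l x) = fst (q ! ix k l y) \<longleftrightarrow> (\<exists>B\<in>P. x \<in> B \<and> y \<in> B)"
    if "x \<in> points k l" "y \<in> points k l" for x y
    using that unfolding P_def cls_def by auto
  ultimately have "describes k l q (P, c)"
    using assms by (auto simp: describes_def c_def)
  then show ?thesis ..
qed

lemma NC_bullet_pattern:
  assumes "\<pi> \<in> NC_bullet k l"
  shows "\<exists>q. nc q \<and> length q = l + k \<and>
    (\<forall>i\<in>words p k. \<forall>j\<in>words p l. delta_bullet \<pi> i j = pvec p q (j @ rev i))"
proof -
  have \<pi>: "\<pi> \<in> P_bullet k l" "\<forall>(P, c)\<in>\<pi>. noncrossing k l P" using assms by (auto simp: NC_bullet_def)
  then obtain m where m: "m \<in> marked_partitions k l" "\<pi> = recolouring k l `` {m}"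
    unfolding P_bullet_def by (elim quotientE)
  have m\<pi>: "m \<in> \<pi>" using equiv_class_self[OF equiv_recolouring m(1)] m(2) by simp
  obtain q where q: "describes k l q m" using describing_pattern_exists[OF m(1)] by blast
  have "nc q" using \<pi>(2) m\<pi> describes_nc[OF q] by auto
  moreover have len: "length q = l + k" using q by (simp add: describes_def)
  moreover have "delta_bullet \<pi> i j = pvec p q (j @ rev i)" if "i \<in> words p k" "j \<in> words p l" for i j
    using delta_bullet_eq[OF \<pi>(1) m\<pi>] describes_delta[OF q that] that len
    by (auto simp: pvec_def words_def)
  ultimately show ?thesis by blast
qed

lemma pattern_NC_bullet:
  assumes "nc q" "length q = l + k"
  shows "\<exists>\<pi>\<in>NC_bullet k l. \<forall>i\<in>words p k. \<forall>j\<in>words p l. delta_bullet \<pi> i j = pvec p q (j @ rev i)"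
proof -
  obtain m where q: "describes k l q m" using described_partition_exists[OF assms(2)] by blast
  then have m: "m \<in> marked_partitions k l" by (simp add: describes_def)
  define \<pi> where "\<pi> = recolouring k l `` {m}"
  have \<pi>: "\<pi> \<in> P_bullet k l" unfolding P_bullet_def \<pi>_def by (rule quotientI[OF m])
  have m\<pi>: "m \<in> \<pi>" unfolding \<pi>_def by (rule equiv_class_self[OF equiv_recolouring m])
  have "noncrossing k l (fst m)" using describes_nc[OF q] assms by simp
  then have "\<forall>(P, c)\<in>\<pi>. noncrossing k l P" by (auto simp: \<pi>_def recolouring_def)
  then have "\<pi> \<in> NC_bullet k l" using \<pi> by (simp add: NC_bullet_def)
  moreover have "delta_bullet \<pi> i j = pvec p q (j @ rev i)" if "i \<in> words p k" "j \<in> words p l" for i j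
    using delta_bullet_eq[OF \<pi> m\<pi>] describes_delta[OF q that] that assms(2)
    by (auto simp: pvec_def words_def)
  ultimately show ?thesis by blast
qed

section \<open>The intertwiner spaces\<close>

definition unbend :: "nat \<Rightarrow> nat \<Rightarrow> nat \<Rightarrow> (idx list \<Rightarrow> complex) \<Rightarrow> tvec \<Rightarrow> tvec" where
  "unbend p k l f v = (if v \<in> tensor_space p k
     then (\<lambda>w. if w \<in> words p l then \<Sum>i\<in>words p k. v i * f (w @ rev i) else 0) else 0)"

lemma basis_vec_tensor_space: "i \<in> words p k \<Longrightarrow> basis_vec i \<in> tensor_space p k"
  by (auto simp: tensor_space_def basis_vec_def)

lemma tensor_space_closed:
  "(\<lambda>_. 0) \<in> tensor_space p k"
  "v \<in> tensor_space p k \<Longrightarrow> w \<in> tensor_space p k \<Longrightarrow> v + w \<in> tensor_space p k"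
  "v \<in> tensor_space p k \<Longrightarrow> (\<lambda>x. c * v x) \<in> tensor_space p k"
  by (auto simp: tensor_space_def)

lemma unbend_linear_map: "unbend p k l f \<in> linear_maps p k l"
proof -
  have "unbend p k l f v \<in> tensor_space p l" if "v \<in> tensor_space p k" for v
    using that by (simp add: unbend_def tensor_space_def)
  moreover have "unbend p k l f (v + w) = unbend p k l f v + unbend p k l f w"
    if "v \<in> tensor_space p k" "w \<in> tensor_space p k" for v w
    using that by (auto simp: unbend_def tensor_space_closed fun_eq_iff distrib_right sum.distrib)
  moreover have "unbend p k l f (\<lambda>x. c * v x) = (\<lambda>x. c * unbend p k l f v x)" if "v \<in> tensor_space p k" for c v
    using that by (auto simp: unbend_def tensor_space_closed fun_eq_iff sum_distrib_left mult.assoc)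
  moreover have "unbend p k l f v = 0" if "v \<notin> tensor_space p k" for v
    using that by (simp add: unbend_def)
  ultimately show ?thesis by (simp add: linear_maps_def)
qed

lemma unbend_basis_vec:
  assumes "i \<in> words p k" "j \<in> words p l"
  shows "unbend p k l f (basis_vec i) j = f (j @ rev i)"
proof -
  have "(\<Sum>x\<in>words p k. basis_vec i x * f (j @ rev x)) = (\<Sum>x\<in>words p k. if x = i then f (j @ rev i) else 0)"
    by (rule sum.cong) (auto simp: basis_vec_def)
  then show ?thesis using assms by (simp add: unbend_def basis_vec_tensor_space finite_words)
qed

lemma linear_mapsD:
  assumes "T \<in> linear_maps p k l" "v \<in> tensor_space p k"
  shows "T v \<in> tensor_space p l"
    and "w \<in> tensor_space p k \<Longrightarrow> T (v + w) = T v + T w"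
    and "T (\<lambda>x. c * v x) = (\<lambda>x. c * T v x)"
  using assms unfolding linear_maps_def by simp_all

lemma linear_map_expand:
  assumes T: "T \<in> linear_maps p k l" and v: "v \<in> tensor_space p k"
  shows "T v w = (\<Sum>i\<in>words p k. v i * T (basis_vec i) w)"
proof -
  have T_zero: "T (\<lambda>_. 0) = (\<lambda>_. 0)"
    using linear_mapsD(3)[OF T tensor_space_closed(1), of 0] by simp
  have partial: "(\<lambda>x. \<Sum>i\<in>S. v i * basis_vec i x) \<in> tensor_space p k \<and>
      T (\<lambda>x. \<Sum>i\<in>S. v i * basis_vec i x) = (\<lambda>x. \<Sum>i\<in>S. v i * T (basis_vec i) x)"
    if "finite S" "S \<subseteq> words p k" for S
    using that
  proof (induction S rule: finite_induct)
    case empty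
    then show ?case using T_zero tensor_space_closed(1) by simp
  next
    case (insert i S)
    let ?a = "\<lambda>x. v i * basis_vec i x" and ?b = "\<lambda>x. \<Sum>i\<in>S. v i * basis_vec i x"
    have a: "?a \<in> tensor_space p k" "T ?a = (\<lambda>x. v i * T (basis_vec i) x)"
      using linear_mapsD(3)[OF T basis_vec_tensor_space] insert.prems
        tensor_space_closed(3)[OF basis_vec_tensor_space] by auto
    have b: "?b \<in> tensor_space p k" "T ?b = (\<lambda>x. \<Sum>i\<in>S. v i * T (basis_vec i) x)"
      using insert by auto
    have eq: "(\<lambda>x. \<Sum>i\<in>insert i S. v i * basis_vec i x) = ?a + ?b"
      using insert.hyps by (auto simp: fun_eq_iff)
    have "T (?a + ?b) = T ?a + T ?b" by (rule linear_mapsD(2)[OF T a(1) b(1)])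
    then show ?case unfolding eq using tensor_space_closed(2)[OF a(1) b(1)] a b insert.hyps
      by (auto simp: fun_eq_iff)
  qed
  have "v = (\<lambda>x. \<Sum>i\<in>words p k. v i * basis_vec i x)"
  proof
    fix x
    have "(\<Sum>i\<in>words p k. v i * basis_vec i x) = (\<Sum>i\<in>words p k. if i = x then v x else 0)"
      by (rule sum.cong) (auto simp: basis_vec_def)
    then show "v x = (\<Sum>i\<in>words p k. v i * basis_vec i x)"
      using v by (simp add: finite_words tensor_space_def)
  qed
  then have "T v = T (\<lambda>x. \<Sum>i\<in>words p k. v i * basis_vec i x)" by (rule arg_cong)
  then show ?thesis using partial[OF finite_words order_refl] by simp
qed

lemma unbend_bend:
  assumes T: "T \<in> linear_maps p k l"
  shows "unbend p k l (bend p k l (\<lambda>j i. T (basis_vec i) j)) = T"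
proof (intro ext)
  fix v w
  show "unbend p k l (bend p k l (\<lambda>j i. T (basis_vec i) j)) v w = T v w"
  proof (cases "v \<in> tensor_space p k")
    case True
    show ?thesis
    proof (cases "w \<in> words p l")
      case w: True
      have "(\<Sum>i\<in>words p k. v i * bend p k l (\<lambda>j i. T (basis_vec i) j) (w @ rev i)) =
          (\<Sum>i\<in>words p k. v i * T (basis_vec i) w)"
        using w by (intro sum.cong refl) (simp add: bend_def words_def)
      then show ?thesis using True w linear_map_expand[OF T True] by (simp add: unbend_def)
    next
      case False
      have "T v \<in> tensor_space p l" by (rule linear_mapsD(1)[OF T True])
      then show ?thesis using False True by (simp add: unbend_def tensor_space_def)
    qed
  next
    case False
    then show ?thesis using T unfolding linear_maps_def unbend_def by simp
  qed
qed

lemma T_tilde_unbend: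
  assumes "\<And>i j. i \<in> words p k \<Longrightarrow> j \<in> words p l \<Longrightarrow> delta_bullet \<pi> i j = f (j @ rev i)"
  shows "T_tilde p k l \<pi> = unbend p k l f"
proof (intro ext)
  fix v w
  have fun_sum: "(\<Sum>j\<in>S. h j) w = (\<Sum>j\<in>S. h j w)" for S and h :: "'x \<Rightarrow> idx list \<Rightarrow> complex"
    by (induction S rule: infinite_finite_induct) auto
  have "(\<Sum>j\<in>words p l. v i * delta_bullet \<pi> i j * basis_vec j w) =
      (\<Sum>j\<in>words p l. if j = w then v i * delta_bullet \<pi> i w else 0)" for i
    by (rule sum.cong) (auto simp: basis_vec_def)
  then have inner: "(\<Sum>j\<in>words p l. v i * delta_bullet \<pi> i j * basis_vec j w) =
      (if w \<in> words p l then v i * delta_bullet \<pi> i w else 0)" for i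
    by (simp add: finite_words)
  have "T_tilde p k l \<pi> v w = (if v \<in> tensor_space p k
      then \<Sum>i\<in>words p k. if w \<in> words p l then v i * delta_bullet \<pi> i w else 0 else 0)"
    by (simp only: T_tilde_def fun_sum inner if_distrib[of "\<lambda>g. g w"] zero_fun_def)
  also have "\<dots> = unbend p k l f v w"
    using assms by (simp add: unbend_def)
  finally show "T_tilde p k l \<pi> v w = unbend p k l f v w" .
qed

lemma unbend_add: "unbend p k l (\<lambda>w. f w + g w) = unbend p k l f + unbend p k l g"
  by (auto simp: fun_eq_iff unbend_def distrib_left sum.distrib)
lemma unbend_scale: "unbend p k l (\<lambda>w. c * f w) = (\<lambda>v w. c * unbend p k l f v w)"
  by (auto simp: fun_eq_iff unbend_def sum_distrib_left mult_ac)
lemma unbend_zero: "unbend p k l (\<lambda>_. 0) = 0"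
  by (auto simp: fun_eq_iff unbend_def)

lemma unbend_F: "unbend p k l ` F p (l + k) = tmap.span (T_tilde p k l ` NC_bullet k l)"
proof
  show "unbend p k l ` F p (l + k) \<subseteq> tmap.span (T_tilde p k l ` NC_bullet k l)"
  proof
    fix T assume "T \<in> unbend p k l ` F p (l + k)"
    then obtain f where f: "f \<in> F p (l + k)" "T = unbend p k l f" by blast
    have "unbend p k l f \<in> tmap.span (T_tilde p k l ` NC_bullet k l)"
      using f(1)
    proof (induction rule: F_induct)
      case zero
      then show ?case unfolding unbend_zero by (rule tmap.span_zero)
    next
      case (base q)
      then obtain \<pi> where "\<pi> \<in> NC_bullet k l"
          "\<forall>i\<in>words p k. \<forall>j\<in>words p l. delta_bullet \<pi> i j = pvec p q (j @ rev i)"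
        using pattern_NC_bullet by blast
      then have "unbend p k l (pvec p q) = T_tilde p k l \<pi>" "\<pi> \<in> NC_bullet k l"
        using T_tilde_unbend[of p k l \<pi> "pvec p q"] by auto
      then show ?case by (auto intro: tmap.span_base)
    next
      case (add f g)
      then show ?case unfolding unbend_add by (intro tmap.span_add)
    next
      case (scale c f)
      then show ?case unfolding unbend_scale by (intro tmap.span_scale)
    qed
    then show "T \<in> tmap.span (T_tilde p k l ` NC_bullet k l)" using f(2) by simp
  qed
  show "tmap.span (T_tilde p k l ` NC_bullet k l) \<subseteq> unbend p k l ` F p (l + k)"
  proof (rule tmap.span_minimal)
    show "T_tilde p k l ` NC_bullet k l \<subseteq> unbend p k l ` F p (l + k)"
    proof
      fix T assume "T \<in> T_tilde p k l ` NC_bullet k l"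
      then obtain \<pi> where \<pi>: "\<pi> \<in> NC_bullet k l" "T = T_tilde p k l \<pi>" by blast
      obtain q where q: "nc q" "length q = l + k"
          "\<forall>i\<in>words p k. \<forall>j\<in>words p l. delta_bullet \<pi> i j = pvec p q (j @ rev i)"
        using NC_bullet_pattern[OF \<pi>(1)] by blast
      then have "T = unbend p k l (pvec p q)" using T_tilde_unbend[of p k l \<pi> "pvec p q"] \<pi>(2) by simp
      then show "T \<in> unbend p k l ` F p (l + k)" using F_base[OF q(1,2)] by blast
    qed
    show "tmap.subspace (unbend p k l ` F p (l + k))"
    proof (rule tmap.subspaceI)
      show "0 \<in> unbend p k l ` F p (l + k)"
        using unbend_zero[of p k l] F_zero[of p "l + k"] by (metis imageI)
      show "x + y \<in> unbend p k l ` F p (l + k)"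
        if "x \<in> unbend p k l ` F p (l + k)" "y \<in> unbend p k l ` F p (l + k)" for x y
        using that F_add by (auto simp flip: unbend_add)
      show "(\<lambda>v w. c * x v w) \<in> unbend p k l ` F p (l + k)" if "x \<in> unbend p k l ` F p (l + k)" for c x
        using that F_scale by (auto simp flip: unbend_scale)
    qed
  qed
qed

context magic_cstar
begin

sublocale kernel: magic p "{a. ev a = \<zero>}"
  by standard (rule magic_kernel)

lemma Hom_space_iff:
  "T \<in> Hom_space p A U k l \<longleftrightarrow>
    T \<in> linear_maps p k l \<and> kernel.intertwines k l (\<lambda>j i. T (basis_vec i) j)"
proof -
  have "mat_prod A (words p k) (amplify A T) (tensor_power A U) j i =
      ev (\<Sum>x\<in>words p k. sc (T (basis_vec x) j) * mon (zip x i))" if "i \<in> words p k" for i j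
  proof -
    have "mat_prod A (words p k) (amplify A T) (tensor_power A U) j i =
        (\<Oplus>x\<in>words p k. ev (sc (T (basis_vec x) j) * mon (zip x i)))"
      unfolding mat_prod_def
      by (intro finsum_cong')
        (use that in \<open>auto simp: amplify_def tensor_power_ev ev_sc cscale_mult_left cscale_closed\<close>)
    then show ?thesis by (simp add: ev_sum)
  qed
  moreover have "mat_prod A (words p l) (tensor_power A U) (amplify A T) j i =
      ev (\<Sum>x\<in>words p l. sc (T (basis_vec i) x) * mon (zip j x))" if "j \<in> words p l" for i j
  proof -
    have "mat_prod A (words p l) (tensor_power A U) (amplify A T) j i =
        (\<Oplus>x\<in>words p l. ev (sc (T (basis_vec i) x) * mon (zip j x)))"
      unfolding mat_prod_def
      by (intro finsum_cong')
        (use that in \<open>auto simp: amplify_def tensor_power_ev ev_sc cscale_mult_right cscale_closed\<close>)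
    then show ?thesis by (simp add: ev_sum)
  qed
  ultimately show ?thesis
    by (simp add: Hom_space_def kernel.intertwines_def kernel.eqv_def ev_eq_iff[symmetric] del: mem_Collect_eq)
      (auto simp: ev_eq_iff)
qed

end

theorem theorem4p4:
  fixes p k l :: nat
    and A :: "'a cstar"
    and U :: "idx \<Rightarrow> idx \<Rightarrow> 'a"
  assumes "p \<ge> 1"
    and "universal_As p A U"
  shows "Hom_space p A U k l = tmap.span (T_tilde p k l ` NC_bullet k l)"
proof -
  interpret magic_cstar A p U by (rule universal_magic_cstar[OF assms(2)])
  interpret haar: magic p "haar_ideal p" by standard (rule magic_haar_ideal)
  have "kernel.fix_space n \<subseteq> haar.fix_space n" for n
    using kernel_in_haar_ideal[OF assms]
    by (auto simp: kernel.fix_space_def haar.fix_space_def kernel.eqv_def haar.eqv_def)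
  then have fixed: "kernel.fix_space n = F p n" for n
    using kernel.F_subset_fix_space fix_space_haar by blast
  have "Hom_space p A U k l = unbend p k l ` F p (l + k)"
  proof
    show "Hom_space p A U k l \<subseteq> unbend p k l ` F p (l + k)"
    proof
      fix T assume "T \<in> Hom_space p A U k l"
      then have T: "T \<in> linear_maps p k l" "kernel.intertwines k l (\<lambda>j i. T (basis_vec i) j)"
        by (simp_all add: Hom_space_iff)
      have "bend p k l (\<lambda>j i. T (basis_vec i) j) \<in> F p (l + k)"
        using T(2) by (simp add: kernel.intertwines_iff_fixed fixed)
      then show "T \<in> unbend p k l ` F p (l + k)"
        using unbend_bend[OF T(1)] by (metis imageI)
    qed
    show "unbend p k l ` F p (l + k) \<subseteq> Hom_space p A U k l"
    proof (rule image_subsetI)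
      fix f assume f: "f \<in> F p (l + k)"
      have "bend p k l (\<lambda>j i. unbend p k l f (basis_vec i) j) = f"
      proof
        fix w
        show "bend p k l (\<lambda>j i. unbend p k l f (basis_vec i) j) w = f w"
        proof (cases "w \<in> words p (l + k)")
          case True
          then have "take l w \<in> words p l" "rev (drop l w) \<in> words p k"
            by (auto simp: words_def dest: in_set_takeD in_set_dropD)
          then show ?thesis using True by (simp add: bend_def unbend_basis_vec)
        qed (simp add: bend_def F_support[OF f])
      qed
      then show "unbend p k l f \<in> Hom_space p A U k l"
        unfolding Hom_space_iff kernel.intertwines_iff_fixed fixed
        using f unbend_linear_map by simp
    qed
  qed
  then show ?thesis by (simp add: unbend_F)
qed

end
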